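(* Let $P$ be a partially ordered set, $X\in\mathbf{sSet}_P$ and $\mathcal J$ a flag in $P$. Then the natural inclusion $$\alpha:\mathrm{Hol}_{N(P)}(\mathcal J,|X|_{N(P)})\hookrightarrow\mathrm{Hol}_P(\mathcal J,|X|_P)$$ is a weak homotopy equivalence.
   Context: Fix a partially ordered set $P$. $\mathbf{Top}$ denotes the category of $\Delta$-generated topological spaces; $P$ carries the Alexandroff topology (closed sets = down-sets). $\mathbf{Top}_P$ is the category of spaces over $P$ with maps commuting with the structure maps (stratum preserving maps). $N(P)$ is the nerve of $P$, $\mathbf{sSet}_P$ the category of simplicial sets over $N(P)$. A flag is a finite strictly increasing sequence $\mathcal J=(p_0<\dots<p_n)$ in $P$, and $\Delta^{\mathcal J}$ is $\Delta^n$ with the map to $N(P)$ given by $i\mapsto p_i$. The realization $|N(P)|$ comes with the continuous map $|N(P)|\to P$ sending a point with barycentric coordinates $(t_p)$ to $\max\{p: t_p>0\}$. For $X\in\mathbf{sSet}_P$, $|X|_{N(P)}$ denotes $|X|$ together with the map $|X|\to|N(P)|$ (a strongly filtered space), and $|X|_P$ denotes $|X|$ with the composite $|X|\to|N(P)|\to P$. $\mathrm{Hol}_P(\mathcal J,Z)$ is the space of maps $|\Delta^{\mathcal J}|_P\to Z$ over $P$, and $\mathrm{Hol}_{N(P)}(\mathcal J,Z')$ the space of maps $|\Delta^{\mathcal J}|\to Z'$ over $|N(P)|$, both with the ($\Delta$-ified) compact-open topology. Every map over $|N(P)|$ is a map over $P$ after composing structure maps with $|N(P)|\to P$; this gives the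 inclusion $\alpha$. *)

theory Defs
  imports "HOL-Analysis.Analysis"
begin

definition std_simplex :: "nat \<Rightarrow> (nat \<Rightarrow> real) set" where
  "std_simplex n = {t. (\<forall>i. 0 \<le> t i) \<and> (\<forall>i>n. t i = 0) \<and> sum t {0..n} = 1}"

definition Dtop :: "nat \<Rightarrow> (nat \<Rightarrow> real) topology" where
  "Dtop n = top_of_set (std_simplex n)"

definition mono_to :: "(nat \<Rightarrow> nat) \<Rightarrow> nat \<Rightarrow> nat \<Rightarrow> bool" where
  "mono_to \<theta> m n \<longleftrightarrow> (\<forall>i j. i \<le> j \<longrightarrow> j \<le> m \<longrightarrow> \<theta> i \<le> \<theta> j) \<and> (\<forall>i\<le>m. \<theta> i \<le> n)"

text \<open>A simplicial set is given by its set S of all simplices, the dimension of each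
  std_simplex, and the simplicial operators: act theta m x is the pullback theta^* x of
  a std_simplex x along theta : [m] -> [dm x].  The map to N(P) sends an n-std_simplex x
  to the n-std_simplex (lab x 0 <= ... <= lab x n) of the nerve of P.\<close>
definition sset_over ::
  "'x set \<Rightarrow> ('x \<Rightarrow> nat) \<Rightarrow> ((nat \<Rightarrow> nat) \<Rightarrow> nat \<Rightarrow> 'x \<Rightarrow> 'x) \<Rightarrow> ('x \<Rightarrow> nat \<Rightarrow> 'p::order) \<Rightarrow> bool" where
  "sset_over S dm act lab \<longleftrightarrow>
     (\<forall>x\<in>S. \<forall>\<theta> m. mono_to \<theta> m (dm x) \<longrightarrow> act \<theta> m x \<in> S \<and> dm (act \<theta> m x) = m) \<and>
     (\<forall>x\<in>S. \<forall>\<theta> \<theta>' m. mono_to \<theta> m (dm x) \<and> (\<forall>i\<le>m. \<theta> i = \<theta>' i) \<longrightarrow> act \<theta> m x = act \<theta>' m x) \<and>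
     (\<forall>x\<in>S. \<forall>\<theta>. (\<forall>i\<le>dm x. \<theta> i = i) \<longrightarrow> act \<theta> (dm x) x = x) \<and>
     (\<forall>x\<in>S. \<forall>\<theta> \<phi> m k. mono_to \<theta> m (dm x) \<and> mono_to \<phi> k m \<longrightarrow>
         act \<phi> k (act \<theta> m x) = act (\<theta> \<circ> \<phi>) k x) \<and>
     (\<forall>x\<in>S. \<forall>i j. i \<le> j \<longrightarrow> j \<le> dm x \<longrightarrow> lab x i \<le> lab x j) \<and>
     (\<forall>x\<in>S. \<forall>\<theta> m. mono_to \<theta> m (dm x) \<longrightarrow> (\<forall>i\<le>m. lab (act \<theta> m x) i = lab x (\<theta> i)))"

definition push :: "(nat \<Rightarrow> nat) \<Rightarrow> nat \<Rightarrow> (nat \<Rightarrow> real) \<Rightarrow> nat \<Rightarrow> real" where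
  "push \<theta> m t = (\<lambda>j. \<Sum>i\<in>{i. i \<le> m \<and> \<theta> i = j}. t i)"

definition real_gen :: "'x set \<Rightarrow> ('x \<Rightarrow> nat) \<Rightarrow> ((nat \<Rightarrow> nat) \<Rightarrow> nat \<Rightarrow> 'x \<Rightarrow> 'x)
    \<Rightarrow> (('x \<times> (nat \<Rightarrow> real)) \<times> ('x \<times> (nat \<Rightarrow> real))) set" where
  "real_gen S dm act = {((act \<theta> m x, t), (x, push \<theta> m t)) | x \<theta> m t.
       x \<in> S \<and> mono_to \<theta> m (dm x) \<and> t \<in> std_simplex m}"

definition real_rel :: "'x set \<Rightarrow> ('x \<Rightarrow> nat) \<Rightarrow> ((nat \<Rightarrow> nat) \<Rightarrow> nat \<Rightarrow> 'x \<Rightarrow> 'x)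
    \<Rightarrow> (('x \<times> (nat \<Rightarrow> real)) \<times> ('x \<times> (nat \<Rightarrow> real))) set" where
  "real_rel S dm act = (real_gen S dm act \<union> (real_gen S dm act)\<inverse>)\<^sup>*"

definition real_cls :: "'x set \<Rightarrow> ('x \<Rightarrow> nat) \<Rightarrow> ((nat \<Rightarrow> nat) \<Rightarrow> nat \<Rightarrow> 'x \<Rightarrow> 'x)
    \<Rightarrow> 'x \<times> (nat \<Rightarrow> real) \<Rightarrow> ('x \<times> (nat \<Rightarrow> real)) set" where
  "real_cls S dm act e = real_rel S dm act `` {e}"

definition real_pts :: "'x set \<Rightarrow> ('x \<Rightarrow> nat) \<Rightarrow> ((nat \<Rightarrow> nat) \<Rightarrow> nat \<Rightarrow> 'x \<Rightarrow> 'x)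
    \<Rightarrow> ('x \<times> (nat \<Rightarrow> real)) set set" where
  "real_pts S dm act = (SIGMA x:S. std_simplex (dm x)) // real_rel S dm act"

definition real_top :: "'x set \<Rightarrow> ('x \<Rightarrow> nat) \<Rightarrow> ((nat \<Rightarrow> nat) \<Rightarrow> nat \<Rightarrow> 'x \<Rightarrow> 'x)
    \<Rightarrow> ('x \<times> (nat \<Rightarrow> real)) set topology" where
  "real_top S dm act = topology (\<lambda>V. V \<subseteq> real_pts S dm act \<and>
      (\<forall>x\<in>S. openin (Dtop (dm x)) {t \<in> std_simplex (dm x). real_cls S dm act (x, t) \<in> V}))"

text \<open>n-simplices of N(P): monotone maps [n] -> P (normalised to be constant after n).\<close>
definition nerve_S :: "(nat \<times> (nat \<Rightarrow> 'p::order)) set" where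
  "nerve_S = {(n, f). (\<forall>i j. i \<le> j \<longrightarrow> j \<le> n \<longrightarrow> f i \<le> f j) \<and> (\<forall>i>n. f i = f n)}"

definition nerve_act :: "(nat \<Rightarrow> nat) \<Rightarrow> nat \<Rightarrow> nat \<times> (nat \<Rightarrow> 'p) \<Rightarrow> nat \<times> (nat \<Rightarrow> 'p)" where
  "nerve_act \<theta> m c = (m, \<lambda>i. snd c (\<theta> (min i m)))"

abbreviation NP_top :: "((nat \<times> (nat \<Rightarrow> 'p::order)) \<times> (nat \<Rightarrow> real)) set topology" where
  "NP_top \<equiv> real_top nerve_S fst nerve_act"

abbreviation NP_cls :: "(nat \<times> (nat \<Rightarrow> 'p::order)) \<times> (nat \<Rightarrow> real)
     \<Rightarrow> ((nat \<times> (nat \<Rightarrow> 'p)) \<times> (nat \<Rightarrow> real)) set" where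
  "NP_cls \<equiv> real_cls nerve_S fst nerve_act"

definition to_nerve :: "('x \<Rightarrow> nat) \<Rightarrow> ('x \<Rightarrow> nat \<Rightarrow> 'p) \<Rightarrow> 'x \<Rightarrow> nat \<times> (nat \<Rightarrow> 'p)" where
  "to_nerve dm lab x = (dm x, \<lambda>i. lab x (min i (dm x)))"

definition real_map :: "('x \<Rightarrow> nat) \<Rightarrow> ('x \<Rightarrow> nat \<Rightarrow> 'p::order)
    \<Rightarrow> ('x \<times> (nat \<Rightarrow> real)) set \<Rightarrow> ((nat \<times> (nat \<Rightarrow> 'p)) \<times> (nat \<Rightarrow> real)) set" where
  "real_map dm lab c = (let e = (SOME e. e \<in> c) in NP_cls (to_nerve dm lab (fst e), snd e))"

definition nerve_to_P :: "((nat \<times> (nat \<Rightarrow> 'p::order)) \<times> (nat \<Rightarrow> real)) set \<Rightarrow> 'p" where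
  "nerve_to_P c = (let e = (SOME e. e \<in> c); n = fst (fst e); f = snd (fst e); t = snd e;
      w = (\<lambda>p. \<Sum>i\<in>{i. i \<le> n \<and> f i = p}. t i)
    in THE p. 0 < w p \<and> (\<forall>q. 0 < w q \<longrightarrow> q \<le> p))"

definition flag :: "'p::order list \<Rightarrow> bool" where
  "flag J \<longleftrightarrow> J \<noteq> [] \<and> sorted_wrt (<) J"

definition flag_dim :: "'p list \<Rightarrow> nat" where
  "flag_dim J = length J - 1"

text \<open>Delta^J as a std_simplex of N(P); |Delta^J| = Delta^n with the map to |N(P)|.\<close>
definition flag_simplex :: "'p list \<Rightarrow> nat \<times> (nat \<Rightarrow> 'p)" where
  "flag_simplex J = (flag_dim J, \<lambda>i. J ! min i (flag_dim J))"

definition flag_map :: "'p::order list \<Rightarrow> (nat \<Rightarrow> real) \<Rightarrow> ((nat \<times> (nat \<Rightarrow> 'p)) \<times> (nat \<Rightarrow> real)) set" where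
  "flag_map J t = NP_cls (flag_simplex J, t)"

definition compact_open :: "'a topology \<Rightarrow> 'b topology \<Rightarrow> ('a \<Rightarrow> 'b) topology" where
  "compact_open X Y = topology_generated_by
     {{f. f \<in> extensional (topspace X) \<and> continuous_map X Y f \<and> f ` K \<subseteq> U} | K U.
        compactin X K \<and> openin Y U}"

definition deltafy :: "'a topology \<Rightarrow> 'a topology" where
  "deltafy T = topology (\<lambda>U. U \<subseteq> topspace T \<and>
      (\<forall>k \<sigma>. continuous_map (Dtop k) T \<sigma> \<longrightarrow> openin (Dtop k) {t \<in> std_simplex k. \<sigma> t \<in> U}))"

definition Hol_N_set :: "'x set \<Rightarrow> ('x \<Rightarrow> nat) \<Rightarrow> ((nat \<Rightarrow> nat) \<Rightarrow> nat \<Rightarrow> 'x \<Rightarrow> 'x)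
    \<Rightarrow> ('x \<Rightarrow> nat \<Rightarrow> 'p::order) \<Rightarrow> 'p list \<Rightarrow> ((nat \<Rightarrow> real) \<Rightarrow> ('x \<times> (nat \<Rightarrow> real)) set) set" where
  "Hol_N_set S dm act lab J = {\<sigma>. \<sigma> \<in> extensional (std_simplex (flag_dim J)) \<and>
      continuous_map (Dtop (flag_dim J)) (real_top S dm act) \<sigma> \<and>
      (\<forall>t\<in>std_simplex (flag_dim J). real_map dm lab (\<sigma> t) = flag_map J t)}"

definition Hol_P_set :: "'x set \<Rightarrow> ('x \<Rightarrow> nat) \<Rightarrow> ((nat \<Rightarrow> nat) \<Rightarrow> nat \<Rightarrow> 'x \<Rightarrow> 'x)
    \<Rightarrow> ('x \<Rightarrow> nat \<Rightarrow> 'p::order) \<Rightarrow> 'p list \<Rightarrow> ((nat \<Rightarrow> real) \<Rightarrow> ('x \<times> (nat \<Rightarrow> real)) set) set" where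
  "Hol_P_set S dm act lab J = {\<sigma>. \<sigma> \<in> extensional (std_simplex (flag_dim J)) \<and>
      continuous_map (Dtop (flag_dim J)) (real_top S dm act) \<sigma> \<and>
      (\<forall>t\<in>std_simplex (flag_dim J). nerve_to_P (real_map dm lab (\<sigma> t)) = nerve_to_P (flag_map J t))}"

definition Hol_N where
  "Hol_N S dm act lab J = deltafy (subtopology
     (compact_open (Dtop (flag_dim J)) (real_top S dm act)) (Hol_N_set S dm act lab J))"

definition Hol_P where
  "Hol_P S dm act lab J = deltafy (subtopology
     (compact_open (Dtop (flag_dim J)) (real_top S dm act)) (Hol_P_set S dm act lab J))"

definition cube_n :: "nat \<Rightarrow> (nat \<Rightarrow> real) set" where
  "cube_n n = {t. (\<forall>i<n. 0 \<le> t i \<and> t i \<le> 1) \<and> (\<forall>i\<ge>n. t i = 0)}"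

definition cube_bd :: "nat \<Rightarrow> (nat \<Rightarrow> real) set" where
  "cube_bd n = {t \<in> cube_n n. \<exists>i<n. t i = 0 \<or> t i = 1}"

definition sphere_rep :: "'a topology \<Rightarrow> 'a \<Rightarrow> nat \<Rightarrow> ((nat \<Rightarrow> real) \<Rightarrow> 'a) \<Rightarrow> bool" where
  "sphere_rep A a n g \<longleftrightarrow> continuous_map (top_of_set (cube_n n)) A g \<and> (\<forall>t\<in>cube_bd n. g t = a)"

definition homotopic_rel_bd :: "'a topology \<Rightarrow> 'a \<Rightarrow> nat \<Rightarrow> ((nat \<Rightarrow> real) \<Rightarrow> 'a) \<Rightarrow> ((nat \<Rightarrow> real) \<Rightarrow> 'a) \<Rightarrow> bool" where
  "homotopic_rel_bd A a n g h \<longleftrightarrow>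
     homotopic_with (\<lambda>k. \<forall>t\<in>cube_bd n. k t = a) (top_of_set (cube_n n)) A g h"

definition weak_homotopy_equivalence :: "'a topology \<Rightarrow> 'b topology \<Rightarrow> ('a \<Rightarrow> 'b) \<Rightarrow> bool" where
  "weak_homotopy_equivalence A B f \<longleftrightarrow>
     continuous_map A B f \<and>
     (\<forall>b\<in>topspace B. \<exists>a\<in>topspace A. path_component_of B (f a) b) \<and>
     (\<forall>a\<in>topspace A. \<forall>a'\<in>topspace A. path_component_of B (f a) (f a') \<longrightarrow> path_component_of A a a') \<and>
     (\<forall>n\<ge>1. \<forall>a\<in>topspace A.
        (\<forall>k. sphere_rep B (f a) n k \<longrightarrow>
             (\<exists>g. sphere_rep A a n g \<and> homotopic_rel_bd B (f a) n (f \<circ> g) k)) \<and>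
        (\<forall>g g'. sphere_rep A a n g \<and> sphere_rep A a n g' \<and> homotopic_rel_bd B (f a) n (f \<circ> g) (f \<circ> g')
             \<longrightarrow> homotopic_rel_bd A a n g g'))"

end

theory Submission
  imports Defs
begin

text \<open>By adjunction everything reduces to maps \<open>F : K \<times> \<Delta>\<^sup>n \<rightarrow> |X|\<close> with \<open>K\<close> a cube. Multiplying the
  barycentric coordinates of a point of \<open>|X|\<close> by a nonnegative function of their labels, and normalising,
  is continuous in families as long as the multipliers are continuous. To turn a stratum preserving family
  into one over \<open>|N(P)|\<close>, first precompose with a self-map \<open>\<kappa>\<close> of \<open>\<Delta>\<^sup>n\<close> that preserves the last nonzero
  coordinate and moves \<open>t\<close> so close to lower faces that the weight \<open>f\<^sub>i\<close> of the label \<open>p\<^sub>i\<close> at \<open>F(k, \<kappa>(t))\<close>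
  satisfies \<open>c t\<^sub>i \<le> f\<^sub>i\<^sup>2\<close>. The multipliers \<open>t\<^sub>i / f\<^sub>i\<close> are then continuous, and they produce exactly the weights
  \<open>t\<close>, while all labels outside the flag are multiplied by \<open>0\<close>. The path from \<open>id\<close> to \<open>\<kappa>\<close> is accompanied by
  multipliers that compensate it on families which already lie over \<open>|N(P)|\<close>, so these never leave
  \<open>Hol_N\<close>; a collar argument makes the deformation relative to the boundary of the cube.\<close>

text \<open>Why precompose at all: stratum preservation forces only the weight of the last label of
  \<open>t\<close> to be positive. An earlier label may have weight 0 although its coordinate in
  \<open>t\<close> is positive, and multiplication cannot create weight. Where all later coordinates
  are small enough compared with the i-th one, however, the i-th weight is positive, and compactness
  of \<open>K\<close> makes "small enough" depend on that coordinate alone. Hence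
  \<open>\<kappa>\<close> depends on the family: no deformation of the whole of \<open>Hol_P\<close>
  is built, and everything is checked on cubes. The bound is quadratic because one linear in the
  weight \<open>f i\<close> would leave the quotient \<open>t i / f i\<close> bounded, but possibly
  discontinuous at zeros of \<open>f i\<close>; the quadratic bound makes it at most
  \<open>f i / c\<close>, which tends to 0 there. Compensation is needed because moving
  \<open>t\<close> towards \<open>\<kappa> t\<close> alone pushes a family over |N(P)| out of
  \<open>Hol_N\<close>: its weights become the coordinates of the moved point.\<close>

lemma continuous_on_eval [continuous_intros]: "continuous_on A (\<lambda>t::nat \<Rightarrow> real. t i)"
  by (rule continuous_on_subset[OF continuous_on_product_coordinates]) simp

section \<open>Moduli of positivity and the shrinking self-map of the simplex\<close>

text \<open>The modulus is an infimal convolution: minimise \<open>h m\<close> plus the penalty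
  \<open>max 0 (d - y m)\<close>. The penalty is increasing and 1-Lipschitz in \<open>d\<close>, and
  both properties pass to the infimum. By compactness the infimum is attained, so it is positive for
  \<open>d > 0\<close>: either \<open>y m > 0\<close> and \<open>h m > 0\<close>, or the penalty is
  positive. At \<open>d = y m\<close> the penalty vanishes, which gives the bound by
  \<open>h m\<close>.\<close>

lemma infimal_modulus:
  fixes h y :: "'m::topological_space \<Rightarrow> real"
  assumes M: "compact M" and ch: "continuous_on M h" and cy: "continuous_on M y"
    and h0: "\<And>m. m \<in> M \<Longrightarrow> 0 \<le> h m" and hp: "\<And>m. m \<in> M \<Longrightarrow> 0 < y m \<Longrightarrow> 0 < h m"
  shows "\<exists>g::real \<Rightarrow> real. continuous_on UNIV g \<and> mono g \<and> (\<forall>d>0. 0 < g d) \<and> (\<forall>d. g d \<le> 1) \<and> (\<forall>m\<in>M. g (y m) \<le> h m)"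
proof (cases "M = {}")
  case True
  then show ?thesis
    by (intro exI[of _ "\<lambda>_. 1"]) (auto simp: mono_def)
next
  case False
  define G where "G = (\<lambda>d m. h m + max 0 (d - y m))"
  define g0 where "g0 = (\<lambda>d. INF m\<in>M. G d m)"
  have bdd: "bdd_below (G d ` M)" for d
    by (rule bdd_belowI2[of _ 0]) (use h0 in \<open>auto simp: G_def intro!: add_nonneg_nonneg\<close>)
  have le: "g0 d \<le> G d m" if "m \<in> M" for d m
    unfolding g0_def by (rule cINF_lower[OF bdd that])
  have lip: "g0 d \<le> g0 d' + \<bar>d - d'\<bar>" for d d'
  proof -
    have "g0 d - \<bar>d - d'\<bar> \<le> (INF m\<in>M. G d' m)"
    proof (rule cINF_greatest[OF False])
      fix m assume "m \<in> M"
      from le[OF this, of d] show "g0 d - \<bar>d - d'\<bar> \<le> G d' m"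
        unfolding G_def by (auto simp: max_def abs_if split: if_splits)
    qed
    then show ?thesis by (simp add: g0_def)
  qed
  have "continuous_on UNIV g0"
    unfolding continuous_on_iff
  proof (intro ballI allI impI)
    fix x e :: real assume "0 < e"
    have "dist (g0 x') (g0 x) < e" if "dist x' x < e" for x'
      using lip[of x x'] lip[of x' x] that by (auto simp: dist_real_def)
    then show "\<exists>d>0. \<forall>x'\<in>UNIV. dist x' x < d \<longrightarrow> dist (g0 x') (g0 x) < e"
      using \<open>0 < e\<close> by blast
  qed
  then have c: "continuous_on UNIV (\<lambda>d. min 1 (g0 d))"
    by (intro continuous_intros)
  have mono: "mono g0"
  proof (rule monoI)
    fix d d' :: real assume "d \<le> d'"
    then show "g0 d \<le> g0 d'"
      unfolding g0_def by (intro cINF_mono[OF False bdd]) (auto simp: G_def max_def intro!: bexI)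
  qed
  have pos: "0 < g0 d" if "0 < d" for d
  proof -
    have "continuous_on M (G d)"
      unfolding G_def by (intro continuous_intros ch cy)
    then obtain m where m: "m \<in> M" "\<And>m'. m' \<in> M \<Longrightarrow> G d m \<le> G d m'"
      using continuous_attains_inf[OF M False] by blast
    have "0 < G d m"
      using h0[OF m(1)] hp[OF m(1)] that unfolding G_def by (cases "0 < y m") (auto simp: max_def)
    also have "G d m \<le> g0 d"
      unfolding g0_def by (rule cINF_greatest[OF False]) (rule m(2))
    finally show ?thesis .
  qed
  have bnd: "g0 (y m) \<le> h m" if "m \<in> M" for m
    using le[OF that, of "y m"] by (simp add: G_def)
  show ?thesis
    using c mono pos bnd
    by (intro exI[of _ "\<lambda>d. min 1 (g0 d)"]) (auto simp: mono_def min_def intro: order_trans)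
qed

lemma common_modulus:
  fixes h y :: "nat \<Rightarrow> 'm::topological_space \<Rightarrow> real"
  assumes M: "compact M" and ch: "\<And>i. i \<le> n \<Longrightarrow> continuous_on M (h i)" and cy: "\<And>i. i \<le> n \<Longrightarrow> continuous_on M (y i)"
    and h0: "\<And>i m. i \<le> n \<Longrightarrow> m \<in> M \<Longrightarrow> 0 \<le> h i m"
    and hp: "\<And>i m. i \<le> n \<Longrightarrow> m \<in> M \<Longrightarrow> 0 < y i m \<Longrightarrow> 0 < h i m"
  shows "\<exists>g::real \<Rightarrow> real. continuous_on UNIV g \<and> mono g \<and> (\<forall>d>0. 0 < g d) \<and> (\<forall>d. g d \<le> 1)
     \<and> (\<forall>i\<le>n. \<forall>m\<in>M. g (y i m) \<le> h i m)"
  using ch cy h0 hp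
proof (induction n)
  case 0
  then show ?case using infimal_modulus[OF M, of "h 0" "y 0"] by auto
next
  case (Suc n)
  obtain g where g: "continuous_on UNIV g" "mono g" "\<forall>d>0. 0 < g d" "\<forall>d. g d \<le> 1"
     "\<forall>i\<le>n. \<forall>m\<in>M. g (y i m) \<le> h i m"
    using Suc by auto
  obtain g' where g': "continuous_on UNIV g'" "mono g'" "\<forall>d>0. 0 < g' d" "\<forall>d. g' d \<le> 1"
     "\<forall>m\<in>M. g' (y (Suc n) m) \<le> h (Suc n) m"
    using infimal_modulus[OF M, of "h (Suc n)" "y (Suc n)"] Suc.prems by auto
  have "continuous_on UNIV (\<lambda>d. min (g d) (g' d))"
    using g(1) g'(1) by (intro continuous_intros)
  moreover have "mono (\<lambda>d. min (g d) (g' d))"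
    using g(2) g'(2) unfolding mono_def by (meson min.mono)
  ultimately show ?case
    using g g' by (intro exI[of _ "\<lambda>d. min (g d) (g' d)"]) (auto simp: le_Suc_eq min.coboundedI1 min.coboundedI2)
qed

lemma increasing_inverse:
  fixes \<Psi> :: "real \<Rightarrow> real"
  assumes c: "continuous_on {0..a} \<Psi>" and sm: "strict_mono_on {0..a} \<Psi>"
    and "0 \<le> a" and 0: "\<Psi> 0 = 0" and 1: "\<Psi> a = 1"
  obtains \<omega> where "continuous_on {0..1} \<omega>" "\<And>u. u \<in> {0..1} \<Longrightarrow> \<omega> u \<in> {0..a}"
    "\<And>u. u \<in> {0..1} \<Longrightarrow> \<Psi> (\<omega> u) = u" "\<And>u v. 0 \<le> u \<Longrightarrow> u \<le> v \<Longrightarrow> v \<le> 1 \<Longrightarrow> \<omega> u \<le> \<omega> v"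
proof
  let ?w = "the_inv_into {0..a} \<Psi>"
  have inj: "inj_on \<Psi> {0..a}" using sm by (rule strict_mono_on_imp_inj_on)
  have img: "\<Psi> ` {0..a} = {0..1}"
  proof
    show "\<Psi> ` {0..a} \<subseteq> {0..1}"
      using strict_mono_on_leD[OF sm, of 0] strict_mono_on_leD[OF sm, of _ a] 0 1 \<open>0 \<le> a\<close> by fastforce
    show "{0..1} \<subseteq> \<Psi> ` {0..a}"
      using IVT'[of \<Psi> 0 _ a] c 0 1 \<open>0 \<le> a\<close> by fastforce
  qed
  show "continuous_on {0..1} ?w"
    using continuous_on_inv_into[OF c _ inj] img by simp
  show mem: "?w u \<in> {0..a}" if "u \<in> {0..1}" for u
    using the_inv_into_into[OF inj, of u "{0..a}"] that img by auto
  show inv: "\<Psi> (?w u) = u" if "u \<in> {0..1}" for u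
    using f_the_inv_into_f[OF inj, of u] that img by auto
  show "?w u \<le> ?w v" if "0 \<le> u" "u \<le> v" "v \<le> 1" for u v
  proof (rule ccontr)
    assume "\<not> ?w u \<le> ?w v"
    then have "\<Psi> (?w v) < \<Psi> (?w u)"
      using mem[of u] mem[of v] that by (intro strict_mono_onD[OF sm]) auto
    then show False using inv[of u] inv[of v] that by auto
  qed
qed

text \<open>\<open>\<zeta>\<close> is a modulus such that \<open>f i (k, x) \<ge> \<zeta> (x i)\<close> whenever all later coordinates of \<open>x\<close> are at most
  \<open>\<zeta> (x i)\<close>. Taking the \<open>i\<close>-th coordinate to be \<open>\<zeta>\<^sup>i (\<omega> (t\<^sub>i + \<dots> + t\<^sub>n))\<close> makes each coordinate at most \<open>\<zeta>\<close>
  of the preceding ones, and \<open>\<omega>\<close> is the inverse of a multiple of the square of \<open>\<zeta>\<^sup>n\<^sup>+\<^sup>1\<close>, which gives the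
  quadratic bounds.\<close>

lemma shrinking_map:
  fixes f :: "nat \<Rightarrow> 'k::topological_space \<times> (nat \<Rightarrow> real) \<Rightarrow> real"
  assumes M: "compact (K \<times> std_simplex n)"
    and cf: "\<And>i. i \<le> n \<Longrightarrow> continuous_on (K \<times> std_simplex n) (f i)"
    and f0: "\<And>i m. i \<le> n \<Longrightarrow> m \<in> K \<times> std_simplex n \<Longrightarrow> 0 \<le> f i m"
    and fp: "\<And>i k x. i \<le> n \<Longrightarrow> k \<in> K \<Longrightarrow> x \<in> std_simplex n \<Longrightarrow> 0 < x i \<Longrightarrow> (\<And>j. i < j \<Longrightarrow> x j = 0) \<Longrightarrow> 0 < f i (k, x)"
  obtains \<kappa> :: "(nat \<Rightarrow> real) \<Rightarrow> nat \<Rightarrow> real" and c :: real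
  where "continuous_on (std_simplex n) \<kappa>" "0 < c"
    "\<And>t. t \<in> std_simplex n \<Longrightarrow> \<kappa> t \<in> std_simplex n"
    "\<And>t i. t \<in> std_simplex n \<Longrightarrow> (\<And>j. i \<le> j \<Longrightarrow> t j = 0) \<Longrightarrow> \<kappa> t i = 0"
    "\<And>t i. t \<in> std_simplex n \<Longrightarrow> i \<le> n \<Longrightarrow> c * t i \<le> (\<kappa> t i)\<^sup>2"
    "\<And>t i k. t \<in> std_simplex n \<Longrightarrow> i \<le> n \<Longrightarrow> k \<in> K \<Longrightarrow> c * t i \<le> (f i (k, \<kappa> t))\<^sup>2"
proof -
  let ?M = "K \<times> std_simplex n"
  \<comment> \<open>Adding the later coordinates makes \<open>h i\<close> positive wherever the i-th
    coordinate is: either \<open>i\<close> is the last nonzero index and \<open>f i\<close> is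
    positive, or some later coordinate contributes. A bound for \<open>f i\<close> is recovered once
    these later coordinates are small.\<close>
  define h where "h = (\<lambda>i m. f i m + (\<Sum>j\<in>{Suc i..n}. snd m j))"
  have nn: "0 \<le> t j" if "t \<in> std_simplex n" for t j using that by (auto simp: std_simplex_def)
  have sum0: "0 \<le> (\<Sum>j\<in>{Suc i..n}. snd m j)" if "m \<in> ?M" for i m
    using that nn by (intro sum_nonneg) auto
  have csnd: "continuous_on ?M (\<lambda>m. snd m j)" for j
    by (rule continuous_on_compose2[OF continuous_on_eval continuous_on_snd[OF continuous_on_id]]) auto
  have "\<exists>g::real \<Rightarrow> real. continuous_on UNIV g \<and> mono g \<and> (\<forall>d>0. 0 < g d) \<and> (\<forall>d. g d \<le> 1)
     \<and> (\<forall>i\<le>n. \<forall>m\<in>?M. g (snd m i) \<le> h i m)"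
  proof (rule common_modulus[OF M])
    show "continuous_on ?M (h i)" if "i \<le> n" for i
      unfolding h_def by (intro continuous_intros cf csnd that)
    show "continuous_on ?M (\<lambda>m. snd m i)" for i by (rule csnd)
    show "0 \<le> h i m" if "i \<le> n" "m \<in> ?M" for i m
      unfolding h_def using f0[OF that] sum0[OF that(2)] by simp
    show "0 < h i m" if "i \<le> n" and m: "m \<in> ?M" and "0 < snd m i" for i m
    proof (cases "\<forall>j>i. snd m j = 0")
      case True
      then have "0 < f i m" using fp[of i "fst m" "snd m"] that by auto
      then show ?thesis unfolding h_def using sum0[OF m] by (simp add: add_pos_nonneg)
    next
      case False
      then obtain j where j: "i < j" "snd m j \<noteq> 0" by auto
      then have "j \<le> n" using m by (auto simp: std_simplex_def not_le intro: ccontr)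
      have "0 < snd m j" using j nn[of "snd m" j] m by auto
      then have "0 < (\<Sum>j\<in>{Suc i..n}. snd m j)"
        using j \<open>j \<le> n\<close> nn m by (intro sum_pos2[of _ j]) auto
      then show ?thesis unfolding h_def using f0[OF \<open>i \<le> n\<close> m] by simp
    qed
  qed
  then obtain g :: "real \<Rightarrow> real" where cg: "continuous_on UNIV g" and mg: "mono g" and gp: "\<And>d. 0 < d \<Longrightarrow> 0 < g d"
    and g1: "\<And>d. g d \<le> 1" and gh: "\<And>i m. i \<le> n \<Longrightarrow> m \<in> ?M \<Longrightarrow> g (snd m i) \<le> h i m" by auto
  \<comment> \<open>The factor \<open>d\<close> makes \<open>\<zeta>\<close> strictly increasing,
    which \<open>g\<close> need not be. The denominator gives
    \<open>(n + 1) * \<zeta> d = d * g d / 2\<close>, so for \<open>d\<close> in the unit interval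
    up to \<open>n\<close> later coordinates of size \<open>\<zeta> d\<close> use up at most half of
    the modulus.\<close>
  define \<zeta> where "\<zeta> = (\<lambda>d::real. d * g d / (2 * (real n + 1)))"
  have z0: "\<zeta> 0 = 0" by (simp add: \<zeta>_def)
  have zle: "\<zeta> d \<le> d / (2 * (real n + 1))" if "0 \<le> d" for d
    unfolding \<zeta>_def by (intro divide_right_mono) (use mult_left_le[OF g1[of d] that] in auto)
  have zle': "\<zeta> d \<le> d" if "0 \<le> d" for d
  proof -
    have "d / (2 * (real n + 1)) \<le> d" using that mult_left_mono[of 1 "2 * (real n + 1)" d] by (simp add: divide_le_eq)
    with zle[OF that] show ?thesis by linarith
  qed
  have zsm: "\<zeta> d < \<zeta> d'" if "0 \<le> d" "d < d'" for d d'
  proof -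
    have "d * g d \<le> d * g d'" using that mg by (intro mult_left_mono) (auto simp: mono_def)
    also have "\<dots> < d' * g d'" using that gp[of d'] by (intro mult_strict_right_mono) auto
    finally show ?thesis unfolding \<zeta>_def by (simp add: divide_strict_right_mono)
  qed
  have zp: "0 \<le> \<zeta> d" if "0 \<le> d" for d using zsm[of 0 d] z0 that by (cases "d = 0") auto
  have cz: "continuous_on UNIV \<zeta>" unfolding \<zeta>_def by (intro continuous_intros cg) auto
  define Z where "Z = (\<lambda>i. \<zeta> ^^ i)"
  have Z0: "Z 0 d = d" "Z (Suc i) d = \<zeta> (Z i d)" for i d by (simp_all add: Z_def)
  have cZ: "continuous_on UNIV (Z i)" for i
  proof (induction i)
    case 0 then show ?case by (simp add: Z_def id_def)
  next
    case (Suc i)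
    then show ?case using continuous_on_compose2[OF cz Suc] unfolding Z_def by (simp add: o_def)
  qed
  have Zp: "0 \<le> Z i d" if "0 \<le> d" for i d by (induction i) (auto simp: Z0 that zp)
  have Zsm: "Z i d < Z i d'" if "0 \<le> d" "d < d'" for i d d'
    by (induction i) (auto simp: Z0 that intro!: zsm Zp)
  have Zm: "Z i d \<le> Z i d'" if "0 \<le> d" "d \<le> d'" for i d d'
    using Zsm[of d d' i] that by (cases "d = d'") auto
  have Zz: "Z i 0 = 0" for i by (induction i) (auto simp: Z0 z0)
  have Zle: "Z j d \<le> Z i d" if "0 \<le> d" "i \<le> j" for i j d
    using that(2) by (induction j rule: dec_induct) (auto simp: Z0 intro: order_trans[OF zle'] Zp that)
  \<comment> \<open>Letting \<open>\<omega>\<close> range up to 1/2 reserves mass for coordinate 0: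
    \<open>y 0\<close> is constantly 1/2, and the other \<open>y i\<close> sum to at most 1/2. The
    square of \<open>C\<close> becomes the constant \<open>c\<close> of the conclusion.\<close>
  define C where "C = Z (Suc n) (1/2)"
  have Cp: "0 < C" unfolding C_def using Zsm[of 0 "1/2" "Suc n"] Zz by simp
  define \<Psi> where "\<Psi> = (\<lambda>d. (Z (Suc n) d / C)\<^sup>2)"
  have "continuous_on {0..1/2} \<Psi>"
    unfolding \<Psi>_def using continuous_on_subset[OF cZ] Cp by (intro continuous_intros) auto
  moreover have "strict_mono_on {0..1/2} \<Psi>"
    unfolding \<Psi>_def by (rule strict_mono_onI) (use Cp Zp Zsm in \<open>auto intro!: power_strict_mono divide_strict_right_mono\<close>)
  moreover have "\<Psi> 0 = 0" "\<Psi> (1/2) = 1" using Cp by (auto simp: \<Psi>_def Zz C_def)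
  ultimately obtain \<omega> where cw: "continuous_on {0..1} \<omega>" and wr: "\<And>u. u \<in> {0..1} \<Longrightarrow> \<omega> u \<in> {0..1/2}"
    and Pw: "\<And>u. u \<in> {0..1} \<Longrightarrow> \<Psi> (\<omega> u) = u" and wm: "\<And>u v. 0 \<le> u \<Longrightarrow> u \<le> v \<Longrightarrow> v \<le> 1 \<Longrightarrow> \<omega> u \<le> \<omega> v"
    using increasing_inverse[of "1/2" \<Psi>] by auto
  define \<tau> where "\<tau> = (\<lambda>i (t::nat\<Rightarrow>real). \<Sum>j\<in>{i..n}. t j)"
  have t1: "\<tau> 0 t = 1" if "t \<in> std_simplex n" for t using that by (simp add: \<tau>_def std_simplex_def)
  have tm: "\<tau> j t \<le> \<tau> i t" if "t \<in> std_simplex n" "i \<le> j" for i j t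
    unfolding \<tau>_def using that nn by (intro sum_mono2) auto
  have t01: "\<tau> i t \<in> {0..1}" if "t \<in> std_simplex n" for i t
    using tm[OF that, of 0 i] t1[OF that] nn[OF that] by (auto simp: \<tau>_def intro: sum_nonneg)
  have ct: "continuous_on A (\<tau> i)" for A i unfolding \<tau>_def by (intro continuous_intros)
  have tge: "t i \<le> \<tau> i t" if "t \<in> std_simplex n" "i \<le> n" for i t
    unfolding \<tau>_def using that nn by (intro member_le_sum) auto
  have w0: "\<omega> 0 = 0"
  proof (rule ccontr)
    assume "\<omega> 0 \<noteq> 0"
    then have "0 < Z (Suc n) (\<omega> 0)" using wr[of 0] Zsm[of 0 "\<omega> 0" "Suc n"] Zz by auto
    then have "0 < \<Psi> (\<omega> 0)" using Cp by (simp add: \<Psi>_def)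
    then show False using Pw[of 0] by simp
  qed
  have w1: "\<omega> 1 = 1/2"
  proof (rule ccontr)
    assume "\<omega> 1 \<noteq> 1/2"
    then have "\<omega> 1 < 1/2" "0 \<le> \<omega> 1" using wr[of 1] by auto
    then have "Z (Suc n) (\<omega> 1) < C" "0 \<le> Z (Suc n) (\<omega> 1)" using Zsm Zp by (auto simp: C_def)
    then have "\<Psi> (\<omega> 1) < 1" using Cp unfolding \<Psi>_def by (simp add: power_less_one_iff)
    then show False using Pw[of 1] by simp
  qed
  define y where "y = (\<lambda>i t. Z i (\<omega> (\<tau> i t)))"
  have wt0: "0 \<le> \<omega> (\<tau> i t)" if "t \<in> std_simplex n" for i t using wr[OF t01[OF that]] by auto
  have y0: "0 \<le> y i t" if "t \<in> std_simplex n" for i t unfolding y_def using that by (intro Zp wt0)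
  have yz: "y j t \<le> \<zeta> (y i t)" if t: "t \<in> std_simplex n" and "i < j" for i j t
  proof -
    have "y j t \<le> Z (Suc i) (\<omega> (\<tau> j t))" unfolding y_def using that by (intro Zle wt0) auto
    also have "\<dots> \<le> Z (Suc i) (\<omega> (\<tau> i t))"
      using that t01[OF t, of i] t01[OF t, of j] by (intro Zm wt0 wm tm) auto
    finally show ?thesis by (simp add: y_def Z0)
  qed
  have y00: "y 0 t = 1/2" if "t \<in> std_simplex n" for t using t1[OF that] by (simp add: y_def Z0 w1)
  have cy: "continuous_on (std_simplex n) (y i)" for i
  proof -
    have "continuous_on (std_simplex n) (\<lambda>t. \<omega> (\<tau> i t))"
      by (rule continuous_on_compose2[OF cw ct]) (use t01 in auto)
    then show ?thesis unfolding y_def by (rule continuous_on_compose2[OF cZ]) auto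
  qed
  \<comment> \<open>Iterates of \<open>\<zeta>\<close> decrease, so the single exponent
    \<open>Suc n\<close> in \<open>\<Psi>\<close> serves every index \<open>i\<close>.\<close>
  have ysq: "C\<^sup>2 * t i \<le> (\<zeta> (y i t))\<^sup>2" if t: "t \<in> std_simplex n" and "i \<le> n" for i t
  proof -
    have "t i \<le> \<tau> i t" using tge[OF that] .
    also have "\<dots> = \<Psi> (\<omega> (\<tau> i t))" using Pw[OF t01[OF t]] by simp
    finally have "C\<^sup>2 * t i \<le> C\<^sup>2 * \<Psi> (\<omega> (\<tau> i t))" by (simp add: mult_left_mono)
    also have "\<dots> = (Z (Suc n) (\<omega> (\<tau> i t)))\<^sup>2" using Cp by (simp add: \<Psi>_def power_divide)
    also have "\<dots> \<le> (Z (Suc i) (\<omega> (\<tau> i t)))\<^sup>2" using that by (intro power_mono Zle Zp wt0) auto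
    finally show ?thesis by (simp add: y_def Z0)
  qed
  define s where "s = (\<lambda>t. \<Sum>j\<in>{Suc 0..n}. y j t)"
  \<comment> \<open>Coordinate 0 absorbs the remaining mass, so nothing is divided by the total. It
    is at least 1/2, hence \<open>y i t \<le> \<kappa> t i\<close> for every \<open>i\<close>, and
    bounds stated for \<open>y\<close> carry over.\<close>
  define \<kappa> where "\<kappa> = (\<lambda>t i. if i = 0 then 1 - s t else if i \<le> n then y i t else 0)"
  have tail: "(\<Sum>j\<in>{Suc i..n}. y j t) \<le> real n * \<zeta> (y i t)" if t: "t \<in> std_simplex n" for i t
  proof -
    have "(\<Sum>j\<in>{Suc i..n}. y j t) \<le> (\<Sum>j\<in>{Suc i..n}. \<zeta> (y i t))"
      by (intro sum_mono yz[OF t]) auto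
    also have "\<dots> \<le> real n * \<zeta> (y i t)"
      using zp[OF y0[OF t, of i]] by (auto intro!: mult_right_mono)
    finally show ?thesis .
  qed
  have nz: "real n * \<zeta> d \<le> d * g d / 2" if "0 \<le> d" for d
  proof -
    have "real n * \<zeta> d \<le> (real n + 1) * \<zeta> d" using zp[OF that] by (simp add: algebra_simps)
    also have "\<dots> = d * g d / 2" by (simp add: \<zeta>_def divide_simps)
    finally show ?thesis .
  qed
  have s12: "s t \<le> 1/2" if "t \<in> std_simplex n" for t
    using tail[OF that, of 0] nz[of "y 0 t"] y00[OF that] g1[of "1/2"] by (simp add: s_def)
  have s0: "0 \<le> s t" if "t \<in> std_simplex n" for t unfolding s_def using y0[OF that] by (intro sum_nonneg) auto
  have ly: "y i t \<le> \<kappa> t i" if "t \<in> std_simplex n" "i \<le> n" for i t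
    using that s12[OF that(1)] y00[OF that(1)] by (auto simp: \<kappa>_def)
  have mem: "\<kappa> t \<in> std_simplex n" if t: "t \<in> std_simplex n" for t
  proof -
    have "sum (\<kappa> t) {0..n} = \<kappa> t 0 + sum (\<kappa> t) {Suc 0..n}" by (rule sum.atLeast_Suc_atMost) simp
    also have "sum (\<kappa> t) {Suc 0..n} = s t" unfolding s_def by (rule sum.cong) (auto simp: \<kappa>_def)
    finally show ?thesis using s12[OF t] y0[OF t] by (auto simp: std_simplex_def \<kappa>_def)
  qed
  have cl: "continuous_on (std_simplex n) \<kappa>"
  proof (rule continuous_on_coordinatewise_then_product)
    fix i
    have "continuous_on (std_simplex n) s" unfolding s_def by (intro continuous_intros cy)
    then show "continuous_on (std_simplex n) (\<lambda>t. \<kappa> t i)"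
      unfolding \<kappa>_def by (cases "i = 0"; cases "i \<le> n") (auto intro!: continuous_intros cy)
  qed
  have zl: "\<zeta> (y i t) \<le> \<zeta> (\<kappa> t i)" if "t \<in> std_simplex n" "i \<le> n" for i t
    using ly[OF that] zsm[of "y i t" "\<kappa> t i"] y0[OF that(1), of i] by (cases "y i t = \<kappa> t i") auto
  have fz: "\<zeta> (\<kappa> t i) \<le> f i (k, \<kappa> t)" if t: "t \<in> std_simplex n" and i: "i \<le> n" and k: "k \<in> K" for t i k
  proof -
    let ?d = "\<kappa> t i"
    have d: "0 \<le> ?d" "?d \<le> 1"
      using mem[OF t] nn[OF mem[OF t]] member_le_sum[of i "{0..n}" "\<kappa> t"] i by (auto simp: std_simplex_def)
    show ?thesis
    proof (cases "?d = 0")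
      case True
      then show ?thesis using z0 f0[of i "(k, \<kappa> t)"] i k mem[OF t] by simp
    next
      case False
      have gd: "0 \<le> g ?d" using gp[of ?d] d False by simp
      have dg: "?d * g ?d \<le> g ?d" using d(2) gd by (simp add: mult_left_le_one_le d(1))
      have "(\<Sum>j\<in>{Suc i..n}. \<kappa> t j) = (\<Sum>j\<in>{Suc i..n}. y j t)"
        by (rule sum.cong) (auto simp: \<kappa>_def)
      also have "\<dots> \<le> real n * \<zeta> ?d"
        using tail[OF t, of i] zl[OF t i] by (meson mult_left_mono of_nat_0_le_iff order_trans)
      finally have "h i (k, \<kappa> t) \<le> f i (k, \<kappa> t) + real n * \<zeta> ?d" by (simp add: h_def)
      moreover have "g ?d \<le> h i (k, \<kappa> t)" using gh[of i "(k, \<kappa> t)"] i k mem[OF t] by simp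
      moreover have "(real n + 1) * \<zeta> ?d = ?d * g ?d / 2" by (simp add: \<zeta>_def divide_simps)
      \<comment> \<open>Here \<open>g ?d\<close> is at least
        \<open>?d * g ?d = 2 * (n + 1) * \<zeta> ?d\<close>; subtracting the tail, at most
        \<open>n * \<zeta> ?d\<close>, leaves at least \<open>\<zeta> ?d\<close>.\<close>
      ultimately show ?thesis using dg gd by (simp add: algebra_simps)
    qed
  qed
  show ?thesis
  proof (rule that[of \<kappa> "C\<^sup>2", OF cl _ mem])
    show "0 < C\<^sup>2" using Cp by simp
    show "\<kappa> t i = 0" if t: "t \<in> std_simplex n" and z: "\<And>j. i \<le> j \<Longrightarrow> t j = 0" for t i
    proof -
      have "\<tau> i t = 0" unfolding \<tau>_def using z by simp
      moreover have "i \<noteq> 0" using calculation t1[OF t] by (cases i) auto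
      ultimately show ?thesis by (auto simp: \<kappa>_def y_def w0 Zz)
    qed
    have zz: "0 \<le> \<zeta> (y i t)" if "t \<in> std_simplex n" for t i using zp[OF y0[OF that]] .
    show "C\<^sup>2 * t i \<le> (\<kappa> t i)\<^sup>2" if t: "t \<in> std_simplex n" and i: "i \<le> n" for t i
      by (rule order_trans[OF ysq[OF that]], rule power_mono[OF _ zz[OF t]])
        (rule order_trans[OF zle'[OF y0[OF t]] ly[OF that]])
    show "C\<^sup>2 * t i \<le> (f i (k, \<kappa> t))\<^sup>2" if t: "t \<in> std_simplex n" and i: "i \<le> n" and k: "k \<in> K" for t i k
      by (rule order_trans[OF ysq[OF t i]], rule power_mono[OF _ zz[OF t]])
        (rule order_trans[OF zl[OF t i] fz[OF t i k]])
  qed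
qed

section \<open>Standard simplices\<close>

lemma sum_push:
  assumes "mono_to \<theta> m n"
  shows "(\<Sum>j\<le>n. push \<theta> m t j * u j) = (\<Sum>i\<le>m. t i * u (\<theta> i))"
proof -
  have "(\<Sum>j\<le>n. push \<theta> m t j * u j) = (\<Sum>j\<le>n. \<Sum>i\<in>{i. i \<in> {..m} \<and> \<theta> i = j}. t i * u (\<theta> i))"
    by (rule sum.cong) (auto simp: push_def sum_distrib_right)
  also have "\<dots> = (\<Sum>i\<le>m. t i * u (\<theta> i))"
    by (rule sum.group) (use assms in \<open>auto simp: mono_to_def\<close>)
  finally show ?thesis .
qed

lemma std_simplex_nonneg: "t \<in> std_simplex n \<Longrightarrow> 0 \<le> t i"
  and std_simplex_zero: "t \<in> std_simplex n \<Longrightarrow> n < i \<Longrightarrow> t i = 0"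
  and std_simplex_sum: "t \<in> std_simplex n \<Longrightarrow> (\<Sum>i\<le>n. t i) = 1"
  by (auto simp: std_simplex_def atMost_atLeast0)

lemma push_in_simplex:
  assumes \<theta>: "mono_to \<theta> m n" and t: "t \<in> std_simplex m"
  shows "push \<theta> m t \<in> std_simplex n"
proof -
  have "push \<theta> m t j = 0" if "n < j" for j
    using \<theta> that unfolding push_def mono_to_def by (intro sum.neutral) fastforce
  moreover have "(\<Sum>j\<le>n. push \<theta> m t j) = 1"
    using sum_push[OF \<theta>, of t "\<lambda>_. 1"] std_simplex_sum[OF t] by simp
  ultimately show ?thesis
    using std_simplex_nonneg[OF t] by (auto simp: std_simplex_def atMost_atLeast0 push_def intro: sum_nonneg)
qed

lemma std_simplex_top:
  assumes "t \<in> std_simplex n"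
  obtains k where "k \<le> n" "0 < t k" "\<And>j. k < j \<Longrightarrow> t j = 0"
proof -
  let ?A = "{i. i \<le> n \<and> 0 < t i}"
  have "?A \<noteq> {}"
  proof
    assume "?A = {}"
    then have "t i = 0" if "i \<le> n" for i using std_simplex_nonneg[OF assms, of i] that by force
    then show False using std_simplex_sum[OF assms] by simp
  qed
  then have m: "Max ?A \<in> ?A" by (intro Max_in) auto
  have "t j = 0" if "Max ?A < j" for j
  proof (rule ccontr)
    assume "t j \<noteq> 0"
    then have "j \<in> ?A" using std_simplex_nonneg[OF assms, of j] std_simplex_zero[OF assms, of j] by force
    then have "j \<le> Max ?A" by (intro Max_ge) auto
    with that show False by simp
  qed
  then show ?thesis using m that by blast
qed

lemma compact_std_simplex: "compact (std_simplex n)"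
proof -
  let ?B = "Pi\<^sub>E UNIV (\<lambda>i::nat. if i \<le> n then {0..1::real} else {0})"
  have "compactin (product_topology (\<lambda>i. euclidean) UNIV) ?B"
    by (subst compactin_PiE) auto
  then have B: "compact ?B"
    by (simp add: euclidean_product_topology)
  have "std_simplex n = ?B \<inter> {t. sum t {0..n} = 1}"
  proof (intro equalityI subsetI)
    fix t assume t: "t \<in> std_simplex n"
    have "t i \<le> 1" if "i \<le> n" for i
      using member_le_sum[of i "{0..n}" t] t that by (auto simp: std_simplex_def)
    then show "t \<in> ?B \<inter> {t. sum t {0..n} = 1}" using t by (auto simp: std_simplex_def)
  next
    fix t assume t: "t \<in> ?B \<inter> {t. sum t {0..n} = 1}"
    then have "t i \<in> (if i \<le> n then {0..1::real} else {0})" for i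
      using PiE_mem[of t UNIV _ i] by blast
    then have "0 \<le> t i" "n < i \<Longrightarrow> t i = 0" for i
      by (smt (verit) atLeastAtMost_iff leD singletonD)+
    then show "t \<in> std_simplex n" using t by (auto simp: std_simplex_def)
  qed
  moreover have "closed {t::nat\<Rightarrow>real. sum t {0..n} = 1}"
    by (intro closed_Collect_eq continuous_intros)
  ultimately show ?thesis using B by (simp add: compact_Int_closed)
qed

text \<open>The tube lemma in closed form. It turns conditions required for all parameters in a
  compact set into open conditions.\<close>

lemma closedin_snd_compact:
  assumes "compact N" "closedin (top_of_set (N \<times> T)) U"
  shows "closedin (top_of_set T) (snd ` U)"
proof -
  have "closed_map (prod_topology (top_of_set N) (top_of_set T)) (top_of_set T) snd"
    using assms(1) by (intro closed_map_snd) (simp add: compact_space_subtopology)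
  then show ?thesis using assms(2) unfolding closed_map_def by simp
qed

lemma topspace_Dtop [simp]: "topspace (Dtop n) = std_simplex n"
  by (simp add: Dtop_def)

lemma sum_indicator:
  fixes t :: "nat \<Rightarrow> real"
  shows "(\<Sum>i\<le>n. t i * of_bool (f i = p)) = (\<Sum>i\<in>{i. i \<le> n \<and> f i = p}. t i)"
proof -
  have "(\<Sum>i\<le>n. t i * of_bool (f i = p)) = (\<Sum>i\<le>n. if f i = p then t i else 0)"
    by (rule sum.cong) auto
  also have "\<dots> = (\<Sum>i\<in>{..n} \<inter> {i. f i = p}. t i)"
    by (simp add: sum.inter_restrict)
  also have "{..n} \<inter> {i. f i = p} = {i. i \<le> n \<and> f i = p}" by auto
  finally show ?thesis .
qed

section \<open>Realizations, weights of labels and reweighting\<close>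

locale sset =
  fixes S :: "'x set" and dm :: "'x \<Rightarrow> nat" and act :: "(nat \<Rightarrow> nat) \<Rightarrow> nat \<Rightarrow> 'x \<Rightarrow> 'x"
    and lab :: "'x \<Rightarrow> nat \<Rightarrow> 'p::order"
  assumes sset: "sset_over S dm act lab"
begin

abbreviation "cls \<equiv> real_cls S dm act"
abbreviation "rel \<equiv> real_rel S dm act"
abbreviation "pts \<equiv> real_pts S dm act"
abbreviation "RX \<equiv> real_top S dm act"

lemma dm_act: "x \<in> S \<Longrightarrow> mono_to \<theta> m (dm x) \<Longrightarrow> dm (act \<theta> m x) = m"
  and lab_mono: "x \<in> S \<Longrightarrow> i \<le> j \<Longrightarrow> j \<le> dm x \<Longrightarrow> lab x i \<le> lab x j"
  and lab_act: "x \<in> S \<Longrightarrow> mono_to \<theta> m (dm x) \<Longrightarrow> i \<le> m \<Longrightarrow> lab (act \<theta> m x) i = lab x (\<theta> i)"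
  using sset unfolding sset_over_def by (elim conjE; simp)+

lemma gen_rel: "(e, e') \<in> real_gen S dm act \<Longrightarrow> (e, e') \<in> rel"
  unfolding real_rel_def by auto

lemma genI:
  "x \<in> S \<Longrightarrow> mono_to \<theta> m (dm x) \<Longrightarrow> t \<in> std_simplex m \<Longrightarrow> ((act \<theta> m x, t), (x, push \<theta> m t)) \<in> real_gen S dm act"
  unfolding real_gen_def by blast

lemma rel_refl: "(e, e) \<in> rel" unfolding real_rel_def by simp

lemma rel_sym: "(e, e') \<in> rel \<Longrightarrow> (e', e) \<in> rel"
  unfolding real_rel_def using sym_rtrancl[of "real_gen S dm act \<union> (real_gen S dm act)\<inverse>"]
  by (metis symD sym_Un_converse)

lemma rel_trans: "(e, e') \<in> rel \<Longrightarrow> (e', e'') \<in> rel \<Longrightarrow> (e, e'') \<in> rel"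
  unfolding real_rel_def by (rule rtrancl_trans)

lemma cls_eqI: "(e, e') \<in> rel \<Longrightarrow> cls e = cls e'"
  unfolding real_cls_def by (auto intro: rel_trans[of e' e] rel_trans[of e e'] rel_sym)

lemma rel_some: "(e, SOME e'. e' \<in> cls e) \<in> rel"
proof -
  have "e \<in> cls e" by (simp add: real_cls_def rel_refl)
  then have "(SOME e'. e' \<in> cls e) \<in> cls e" by (rule someI)
  then show ?thesis by (simp add: real_cls_def)
qed

text \<open>Functions on the realization are defined through a representative chosen by
  \<open>SOME\<close>; this reduces independence of the choice to the generating pairs.\<close>

lemma rel_invariant:
  assumes "(e, e') \<in> rel" and "\<And>e e'. (e, e') \<in> real_gen S dm act \<Longrightarrow> f e = f e'"
  shows "f e = f e'"
  using assms(1) unfolding real_rel_def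
proof (induction rule: rtrancl_induct)
  case (step y z)
  then show ?case using assms(2)[of y z] assms(2)[of z y] by auto
qed simp

lemma pts_eq: "pts = {cls (x, t) | x t. x \<in> S \<and> t \<in> std_simplex (dm x)}"
  unfolding real_pts_def real_cls_def quotient_def by auto

lemma ptsE:
  assumes "c \<in> pts"
  obtains x t where "x \<in> S" "t \<in> std_simplex (dm x)" "c = cls (x, t)"
  using assms unfolding pts_eq by blast

lemma cls_in_pts: "x \<in> S \<Longrightarrow> t \<in> std_simplex (dm x) \<Longrightarrow> cls (x, t) \<in> pts"
  unfolding pts_eq by blast

lemma openin_RX:
  "openin RX V \<longleftrightarrow> V \<subseteq> pts \<and> (\<forall>x\<in>S. openin (Dtop (dm x)) {t \<in> std_simplex (dm x). cls (x, t) \<in> V})"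
proof -
  have "istopology (\<lambda>V. V \<subseteq> pts \<and> (\<forall>x\<in>S. openin (Dtop (dm x)) {t \<in> std_simplex (dm x). cls (x, t) \<in> V}))"
    unfolding istopology_def
  proof (intro conjI allI impI ballI; (elim conjE)?)
    fix A B x assume "x \<in> S" "\<forall>x\<in>S. openin (Dtop (dm x)) {t \<in> std_simplex (dm x). cls (x, t) \<in> A}"
      "\<forall>x\<in>S. openin (Dtop (dm x)) {t \<in> std_simplex (dm x). cls (x, t) \<in> B}"
    then have "openin (Dtop (dm x)) ({t \<in> std_simplex (dm x). cls (x, t) \<in> A} \<inter> {t \<in> std_simplex (dm x). cls (x, t) \<in> B})"
      by (intro openin_Int) simp_all
    also have "{t \<in> std_simplex (dm x). cls (x, t) \<in> A} \<inter> {t \<in> std_simplex (dm x). cls (x, t) \<in> B} = {t \<in> std_simplex (dm x). cls (x, t) \<in> A \<inter> B}"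
      by auto
    finally show "openin (Dtop (dm x)) {t \<in> std_simplex (dm x). cls (x, t) \<in> A \<inter> B}" .
  next
    fix \<K> x assume "x \<in> S" and K: "\<forall>K\<in>\<K>. K \<subseteq> pts \<and> (\<forall>x\<in>S. openin (Dtop (dm x)) {t \<in> std_simplex (dm x). cls (x, t) \<in> K})"
    then have "openin (Dtop (dm x)) (\<Union>K\<in>\<K>. {t \<in> std_simplex (dm x). cls (x, t) \<in> K})"
      by (intro openin_Union) auto
    also have "(\<Union>K\<in>\<K>. {t \<in> std_simplex (dm x). cls (x, t) \<in> K}) = {t \<in> std_simplex (dm x). cls (x, t) \<in> \<Union>\<K>}"
      by auto
    finally show "openin (Dtop (dm x)) {t \<in> std_simplex (dm x). cls (x, t) \<in> \<Union>\<K>}" .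
  qed auto
  then show ?thesis unfolding real_top_def by simp
qed

lemma topspace_RX [simp]: "topspace RX = pts"
proof -
  have "openin RX pts"
  proof -
    have "{t \<in> std_simplex (dm x). cls (x, t) \<in> pts} = std_simplex (dm x)" if "x \<in> S" for x
      using cls_in_pts[OF that] by auto
    then show ?thesis unfolding openin_RX using openin_topspace[of "Dtop (dm _)"] by simp
  qed
  moreover have "topspace RX \<subseteq> pts" using openin_topspace[of RX] unfolding openin_RX by (rule conjunct1)
  ultimately show ?thesis using openin_subset by fastforce
qed

text \<open>Collected by label, the barycentric coordinates of a point form a finitely supported
  probability measure on labels, and \<open>tot\<close> integrates against it. The weight of a label
  and the normalising constant of a reweighting are both such integrals, so one proof of invariance
  and one of continuity cover them.\<close>

definition tot :: "('p \<Rightarrow> real) \<Rightarrow> 'x \<Rightarrow> (nat \<Rightarrow> real) \<Rightarrow> real" where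
  "tot \<phi> x t = (\<Sum>i\<le>dm x. t i * \<phi> (lab x i))"

definition mass :: "('p \<Rightarrow> real) \<Rightarrow> ('x \<times> (nat \<Rightarrow> real)) set \<Rightarrow> real" where
  "mass \<phi> c = (let e = SOME e. e \<in> c in tot \<phi> (fst e) (snd e))"

abbreviation weight :: "('x \<times> (nat \<Rightarrow> real)) set \<Rightarrow> 'p \<Rightarrow> real" where
  "weight c p \<equiv> mass (\<lambda>q. of_bool (q = p)) c"

lemma tot_push:
  assumes "x \<in> S" "mono_to \<theta> m (dm x)"
  shows "tot \<phi> x (push \<theta> m t) = tot \<phi> (act \<theta> m x) t"
  unfolding tot_def using assms by (simp add: sum_push[OF assms(2)] dm_act lab_act)

lemma mass_cls [simp]: "mass \<phi> (cls (x, t)) = tot \<phi> x t"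
proof -
  have "tot \<phi> (fst e) (snd e) = tot \<phi> (fst e') (snd e')" if "(e, e') \<in> rel" for e e'
    by (rule rel_invariant[OF that]) (auto simp: real_gen_def tot_push)
  from this[OF rel_some] show ?thesis unfolding mass_def Let_def by simp
qed

lemma weight_cls: "weight (cls (x, t)) p = (\<Sum>i\<in>{i. i \<le> dm x \<and> lab x i = p}. t i)"
  by (simp only: mass_cls tot_def sum_indicator)

lemma mass_nonneg:
  assumes "c \<in> pts" "\<And>p. 0 \<le> \<phi> p"
  shows "0 \<le> mass \<phi> c"
proof -
  obtain x t where x: "x \<in> S" "t \<in> std_simplex (dm x)" "c = cls (x, t)" using assms(1) by (rule ptsE)
  show ?thesis
    unfolding x(3) mass_cls tot_def using assms(2) std_simplex_nonneg[OF x(2)] by (intro sum_nonneg) simp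
qed

lemma mass_pos:
  assumes c: "c \<in> pts" and "\<And>p. 0 \<le> \<phi> p" and "0 < weight c p" "0 < \<phi> p"
  shows "0 < mass \<phi> c"
proof -
  obtain x t where x: "x \<in> S" "t \<in> std_simplex (dm x)" "c = cls (x, t)" using c by (rule ptsE)
  have "0 < \<phi> p * weight c p" using assms by simp
  also have "\<dots> = (\<Sum>i\<le>dm x. \<phi> p * (t i * of_bool (lab x i = p)))"
    unfolding x(3) mass_cls tot_def sum_distrib_left ..
  also have "\<dots> \<le> (\<Sum>i\<le>dm x. t i * \<phi> (lab x i))"
    by (rule sum_mono) (use assms(2) std_simplex_nonneg[OF x(2)] in auto)
  finally show ?thesis by (simp add: x(3) tot_def)
qed

text \<open>A representative carries finitely many labels, so its coordinates can be grouped by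
  label in a finite sum even if the order is infinite. Enlarging by \<open>A\<close> and discarding
  the vanishing terms leaves the sum over \<open>A\<close>.\<close>

lemma mass_finite_support:
  assumes c: "c \<in> pts" and A: "finite A" and z: "\<And>p. p \<notin> A \<Longrightarrow> \<phi> p * weight c p = 0"
  shows "mass \<phi> c = (\<Sum>p\<in>A. \<phi> p * weight c p)"
proof -
  obtain x t where x: "x \<in> S" "t \<in> std_simplex (dm x)" "c = cls (x, t)" using c by (rule ptsE)
  let ?L = "lab x ` {..dm x}"
  have w: "\<phi> p * weight c p = (\<Sum>i\<in>{i \<in> {..dm x}. lab x i = p}. t i * \<phi> (lab x i))" for p
    unfolding x(3) weight_cls sum_distrib_left by (rule sum.cong) auto
  have "mass \<phi> c = (\<Sum>p\<in>?L \<union> A. \<Sum>i\<in>{i \<in> {..dm x}. lab x i = p}. t i * \<phi> (lab x i))"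
    unfolding x(3) mass_cls tot_def by (rule sum.group[symmetric]) (use A in auto)
  also have "\<dots> = (\<Sum>p\<in>?L \<union> A. \<phi> p * weight c p)" by (simp add: w)
  also have "\<dots> = (\<Sum>p\<in>A. \<phi> p * weight c p)"
  proof (rule sum.mono_neutral_right)
    show "\<forall>p\<in>?L \<union> A - A. \<phi> p * weight c p = 0" using z by blast
  qed (use A in auto)
  finally show ?thesis .
qed

text \<open>Labels increase along a simplex, so the label of the last nonzero coordinate dominates
  all labels in the support.\<close>

lemma weight_top_exists:
  assumes "c \<in> pts"
  shows "\<exists>p. 0 < weight c p \<and> (\<forall>q. 0 < weight c q \<longrightarrow> q \<le> p)"
proof -
  obtain x t where x: "x \<in> S" "t \<in> std_simplex (dm x)" "c = cls (x, t)" using assms by (rule ptsE)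
  obtain k where k: "k \<le> dm x" "0 < t k" "\<And>j. k < j \<Longrightarrow> t j = 0"
    using std_simplex_top[OF x(2)] by metis
  have "0 < weight c (lab x k)"
    unfolding x(3) weight_cls
    by (rule sum_pos2[of _ k]) (use k std_simplex_nonneg[OF x(2)] in auto)
  moreover have "q \<le> lab x k" if "0 < weight c q" for q
  proof -
    have "\<exists>i. i \<le> dm x \<and> lab x i = q \<and> t i \<noteq> 0"
    proof (rule ccontr)
      assume "\<not> ?thesis"
      then have "weight c q = 0" unfolding x(3) weight_cls by (intro sum.neutral) auto
      with that show False by simp
    qed
    then obtain i where i: "i \<le> dm x" "lab x i = q" "t i \<noteq> 0" by blast
    then have "i \<le> k" using k(3) by (meson not_le)
    then show ?thesis using lab_mono[OF x(1), of i k] i k by auto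
  qed
  ultimately show ?thesis by blast
qed

text \<open>If every label in the support is multiplied by 0 there is nothing to normalise. The
  default value \<open>t\<close> keeps the result in the simplex and compatible with pushforward, so
  that reweighting descends to classes without a side condition.\<close>

definition rescale :: "('p \<Rightarrow> real) \<Rightarrow> 'x \<Rightarrow> (nat \<Rightarrow> real) \<Rightarrow> nat \<Rightarrow> real" where
  "rescale \<phi> x t = (if 0 < tot \<phi> x t then (\<lambda>i. t i * \<phi> (lab x i) / tot \<phi> x t) else t)"

definition reweight :: "('p \<Rightarrow> real) \<Rightarrow> ('x \<times> (nat \<Rightarrow> real)) set \<Rightarrow> ('x \<times> (nat \<Rightarrow> real)) set" where
  "reweight \<phi> c = (let e = SOME e. e \<in> c in cls (fst e, rescale \<phi> (fst e) (snd e)))"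

lemma rescale_in_simplex:
  assumes "\<And>p. 0 \<le> \<phi> p" "t \<in> std_simplex (dm x)"
  shows "rescale \<phi> x t \<in> std_simplex (dm x)"
proof (cases "0 < tot \<phi> x t")
  case True
  have "(\<Sum>i\<le>dm x. t i * \<phi> (lab x i) / tot \<phi> x t) = 1"
    using True by (simp flip: sum_divide_distrib tot_def)
  then show ?thesis
    using True assms std_simplex_nonneg[OF assms(2)] std_simplex_zero[OF assms(2)]
    by (auto simp: rescale_def std_simplex_def atMost_atLeast0)
qed (use assms in \<open>auto simp: rescale_def\<close>)

text \<open>A multiplier sees only the label, and vertices identified by \<open>\<theta>\<close>
  have the same label. It is therefore a common factor of each sum that \<open>push\<close>
  forms.\<close>

lemma push_rescale:
  assumes "x \<in> S" "mono_to \<theta> m (dm x)"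
  shows "push \<theta> m (rescale \<phi> (act \<theta> m x) t) = rescale \<phi> x (push \<theta> m t)"
proof (cases "0 < tot \<phi> (act \<theta> m x) t")
  case True
  show ?thesis
  proof
    fix j
    have "(\<Sum>i | i \<le> m \<and> \<theta> i = j. t i * \<phi> (lab (act \<theta> m x) i) / tot \<phi> (act \<theta> m x) t) =
      (\<Sum>i | i \<le> m \<and> \<theta> i = j. t i) * \<phi> (lab x j) / tot \<phi> (act \<theta> m x) t"
      unfolding sum_distrib_right sum_divide_distrib
      by (rule sum.cong) (auto simp: lab_act[OF assms])
    then show "push \<theta> m (rescale \<phi> (act \<theta> m x) t) j = rescale \<phi> x (push \<theta> m t) j"
      using True unfolding rescale_def tot_push[OF assms] by (simp add: push_def)
  qed
qed (simp add: rescale_def tot_push[OF assms])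

lemma reweight_cls [simp]:
  assumes "\<And>p. 0 \<le> \<phi> p"
  shows "reweight \<phi> (cls (x, t)) = cls (x, rescale \<phi> x t)"
proof -
  let ?f = "\<lambda>e. cls (fst e, rescale \<phi> (fst e) (snd e))"
  have "?f e = ?f e'" if "(e, e') \<in> rel" for e e'
  proof (rule rel_invariant[OF that])
    fix e e' assume "(e, e') \<in> real_gen S dm act"
    then obtain x \<theta> m t where x: "e = (act \<theta> m x, t)" "e' = (x, push \<theta> m t)" "x \<in> S" "mono_to \<theta> m (dm x)" "t \<in> std_simplex m"
      unfolding real_gen_def by blast
    have "rescale \<phi> (act \<theta> m x) t \<in> std_simplex m"
      using rescale_in_simplex[OF assms, of t "act \<theta> m x"] x by (simp add: dm_act)
    then have "((act \<theta> m x, rescale \<phi> (act \<theta> m x) t), (x, push \<theta> m (rescale \<phi> (act \<theta> m x) t))) \<in> real_gen S dm act"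
      using x by (intro genI)
    then show "?f e = ?f e'"
      unfolding x(1,2) fst_conv snd_conv push_rescale[OF x(3,4)] by (intro cls_eqI gen_rel)
  qed
  from this[OF rel_some] show ?thesis unfolding reweight_def Let_def by simp
qed

lemma reweight_in_pts:
  assumes "\<And>p. 0 \<le> \<phi> p" "c \<in> pts"
  shows "reweight \<phi> c \<in> pts"
  using assms(2) by (rule ptsE) (auto simp: assms(1) intro!: cls_in_pts rescale_in_simplex)

lemma weight_reweight:
  assumes "\<And>p. 0 \<le> \<phi> p" "c \<in> pts" "0 < mass \<phi> c"
  shows "weight (reweight \<phi> c) p = \<phi> p * weight c p / mass \<phi> c"
proof -
  obtain x t where x: "x \<in> S" "t \<in> std_simplex (dm x)" "c = cls (x, t)" using assms(2) by (rule ptsE)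
  have "0 < tot \<phi> x t" using assms(3) x by simp
  then show ?thesis
    unfolding x(3) reweight_cls[OF assms(1)] mass_cls[of \<phi>] weight_cls
    by (auto simp: rescale_def sum_distrib_left sum_divide_distrib mult.commute intro!: sum.cong)
qed

lemma reweight_one:
  assumes "\<And>p. \<phi> p = 1" "c \<in> pts"
  shows "reweight \<phi> c = c"
proof -
  obtain x t where x: "x \<in> S" "t \<in> std_simplex (dm x)" "c = cls (x, t)" using assms(2) by (rule ptsE)
  then have "tot \<phi> x t = 1" using std_simplex_sum[of t "dm x"] by (simp add: tot_def assms(1))
  then show ?thesis unfolding x(3) by (subst reweight_cls) (auto simp: assms(1) rescale_def)
qed

lemma continuous_mass: "continuous_map RX euclideanreal (mass \<phi>)"
  unfolding continuous_map_def openin_RX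
proof (intro conjI allI impI ballI)
  fix U :: "real set" and x assume "openin euclideanreal U" "x \<in> S"
  have "continuous_on (std_simplex (dm x)) (tot \<phi> x)"
    unfolding tot_def by (intro continuous_intros)
  then have "openin (Dtop (dm x)) {t \<in> std_simplex (dm x). tot \<phi> x t \<in> U}"
    using \<open>openin euclideanreal U\<close> openin_continuous_map_preimage[of "Dtop (dm x)" euclideanreal "tot \<phi> x" U]
    by (simp add: Dtop_def)
  also have "{t \<in> std_simplex (dm x). tot \<phi> x t \<in> U} = {t \<in> std_simplex (dm x). cls (x, t) \<in> {c \<in> topspace RX. mass \<phi> c \<in> U}}"
    using cls_in_pts[OF \<open>x \<in> S\<close>] by auto
  finally show "openin (Dtop (dm x)) {t \<in> std_simplex (dm x). cls (x, t) \<in> {c \<in> topspace RX. mass \<phi> c \<in> U}}" .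
qed auto

text \<open>The parameter space has to be compact: joint continuity of reweighting on an arbitrary product
  with the realization may fail, the tube lemma is what makes the pointwise check on simplices suffice.\<close>

lemma continuous_reweight:
  fixes M :: "'m::metric_space set"
  assumes M: "compact M" and F: "continuous_map (top_of_set M) RX F"
    and \<phi>: "\<And>p. continuous_on M (\<lambda>m. \<phi> m p)" and nn: "\<And>m p. m \<in> M \<Longrightarrow> 0 \<le> \<phi> m p"
    and pos: "\<And>m. m \<in> M \<Longrightarrow> 0 < mass (\<phi> m) (F m)"
  shows "continuous_map (top_of_set M) RX (\<lambda>m. reweight (\<phi> m) (F m))"
proof -
  have Fp: "F m \<in> pts" if "m \<in> M" for m
    using continuous_map_image_subset_topspace[OF F] that by auto
  \<comment> \<open>The good pairs on a single simplex. Positivity of the total is part of the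
    condition, since the rescaled coordinates are quotients by it.\<close>
  define G where "G x U = {(m, t). m \<in> M \<and> t \<in> std_simplex (dm x) \<and> 0 < tot (\<phi> m) x t \<and> cls (x, rescale (\<phi> m) x t) \<in> U}" for x U
  have G_open: "openin (top_of_set (M \<times> std_simplex (dm x))) (G x U)" if x: "x \<in> S" and U: "openin RX U" for x U
  proof -
    let ?D = "M \<times> std_simplex (dm x)"
    let ?s = "\<lambda>z. tot (\<phi> (fst z)) x (snd z)"
    have c1: "continuous_on ?D (\<lambda>z. \<phi> (fst z) p)" for p
      by (rule continuous_on_compose2[OF \<phi> continuous_on_fst[OF continuous_on_id]]) auto
    have c2: "continuous_on ?D (\<lambda>z. snd z i)" for i
      by (rule continuous_on_compose2[OF continuous_on_eval continuous_on_snd[OF continuous_on_id]]) auto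
    have cs: "continuous_on ?D ?s" unfolding tot_def by (intro continuous_intros c1 c2)
    let ?D' = "?D \<inter> ?s -` {0<..}"
    have D': "openin (top_of_set ?D) ?D'"
      by (rule continuous_openin_preimage_gen[OF cs]) simp
    let ?r = "\<lambda>z. (\<lambda>i. snd z i * \<phi> (fst z) (lab x i) / ?s z)"
    have cr: "continuous_on ?D' ?r"
    proof (rule continuous_on_coordinatewise_then_product)
      fix i
      have "continuous_on ?D' ?s" "continuous_on ?D' (\<lambda>z. snd z i)" "continuous_on ?D' (\<lambda>z. \<phi> (fst z) (lab x i))"
        using cs c1 c2 by (auto intro: continuous_on_subset)
      then show "continuous_on ?D' (\<lambda>z. snd z i * \<phi> (fst z) (lab x i) / ?s z)"
        by (intro continuous_intros) auto
    qed
    have r: "?r z = rescale (\<phi> (fst z)) x (snd z)" if "z \<in> ?D'" for z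
      using that by (auto simp: rescale_def)
    have im: "?r \<in> ?D' \<rightarrow> std_simplex (dm x)"
    proof
      fix z assume z: "z \<in> ?D'"
      then show "?r z \<in> std_simplex (dm x)"
        unfolding r[OF z] by (intro rescale_in_simplex nn) auto
    qed
    have "openin (top_of_set (std_simplex (dm x))) {t \<in> std_simplex (dm x). cls (x, t) \<in> U}"
      using U x unfolding openin_RX Dtop_def by blast
    then have "openin (top_of_set ?D') (?D' \<inter> ?r -` {t \<in> std_simplex (dm x). cls (x, t) \<in> U})"
      by (rule continuous_openin_preimage[OF cr im])
    also have "?D' \<inter> ?r -` {t \<in> std_simplex (dm x). cls (x, t) \<in> U} = G x U"
    proof (rule set_eqI)
      fix z
      show "z \<in> ?D' \<inter> ?r -` {t \<in> std_simplex (dm x). cls (x, t) \<in> U} \<longleftrightarrow> z \<in> G x U"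
      proof (cases "z \<in> ?D'")
        case True
        have "?r z \<in> std_simplex (dm x)" using im True by (rule funcset_mem)
        then show ?thesis using True r[OF True] by (simp add: G_def case_prod_beta mem_Times_iff)
      next
        case False
        then show ?thesis by (auto simp: G_def)
      qed
    qed
    finally show ?thesis using D' by (rule openin_trans)
  qed
  have step: "\<exists>A. openin (top_of_set M) A \<and> m0 \<in> A \<and> (\<forall>m\<in>A. reweight (\<phi> m) (F m) \<in> U)"
    if U: "openin RX U" and m0: "m0 \<in> M" "reweight (\<phi> m0) (F m0) \<in> U" for U m0
  proof -
    obtain x0 t0 where x0: "x0 \<in> S" "t0 \<in> std_simplex (dm x0)" "F m0 = cls (x0, t0)"
      using Fp[OF m0(1)] by (rule ptsE)
    have "(m0, t0) \<in> G x0 U"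
      using m0 x0 pos[OF m0(1)] nn by (simp add: G_def)
    moreover have "openin (top_of_set M) (M \<inter> (\<lambda>m. (m, t0)) -` G x0 U)"
      by (rule continuous_openin_preimage[OF _ _ G_open[OF x0(1) U]]) (use x0 in \<open>auto intro!: continuous_intros\<close>)
    ultimately obtain e where e: "0 < e" "\<And>m. m \<in> M \<Longrightarrow> dist m m0 < e \<Longrightarrow> (m, t0) \<in> G x0 U"
      using m0(1) unfolding openin_euclidean_subtopology_iff by blast
    define N where "N = M \<inter> cball m0 (e/2)"
    have N: "compact N" unfolding N_def using M by (intro compact_Int_closed) auto
    have NM: "N \<subseteq> M" by (auto simp: N_def)
    \<comment> \<open>Being good is demanded for all \<open>m\<close> in \<open>N\<close> at once.
      On each simplex the points that fail form the projection along the compact \<open>N\<close> of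
      a closed set, hence a closed set, so \<open>V\<close> is open in the realization. For
      \<open>m\<close> in \<open>N\<close> with \<open>F m\<close> in \<open>V\<close> the condition
      is then used at that very \<open>m\<close>.\<close>
    define V where "V = {c \<in> pts. \<forall>m\<in>N. 0 < mass (\<phi> m) c \<and> reweight (\<phi> m) c \<in> U}"
    have "openin RX V" unfolding openin_RX
    proof (intro conjI ballI)
      fix x assume x: "x \<in> S"
      have "closedin (top_of_set (N \<times> std_simplex (dm x))) (N \<times> std_simplex (dm x) - G x U)"
      proof -
        have "openin (top_of_set (N \<times> std_simplex (dm x))) (N \<times> std_simplex (dm x) \<inter> G x U)"
        proof -
          obtain T where T: "open T" "G x U = M \<times> std_simplex (dm x) \<inter> T"
            using G_open[OF x U] unfolding openin_open by blast
          then have "N \<times> std_simplex (dm x) \<inter> G x U = N \<times> std_simplex (dm x) \<inter> T" using NM by auto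
          with T(1) show ?thesis unfolding openin_open by blast
        qed
        then have "closedin (top_of_set (N \<times> std_simplex (dm x))) (N \<times> std_simplex (dm x) - (N \<times> std_simplex (dm x) \<inter> G x U))"
          by (simp add: closedin_def double_diff)
        then show ?thesis by (simp add: Diff_Int)
      qed
      then have "closedin (top_of_set (std_simplex (dm x))) (snd ` (N \<times> std_simplex (dm x) - G x U))"
        by (rule closedin_snd_compact[OF N])
      then have "openin (Dtop (dm x)) (std_simplex (dm x) - snd ` (N \<times> std_simplex (dm x) - G x U))"
        by (simp add: Dtop_def openin_diff)
      also have "std_simplex (dm x) - snd ` (N \<times> std_simplex (dm x) - G x U) = {t \<in> std_simplex (dm x). cls (x, t) \<in> V}"
      proof (rule set_eqI)
        fix t
        have "0 < mass (\<phi> m) (cls (x, t)) \<and> reweight (\<phi> m) (cls (x, t)) \<in> U \<longleftrightarrow> (m, t) \<in> G x U"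
          if "m \<in> N" "t \<in> std_simplex (dm x)" for m
          using that NM nn[of m] by (simp add: G_def subset_iff)
        then show "t \<in> std_simplex (dm x) - snd ` (N \<times> std_simplex (dm x) - G x U) \<longleftrightarrow> t \<in> {t \<in> std_simplex (dm x). cls (x, t) \<in> V}"
          using cls_in_pts[OF x, of t] unfolding V_def by force
      qed
      finally show "openin (Dtop (dm x)) {t \<in> std_simplex (dm x). cls (x, t) \<in> V}" .
    qed (auto simp: V_def)
    then have "openin (top_of_set M) {m \<in> M. F m \<in> V}"
      using openin_continuous_map_preimage[OF F] by fastforce
    then have o: "openin (top_of_set M) ({m \<in> M. F m \<in> V} \<inter> (M \<inter> ball m0 (e/2)))"
      by (intro openin_Int openin_open_Int) auto
    have "F m0 \<in> V"
    proof -
      have "0 < tot (\<phi> m) x0 t0 \<and> cls (x0, rescale (\<phi> m) x0 t0) \<in> U" if "m \<in> N" for m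
        using e(2)[of m] \<open>0 < e\<close> that by (auto simp: N_def G_def dist_commute)
      moreover have "reweight (\<phi> m) (cls (x0, t0)) = cls (x0, rescale (\<phi> m) x0 t0)" if "m \<in> N" for m
        using NM nn that by (intro reweight_cls) auto
      ultimately show ?thesis using Fp[OF m0(1)] unfolding V_def x0(3) by simp
    qed
    then show ?thesis
      using o m0 \<open>0 < e\<close> by (intro exI[of _ "{m \<in> M. F m \<in> V} \<inter> (M \<inter> ball m0 (e/2))"]) (auto simp: V_def N_def)
  qed
  show ?thesis
    unfolding continuous_map_def
  proof (intro conjI allI impI)
    show "(\<lambda>m. reweight (\<phi> m) (F m)) \<in> topspace (top_of_set M) \<rightarrow> topspace RX"
      using Fp nn reweight_in_pts by auto
    fix U assume U: "openin RX U"
    show "openin (top_of_set M) {m \<in> topspace (top_of_set M). reweight (\<phi> m) (F m) \<in> U}"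
    proof (subst openin_subopen, rule ballI)
      fix m0 assume "m0 \<in> {m \<in> topspace (top_of_set M). reweight (\<phi> m) (F m) \<in> U}"
      then obtain A where A: "openin (top_of_set M) A" "m0 \<in> A" "\<forall>m\<in>A. reweight (\<phi> m) (F m) \<in> U"
        using step[OF U, of m0] by auto
      then have "A \<subseteq> {m \<in> topspace (top_of_set M). reweight (\<phi> m) (F m) \<in> U}"
        using openin_subset[OF A(1)] by auto
      with A show "\<exists>T. openin (top_of_set M) T \<and> m0 \<in> T \<and> T \<subseteq> {m \<in> topspace (top_of_set M). reweight (\<phi> m) (F m) \<in> U}"
        by blast
    qed
  qed
qed

end

section \<open>The nerve, flags, and both structure maps expressed by weights\<close>

lemma sset_over_nerve: "sset_over nerve_S fst nerve_act (snd :: nat \<times> (nat \<Rightarrow> 'p::order) \<Rightarrow> nat \<Rightarrow> 'p)"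
  unfolding sset_over_def
proof (intro conjI ballI allI impI)
  fix x :: "nat \<times> (nat \<Rightarrow> 'p)" and \<theta> m assume x: "x \<in> nerve_S" and \<theta>: "mono_to \<theta> m (fst x)"
  show "nerve_act \<theta> m x \<in> nerve_S" using x \<theta> by (auto simp: nerve_S_def nerve_act_def mono_to_def)
  show "fst (nerve_act \<theta> m x) = m" by (simp add: nerve_act_def)
next
  fix x :: "nat \<times> (nat \<Rightarrow> 'p)" and \<theta> \<theta>' :: "nat \<Rightarrow> nat" and m assume "mono_to \<theta> m (fst x) \<and> (\<forall>i\<le>m. \<theta> i = \<theta>' i)"
  then show "nerve_act \<theta> m x = nerve_act \<theta>' m x" by (auto simp: nerve_act_def)
next
  fix x :: "nat \<times> (nat \<Rightarrow> 'p)" and \<theta> :: "nat \<Rightarrow> nat" assume "x \<in> nerve_S" "\<forall>i\<le>fst x. \<theta> i = i"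
  moreover obtain n f where "x = (n, f)" by force
  ultimately show "nerve_act \<theta> (fst x) x = x" by (auto simp: nerve_act_def nerve_S_def min_def not_le)
next
  fix x :: "nat \<times> (nat \<Rightarrow> 'p)" and \<theta> \<phi> :: "nat \<Rightarrow> nat" and m k
  assume "mono_to \<theta> m (fst x) \<and> mono_to \<phi> k m"
  then show "nerve_act \<phi> k (nerve_act \<theta> m x) = nerve_act (\<theta> \<circ> \<phi>) k x"
    by (auto simp: nerve_act_def mono_to_def min_def)
qed (auto simp: nerve_S_def nerve_act_def)

text \<open>The nerve lies over itself by the identity, with its vertices as labels. Weights thus
  exist on |N(P)| too, and the structure map from |X| preserves them.\<close>

interpretation nv: sset "nerve_S :: (nat \<times> (nat \<Rightarrow> 'p::order)) set" fst nerve_act snd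
  by unfold_locales (rule sset_over_nerve)

lemma nerve_to_P_eq:
  "nerve_to_P c = (THE p. 0 < nv.weight c p \<and> (\<forall>q. 0 < nv.weight c q \<longrightarrow> q \<le> p))"
  unfolding nerve_to_P_def nv.mass_def nv.tot_def Let_def sum_indicator ..

lemma flag_simplex_in: "flag J \<Longrightarrow> flag_simplex J \<in> nerve_S"
proof -
  assume J: "flag J"
  have "J ! i \<le> J ! j" if "i \<le> j" "j < length J" for i j
    using J that sorted_wrt_nth_less[of "(<)" J i j] by (cases "i = j") (auto simp: flag_def)
  then show ?thesis using J by (cases J) (auto simp: nerve_S_def flag_simplex_def flag_dim_def flag_def min_def)
qed

lemma flag_length: "flag J \<Longrightarrow> i \<le> flag_dim J \<longleftrightarrow> i < length J"
  by (cases J) (auto simp: flag_def flag_dim_def)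

lemma flag_nth_less: "flag J \<Longrightarrow> i < j \<Longrightarrow> j \<le> flag_dim J \<Longrightarrow> J ! i < J ! j"
  using sorted_wrt_nth_less[of "(<)" J i j] by (simp add: flag_length) (simp add: flag_def)

lemma flag_nth_le:
  assumes "flag J" "i \<le> flag_dim J" "j \<le> flag_dim J"
  shows "J ! i \<le> J ! j \<longleftrightarrow> i \<le> j"
proof (cases i j rule: linorder_cases)
  case less
  then show ?thesis using flag_nth_less[OF assms(1) less assms(3)] by simp
next
  case greater
  then show ?thesis using flag_nth_less[OF assms(1) greater assms(2)] by (simp add: less_le_not_le)
qed simp

lemma flag_nth_eq: "flag J \<Longrightarrow> i \<le> flag_dim J \<Longrightarrow> j \<le> flag_dim J \<Longrightarrow> J ! i = J ! j \<longleftrightarrow> i = j"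
  using flag_nth_le[of J i j] flag_nth_le[of J j i] by auto

lemma weight_flag_map:
  assumes J: "flag J" and i: "i \<le> flag_dim J"
  shows "nv.weight (flag_map J t) (J ! i) = t i"
proof -
  have "{j. j \<le> flag_dim J \<and> J ! min j (flag_dim J) = J ! i} = {i}"
  proof (rule set_eqI)
    fix j
    show "j \<in> {j. j \<le> flag_dim J \<and> J ! min j (flag_dim J) = J ! i} \<longleftrightarrow> j \<in> {i}"
      using flag_nth_eq[OF J, of j i] i by (cases "j \<le> flag_dim J") auto
  qed
  then show ?thesis
    unfolding flag_map_def nv.weight_cls by (simp add: flag_simplex_def)
qed

lemma weight_flag_map_outside:
  assumes J: "flag J" and p: "p \<notin> set J"
  shows "nv.weight (flag_map J t) p = 0"
proof -
  have "{j. j \<le> flag_dim J \<and> J ! min j (flag_dim J) = p} = {}"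
  proof -
    have "J ! j \<noteq> p" if "j \<le> flag_dim J" for j
      using p that nth_mem[of j J] flag_length[OF J, of j] by metis
    then show ?thesis by (simp add: min_def)
  qed
  then show ?thesis
    unfolding flag_map_def nv.weight_cls by (simp add: flag_simplex_def)
qed

text \<open>Collapsing a chain onto the support of its coordinates, each index going to the closest
  supported index below it, does not change the point it represents.\<close>

lemma collapse_to_support:
  assumes t: "t \<in> std_simplex n"
  obtains \<theta> where "mono_to \<theta> n n" "\<And>i. i \<le> n \<Longrightarrow> 0 < t (\<theta> i)" "push \<theta> n t = t"
proof -
  let ?A = "{i. i \<le> n \<and> 0 < t i}"
  define B where "B i = {a \<in> ?A. a \<le> i}" for i
  \<comment> \<open>Indices below the whole support have no supported index under them; sending them
    to the smallest supported one keeps \<open>\<theta>\<close> monotone.\<close>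
  define \<theta> where "\<theta> i = (if B i = {} then Min ?A else Max (B i))" for i
  obtain k where k: "k \<in> ?A" using std_simplex_top[OF t] by blast
  have fB: "finite (B i)" for i by (simp add: B_def)
  have mA: "Min ?A \<in> ?A" using k by (intro Min_in) auto
  have mB: "Max (B i) \<in> B i" if "B i \<noteq> {}" for i using fB that by (intro Max_in) auto
  have \<theta>A: "\<theta> i \<in> ?A" for i
    using mA mB[of i] unfolding \<theta>_def by (auto simp: B_def)
  have fixA: "\<theta> i = i" if "i \<in> ?A" for i
  proof -
    have "i \<in> B i" using that by (simp add: B_def)
    then have "\<theta> i = Max (B i)" by (auto simp: \<theta>_def)
    also have "\<dots> = i" using \<open>i \<in> B i\<close> by (intro Max_eqI fB) (auto simp: B_def)
    finally show ?thesis .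
  qed
  have mono: "\<theta> i \<le> \<theta> j" if "i \<le> j" for i j
  proof (cases "B i = {}")
    case True
    then show ?thesis using \<theta>A[of j] by (auto simp: \<theta>_def intro!: Min_le)
  next
    case False
    have "B i \<subseteq> B j" using that by (auto simp: B_def)
    then show ?thesis using False fB Max_mono[of "B i" "B j"] by (auto simp: \<theta>_def)
  qed
  have "push \<theta> n t = t"
  proof
    fix j
    show "push \<theta> n t j = t j"
    proof (cases "j \<in> ?A")
      case True
      have "push \<theta> n t j = (\<Sum>i\<in>{j}. t i)"
        unfolding push_def
      proof (rule sum.mono_neutral_right)
        show "\<forall>i\<in>{i. i \<le> n \<and> \<theta> i = j} - {j}. t i = 0"
        proof
          fix i assume i: "i \<in> {i. i \<le> n \<and> \<theta> i = j} - {j}"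
          then have "i \<notin> ?A" using fixA[of i] by auto
          then show "t i = 0" using i std_simplex_nonneg[OF t, of i] by auto
        qed
      qed (use True fixA[OF True] in auto)
      then show ?thesis by simp
    next
      case False
      then have "{i. i \<le> n \<and> \<theta> i = j} = {}" using \<theta>A by blast
      moreover have "t j = 0" using False std_simplex_nonneg[OF t, of j] std_simplex_zero[OF t, of j] by force
      ultimately show ?thesis by (simp only: push_def sum.empty)
    qed
  qed
  moreover have "mono_to \<theta> n n" using mono \<theta>A unfolding mono_to_def by blast
  moreover have "0 < t (\<theta> i)" for i using \<theta>A[of i] by blast
  ultimately show ?thesis by (intro that)
qed

text \<open>After collapsing onto the support all vertices of the chain belong to the flag, so the
  chain is a pullback of the flag simplex. The point is then the image of some coordinate vector of
  the flag, and that vector is read off from the weights.\<close>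

lemma nerve_cls_eq_flag_map:
  assumes J: "flag J" and x: "x \<in> nerve_S" and t: "t \<in> std_simplex (fst x)"
    and w: "\<And>i. i \<le> flag_dim J \<Longrightarrow> nv.weight (NP_cls (x, t)) (J ! i) = t' i"
    and w0: "\<And>p. p \<notin> set J \<Longrightarrow> nv.weight (NP_cls (x, t)) p = 0"
    and t': "t' \<in> std_simplex (flag_dim J)"
  shows "NP_cls (x, t) = flag_map J t'"
proof -
  obtain n f where nf: "x = (n, f)" by force
  let ?d = "flag_dim J"
  have t: "t \<in> std_simplex n" using t nf by simp
  obtain \<theta> where \<theta>: "mono_to \<theta> n n" "\<And>i. i \<le> n \<Longrightarrow> 0 < t (\<theta> i)" "push \<theta> n t = t"
    using collapse_to_support[OF t] by metis
  have wf: "nv.weight (NP_cls (x, t)) p = (\<Sum>i\<in>{i. i \<le> n \<and> f i = p}. t i)" for p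
    unfolding nv.weight_cls by (simp add: nf)
  have inJ: "f i \<in> set J" if "i \<le> n" "0 < t i" for i
  proof (rule ccontr)
    assume "f i \<notin> set J"
    then have "(\<Sum>j\<in>{j. j \<le> n \<and> f j = f i}. t j) = 0" using w0 wf by simp
    moreover have "0 < (\<Sum>j\<in>{j. j \<le> n \<and> f j = f i}. t j)"
      by (rule sum_pos2[of _ i]) (use that std_simplex_nonneg[OF t] in auto)
    ultimately show False by simp
  qed
  have "\<exists>j\<le>?d. f (\<theta> i) = J ! j" if "i \<le> n" for i
    using inJ[of "\<theta> i"] \<theta>(1,2) that flag_length[OF J] unfolding mono_to_def by (metis in_set_conv_nth)
  then obtain s where s: "\<And>i. i \<le> n \<Longrightarrow> s i \<le> ?d" "\<And>i. i \<le> n \<Longrightarrow> f (\<theta> i) = J ! s i" by metis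
  have fm: "f i \<le> f j" if "i \<le> j" "j \<le> n" for i j using x that by (auto simp: nf nerve_S_def)
  have sm: "mono_to s n ?d"
    unfolding mono_to_def
  proof (intro conjI allI impI)
    fix i j assume ij: "i \<le> j" "j \<le> n"
    then have "f (\<theta> i) \<le> f (\<theta> j)" using \<theta>(1) by (intro fm) (auto simp: mono_to_def)
    then show "s i \<le> s j" using s[of i] s[of j] ij flag_nth_le[OF J, of "s i" "s j"] by auto
  qed (use s in auto)
  \<comment> \<open>One chain is a pullback of \<open>x\<close> along \<open>\<theta>\<close> and of
    the flag simplex along \<open>s\<close>. Pushing \<open>t\<close> forward along both maps
    identifies the points they represent.\<close>
  have eq: "nerve_act \<theta> n x = nerve_act s n (flag_simplex J)"
    using s by (auto simp: nerve_act_def nf flag_simplex_def min_def)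
  have "((nerve_act \<theta> n x, t), (x, push \<theta> n t)) \<in> real_gen nerve_S fst nerve_act"
    using x \<theta>(1) t nf by (intro nv.genI) auto
  then have 1: "NP_cls (nerve_act \<theta> n x, t) = NP_cls (x, t)"
    unfolding \<theta>(3) by (intro nv.cls_eqI nv.gen_rel)
  have "((nerve_act s n (flag_simplex J), t), (flag_simplex J, push s n t)) \<in> real_gen nerve_S fst nerve_act"
    using flag_simplex_in[OF J] sm t by (intro nv.genI) (auto simp: flag_simplex_def)
  then have 2: "NP_cls (x, t) = flag_map J (push s n t)"
    unfolding flag_map_def using 1 eq by (metis nv.cls_eqI nv.gen_rel)
  have "push s n t = t'"
  proof
    fix i
    show "push s n t i = t' i"
    proof (cases "i \<le> ?d")
      case True
      then show ?thesis using w[OF True] weight_flag_map[OF J True] 2 by metis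
    next
      case False
      then show ?thesis
        using std_simplex_zero[OF t'] std_simplex_zero[OF push_in_simplex[OF sm t]] by simp
    qed
  qed
  with 2 show ?thesis by simp
qed

context sset
begin

lemma real_map_cls: "real_map dm lab (cls (x, t)) = NP_cls (to_nerve dm lab x, t)"
proof -
  let ?f = "\<lambda>e. NP_cls (to_nerve dm lab (fst e), snd e)"
  have "?f e = ?f e'" if "(e, e') \<in> rel" for e e'
  proof (rule rel_invariant[OF that])
    fix e e' assume "(e, e') \<in> real_gen S dm act"
    then obtain x \<theta> m t where x: "e = (act \<theta> m x, t)" "e' = (x, push \<theta> m t)" "x \<in> S" "mono_to \<theta> m (dm x)" "t \<in> std_simplex m"
      unfolding real_gen_def by blast
    have "to_nerve dm lab x \<in> nerve_S"
      using lab_mono[OF x(3)] by (auto simp: to_nerve_def nerve_S_def)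
    moreover have "to_nerve dm lab (act \<theta> m x) = nerve_act \<theta> m (to_nerve dm lab x)"
      using x(4) by (auto simp: to_nerve_def nerve_act_def dm_act[OF x(3,4)] lab_act[OF x(3,4)] mono_to_def min_def)
    moreover have "fst (to_nerve dm lab x) = dm x" by (simp add: to_nerve_def)
    ultimately have "((to_nerve dm lab (act \<theta> m x), t), (to_nerve dm lab x, push \<theta> m t)) \<in> real_gen nerve_S fst nerve_act"
      using nv.genI[of "to_nerve dm lab x" \<theta> m t] x(4,5) by simp
    then show "?f e = ?f e'" unfolding x(1,2) fst_conv snd_conv by (intro nv.cls_eqI nv.gen_rel)
  qed
  from this[OF rel_some] show ?thesis unfolding real_map_def Let_def by simp
qed

lemma mass_real_map:
  assumes "c \<in> pts"
  shows "nv.mass \<phi> (real_map dm lab c) = mass \<phi> c"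
proof -
  obtain x t where x: "x \<in> S" "t \<in> std_simplex (dm x)" "c = cls (x, t)" using assms by (rule ptsE)
  show ?thesis
    unfolding x(3) real_map_cls mass_cls nv.mass_cls
    by (auto simp: tot_def nv.tot_def to_nerve_def intro!: sum.cong)
qed

lemma nerve_to_P_real_map:
  assumes "c \<in> pts"
  shows "nerve_to_P (real_map dm lab c) = p \<longleftrightarrow> 0 < weight c p \<and> (\<forall>q. 0 < weight c q \<longrightarrow> q \<le> p)"
proof -
  let ?P = "\<lambda>p. 0 < weight c p \<and> (\<forall>q. 0 < weight c q \<longrightarrow> q \<le> p)"
  obtain p0 where p0: "?P p0" using weight_top_exists[OF assms] by blast
  have u: "p' = p0" if "?P p'" for p' using that p0 by (meson order_antisym)
  have "(THE p. ?P p) = p0" by (rule the_equality) (use p0 u in blast)+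
  then have "nerve_to_P (real_map dm lab c) = p0"
    unfolding nerve_to_P_eq mass_real_map[OF assms] .
  then show ?thesis using p0 u by metis
qed

text \<open>Lying over |N(P)| becomes a condition on weights, which are exactly what reweighting
  controls.\<close>

lemma real_map_eq_flag_map_iff:
  assumes c: "c \<in> pts" and J: "flag J" and t: "t \<in> std_simplex (flag_dim J)"
  shows "real_map dm lab c = flag_map J t \<longleftrightarrow>
    (\<forall>i\<le>flag_dim J. weight c (J ! i) = t i) \<and> (\<forall>p. p \<notin> set J \<longrightarrow> weight c p = 0)"
proof
  assume "real_map dm lab c = flag_map J t"
  then have "weight c p = nv.weight (flag_map J t) p" for p using mass_real_map[OF c] by metis
  then show "(\<forall>i\<le>flag_dim J. weight c (J ! i) = t i) \<and> (\<forall>p. p \<notin> set J \<longrightarrow> weight c p = 0)"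
    using weight_flag_map[OF J] weight_flag_map_outside[OF J] by simp
next
  assume w: "(\<forall>i\<le>flag_dim J. weight c (J ! i) = t i) \<and> (\<forall>p. p \<notin> set J \<longrightarrow> weight c p = 0)"
  obtain x u where x: "x \<in> S" "u \<in> std_simplex (dm x)" "c = cls (x, u)" using c by (rule ptsE)
  have "to_nerve dm lab x \<in> nerve_S" "fst (to_nerve dm lab x) = dm x"
    using lab_mono[OF x(1)] by (auto simp: to_nerve_def nerve_S_def)
  moreover have "nv.weight (NP_cls (to_nerve dm lab x, u)) p = weight c p" for p
    using mass_real_map[OF c] unfolding x(3) real_map_cls .
  ultimately show "real_map dm lab c = flag_map J t"
    unfolding x(3) real_map_cls using w x t J by (intro nerve_cls_eq_flag_map) auto
qed

text \<open>The flag is strictly increasing, so the stratum of \<open>t\<close> is the label of its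
  last nonzero index \<open>k\<close>. Only this one weight is forced to be positive.\<close>

lemma stratum_eq_flag_iff:
  assumes c: "c \<in> pts" and J: "flag J" and t: "t \<in> std_simplex (flag_dim J)"
    and k: "k \<le> flag_dim J" "0 < t k" "\<And>j. k < j \<Longrightarrow> t j = 0"
  shows "nerve_to_P (real_map dm lab c) = nerve_to_P (flag_map J t) \<longleftrightarrow>
    0 < weight c (J ! k) \<and> (\<forall>q. 0 < weight c q \<longrightarrow> q \<le> J ! k)"
proof -
  have "q \<le> J ! k" if "0 < nv.weight (flag_map J t) q" for q
  proof -
    have "q \<in> set J" using that weight_flag_map_outside[OF J, of q] by force
    then obtain i where i: "q = J ! i" "i \<le> flag_dim J" by (metis in_set_conv_nth flag_length[OF J])
    then have "i \<le> k" using that weight_flag_map[OF J i(2)] k(3)[of i] by force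
    then show ?thesis using i k flag_nth_le[OF J] by auto
  qed
  moreover have "0 < nv.weight (flag_map J t) (J ! k)" using weight_flag_map[OF J k(1)] k by simp
  ultimately have "nerve_to_P (flag_map J t) = J ! k"
    unfolding nerve_to_P_eq by (intro the_equality) (auto intro: order_antisym)
  then show ?thesis using nerve_to_P_real_map[OF c] by simp
qed

end

section \<open>Delta-ification and the compact-open topology\<close>

lemma openin_deltafy:
  "openin (deltafy T) U \<longleftrightarrow> U \<subseteq> topspace T \<and>
      (\<forall>k \<sigma>. continuous_map (Dtop k) T \<sigma> \<longrightarrow> openin (Dtop k) {t \<in> std_simplex k. \<sigma> t \<in> U})"
proof -
  have "istopology (\<lambda>U. U \<subseteq> topspace T \<and>
      (\<forall>k \<sigma>. continuous_map (Dtop k) T \<sigma> \<longrightarrow> openin (Dtop k) {t \<in> std_simplex k. \<sigma> t \<in> U}))"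
    unfolding istopology_def
  proof (intro conjI allI impI; (elim conjE)?)
    fix A B k \<sigma> assume "continuous_map (Dtop k) T \<sigma>"
      "\<forall>k \<sigma>. continuous_map (Dtop k) T \<sigma> \<longrightarrow> openin (Dtop k) {t \<in> std_simplex k. \<sigma> t \<in> A}"
      "\<forall>k \<sigma>. continuous_map (Dtop k) T \<sigma> \<longrightarrow> openin (Dtop k) {t \<in> std_simplex k. \<sigma> t \<in> B}"
    then have "openin (Dtop k) ({t \<in> std_simplex k. \<sigma> t \<in> A} \<inter> {t \<in> std_simplex k. \<sigma> t \<in> B})"
      by (intro openin_Int) simp_all
    also have "{t \<in> std_simplex k. \<sigma> t \<in> A} \<inter> {t \<in> std_simplex k. \<sigma> t \<in> B} = {t \<in> std_simplex k. \<sigma> t \<in> A \<inter> B}"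
      by auto
    finally show "openin (Dtop k) {t \<in> std_simplex k. \<sigma> t \<in> A \<inter> B}" .
  next
    fix \<K> k \<sigma> assume "continuous_map (Dtop k) T \<sigma>" "\<forall>K\<in>\<K>. K \<subseteq> topspace T \<and>
      (\<forall>k \<sigma>. continuous_map (Dtop k) T \<sigma> \<longrightarrow> openin (Dtop k) {t \<in> std_simplex k. \<sigma> t \<in> K})"
    then have "openin (Dtop k) (\<Union>K\<in>\<K>. {t \<in> std_simplex k. \<sigma> t \<in> K})"
      by (intro openin_Union) auto
    also have "(\<Union>K\<in>\<K>. {t \<in> std_simplex k. \<sigma> t \<in> K}) = {t \<in> std_simplex k. \<sigma> t \<in> \<Union>\<K>}" by auto
    finally show "openin (Dtop k) {t \<in> std_simplex k. \<sigma> t \<in> \<Union>\<K>}" .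
  qed auto
  then show ?thesis unfolding deltafy_def by simp
qed

lemma openin_imp_openin_deltafy:
  assumes "openin T U" shows "openin (deltafy T) U"
  unfolding openin_deltafy
proof (intro conjI allI impI)
  show "U \<subseteq> topspace T" using assms by (rule openin_subset)
  fix k \<sigma> assume "continuous_map (Dtop k) T \<sigma>"
  from openin_continuous_map_preimage[OF this assms]
  show "openin (Dtop k) {t \<in> std_simplex k. \<sigma> t \<in> U}" by simp
qed

lemma topspace_deltafy [simp]: "topspace (deltafy T) = topspace T"
proof
  show "topspace (deltafy T) \<subseteq> topspace T"
    using openin_topspace[of "deltafy T"] unfolding openin_deltafy by (rule conjunct1)
  show "topspace T \<subseteq> topspace (deltafy T)"
    by (intro openin_subset openin_imp_openin_deltafy openin_topspace)
qed

lemma continuous_map_from_deltafy: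
  assumes "continuous_map Y (deltafy T) g" shows "continuous_map Y T g"
  using assms openin_imp_openin_deltafy unfolding continuous_map_def by (metis topspace_deltafy)

text \<open>The topology of \<open>deltafy T\<close> is tested by maps out of simplices. On a
  retract of a simplex, \<open>g\<close> agrees with \<open>(g \<circ> \<sigma>) \<circ> s\<close>,
  so continuity into \<open>T\<close> already gives continuity into
  \<open>deltafy T\<close>.\<close>

definition simplex_retract :: "'a topology \<Rightarrow> bool" where
  "simplex_retract Y \<longleftrightarrow> (\<exists>k \<sigma> s. continuous_map (Dtop k) Y \<sigma> \<and> continuous_map Y (Dtop k) s \<and> (\<forall>y\<in>topspace Y. \<sigma> (s y) = y))"

lemma continuous_map_into_deltafy:
  assumes Y: "simplex_retract Y" and g: "continuous_map Y T g"
  shows "continuous_map Y (deltafy T) g"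
proof -
  obtain k \<sigma> s where \<sigma>: "continuous_map (Dtop k) Y \<sigma>" and s: "continuous_map Y (Dtop k) s" and r: "\<And>y. y \<in> topspace Y \<Longrightarrow> \<sigma> (s y) = y"
    using Y unfolding simplex_retract_def by blast
  have "openin Y {y \<in> topspace Y. g y \<in> U}" if U: "openin (deltafy T) U" for U
  proof -
    have "continuous_map (Dtop k) T (g \<circ> \<sigma>)" using \<sigma> g by (rule continuous_map_compose)
    then have "openin (Dtop k) {t \<in> std_simplex k. (g \<circ> \<sigma>) t \<in> U}"
      using U unfolding openin_deltafy by blast
    from openin_continuous_map_preimage[OF s this]
    have "openin Y {y \<in> topspace Y. s y \<in> {t \<in> std_simplex k. (g \<circ> \<sigma>) t \<in> U}}" .
    also have "{y \<in> topspace Y. s y \<in> {t \<in> std_simplex k. (g \<circ> \<sigma>) t \<in> U}} = {y \<in> topspace Y. g y \<in> U}"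
      using r continuous_map_image_subset_topspace[OF s] by auto
    finally show ?thesis .
  qed
  then show ?thesis using g unfolding continuous_map_def by simp
qed

text \<open>The section \<open>s\<close> shrinks the cube by the factor \<open>n\<close> into a
  corner of the simplex and puts the missing mass on coordinate \<open>n\<close>. The retraction
  scales back, and truncating at 1 makes it land in the cube on the whole simplex.\<close>

lemma simplex_retract_cube: "simplex_retract (top_of_set (cube_n n))"
proof -
  define \<sigma> :: "(nat \<Rightarrow> real) \<Rightarrow> nat \<Rightarrow> real" where
    "\<sigma> t = (\<lambda>i. if i < n then min 1 (real n * t i) else 0)" for t
  define s :: "(nat \<Rightarrow> real) \<Rightarrow> nat \<Rightarrow> real" where
    "s x = (\<lambda>i. if i < n then x i / real n else if i = n then 1 - (\<Sum>j<n. x j / real n) else 0)" for x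
  have "continuous_on A (\<lambda>t. \<sigma> t i)" for A i
    unfolding \<sigma>_def by (cases "i < n") (auto intro!: continuous_intros)
  then have 1: "continuous_on (std_simplex n) \<sigma>" by (intro continuous_on_coordinatewise_then_product)
  have "continuous_on A (\<lambda>t. s t i)" for A i
    unfolding s_def by (cases "i < n"; cases "i = n") (auto intro!: continuous_intros)
  then have 2: "continuous_on (cube_n n) s" by (intro continuous_on_coordinatewise_then_product)
  have 3: "\<sigma> \<in> std_simplex n \<rightarrow> cube_n n"
    using std_simplex_nonneg by (fastforce simp: \<sigma>_def cube_n_def)
  have 4: "s x \<in> std_simplex n" if x: "x \<in> cube_n n" for x
  proof -
    have "(\<Sum>j<n. x j / real n) \<le> (\<Sum>j<n. 1 / real n)"
      by (rule sum_mono) (use x in \<open>auto simp: cube_n_def divide_right_mono\<close>)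
    also have "\<dots> \<le> 1" by simp
    finally have "0 \<le> s x i" for i using x by (auto simp: s_def cube_n_def)
    moreover have "(\<Sum>i\<le>n. s x i) = 1"
    proof -
      have "(\<Sum>i\<le>n. s x i) = (\<Sum>i<n. s x i) + s x n" by (simp add: lessThan_Suc_atMost[symmetric])
      also have "(\<Sum>i<n. s x i) = (\<Sum>j<n. x j / real n)" by (rule sum.cong) (auto simp: s_def)
      finally show ?thesis by (simp add: s_def)
    qed
    ultimately show ?thesis by (auto simp: std_simplex_def atMost_atLeast0 s_def)
  qed
  have 5: "\<sigma> (s x) = x" if "x \<in> cube_n n" for x
    using that by (auto simp: \<sigma>_def s_def cube_n_def)
  show ?thesis
    unfolding simplex_retract_def
  proof (intro exI conjI)
    show "continuous_map (Dtop n) (top_of_set (cube_n n)) \<sigma>" using 1 3 by (auto simp: Dtop_def)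
    show "continuous_map (top_of_set (cube_n n)) (Dtop n) s" using 2 4 by (auto simp: Dtop_def)
  qed (use 5 in auto)
qed

lemma simplex_retract_trans:
  assumes "simplex_retract Y" "continuous_map Y Z f" "continuous_map Z Y g" "\<And>z. z \<in> topspace Z \<Longrightarrow> f (g z) = z"
  shows "simplex_retract Z"
proof -
  obtain k \<sigma> s where \<sigma>: "continuous_map (Dtop k) Y \<sigma>" and s: "continuous_map Y (Dtop k) s" and r: "\<And>y. y \<in> topspace Y \<Longrightarrow> \<sigma> (s y) = y"
    using assms(1) unfolding simplex_retract_def by blast
  have "(f \<circ> \<sigma>) ((s \<circ> g) z) = z" if "z \<in> topspace Z" for z
    using r[of "g z"] continuous_map_image_subset_topspace[OF assms(3)] assms(4)[OF that] that by auto
  then show ?thesis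
    unfolding simplex_retract_def
    using continuous_map_compose[OF \<sigma> assms(2)] continuous_map_compose[OF assms(3) s] by blast
qed

definition cube_cons :: "real \<times> (nat \<Rightarrow> real) \<Rightarrow> nat \<Rightarrow> real" where
  "cube_cons z = (\<lambda>i. case i of 0 \<Rightarrow> fst z | Suc j \<Rightarrow> snd z j)"

lemma cube_cons_simps [simp]: "cube_cons z 0 = fst z" "cube_cons z (Suc j) = snd z j"
  by (simp_all add: cube_cons_def)

lemma cube_cons_in: "s \<in> {0..1} \<Longrightarrow> x \<in> cube_n n \<Longrightarrow> cube_cons (s, x) \<in> cube_n (Suc n)"
  by (auto simp: cube_n_def cube_cons_def split: nat.splits)

lemma cube_uncons_in: "y \<in> cube_n (Suc n) \<Longrightarrow> y 0 \<in> {0..1} \<and> (\<lambda>i. y (Suc i)) \<in> cube_n n"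
  by (auto simp: cube_n_def)

lemma continuous_on_snd_eval: "continuous_on A (\<lambda>z. snd z (i::nat) :: real)"
  by (rule continuous_on_compose2[OF continuous_on_eval continuous_on_snd[OF continuous_on_id]]) auto

lemma continuous_on_cube_cons: "continuous_on A cube_cons"
proof (rule continuous_on_coordinatewise_then_product)
  fix i show "continuous_on A (\<lambda>z. cube_cons z i)"
    by (cases i) (auto intro!: continuous_on_fst continuous_on_id continuous_on_snd_eval)
qed

lemma continuous_on_cube_uncons: "continuous_on A (\<lambda>y. (y 0, \<lambda>i. y (Suc i)) :: real \<times> (nat \<Rightarrow> real))"
  by (intro continuous_on_Pair continuous_on_coordinatewise_then_product continuous_on_eval)

lemma simplex_retract_interval_cube: "simplex_retract (top_of_set ({0..1::real} \<times> cube_n n))"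
proof (rule simplex_retract_trans[OF simplex_retract_cube[of "Suc n"], where f = "\<lambda>y. (y 0, \<lambda>i. y (Suc i))" and g = cube_cons])
  show "continuous_map (top_of_set (cube_n (Suc n))) (top_of_set ({0..1} \<times> cube_n n)) (\<lambda>y. (y 0, \<lambda>i. y (Suc i)))"
    using continuous_on_cube_uncons cube_uncons_in by auto
  show "continuous_map (top_of_set ({0..1} \<times> cube_n n)) (top_of_set (cube_n (Suc n))) cube_cons"
    using continuous_on_cube_cons cube_cons_in by auto
qed (auto simp: cube_cons_def)

lemma topspace_compact_open:
  "topspace (compact_open X Y) = {f. f \<in> extensional (topspace X) \<and> continuous_map X Y f}"
  unfolding compact_open_def topology_generated_by_topspace
proof (intro equalityI subsetI)
  fix f assume f: "f \<in> {f. f \<in> extensional (topspace X) \<and> continuous_map X Y f}"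
  show "f \<in> \<Union> {{f \<in> extensional (topspace X). continuous_map X Y f \<and> f ` K \<subseteq> U} |K U. compactin X K \<and> openin Y U}"
    \<comment> \<open>The subbasic set of an empty compact set and an empty open set imposes no
      condition on \<open>f\<close>.\<close>
    by (rule UnionI[of "{f \<in> extensional (topspace X). continuous_map X Y f \<and> f ` {} \<subseteq> {}}"])
      (use f in \<open>auto intro!: exI[of _ "{}"]\<close>)
qed auto

text \<open>Evaluation is continuous because \<open>D\<close> is locally compact:
  \<open>g a0\<close> maps a small closed ball around \<open>t0\<close> into \<open>U\<close>, and
  doing so is a subbasic condition on the map, hence open in \<open>a\<close>.\<close>

lemma continuous_map_uncurry:
  fixes D :: "'d::metric_space set" and A :: "'a::topological_space set"
  assumes D: "compact D" and g: "continuous_map (top_of_set A) (compact_open (top_of_set D) Z) g"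
  shows "continuous_map (top_of_set (A \<times> D)) Z (\<lambda>(a, t). g a t)"
proof -
  have ga: "continuous_map (top_of_set D) Z (g a)" if "a \<in> A" for a
    using continuous_map_image_subset_topspace[OF g] that by (auto simp: topspace_compact_open)
  have step: "\<exists>T. openin (top_of_set (A \<times> D)) T \<and> (a0, t0) \<in> T \<and> (\<forall>z\<in>T. g (fst z) (snd z) \<in> U)"
    if U: "openin Z U" and a0: "a0 \<in> A" "t0 \<in> D" "g a0 t0 \<in> U" for U a0 t0
  proof -
    have "openin (top_of_set D) {t \<in> D. g a0 t \<in> U}"
      using openin_continuous_map_preimage[OF ga[OF a0(1)] U] by simp
    then obtain e where e: "0 < e" "\<And>t. t \<in> D \<Longrightarrow> dist t t0 < e \<Longrightarrow> g a0 t \<in> U"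
      using a0 unfolding openin_euclidean_subtopology_iff by blast
    let ?N = "D \<inter> cball t0 (e/2)"
    have N: "compactin (top_of_set D) ?N" using D by (simp add: compactin_subtopology compact_Int_closed)
    let ?S = "{f. f \<in> extensional (topspace (top_of_set D)) \<and> continuous_map (top_of_set D) Z f \<and> f ` ?N \<subseteq> U}"
    have "openin (compact_open (top_of_set D) Z) ?S"
      unfolding compact_open_def by (rule topology_generated_by_Basis) (use N U in blast)
    then have o: "openin (top_of_set A) {a \<in> A. g a \<in> ?S}"
      using openin_continuous_map_preimage[OF g] by fastforce
    have "openin (top_of_set (A \<times> D)) ({a \<in> A. g a \<in> ?S} \<times> (D \<inter> ball t0 (e/2)))"
      by (intro openin_Times o openin_open_Int) simp
    moreover have "a0 \<in> {a \<in> A. g a \<in> ?S}"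
      using a0 e continuous_map_image_subset_topspace[OF g]
      by (auto simp: topspace_compact_open dist_commute)
    ultimately show ?thesis
      using a0 e(1) by (intro exI[of _ "{a \<in> A. g a \<in> ?S} \<times> (D \<inter> ball t0 (e/2))"]) (force simp: image_subset_iff)
  qed
  show ?thesis
    unfolding continuous_map_def
  proof (intro conjI allI impI)
    show "(\<lambda>(a, t). g a t) \<in> topspace (top_of_set (A \<times> D)) \<rightarrow> topspace Z"
      using ga continuous_map_image_subset_topspace by fastforce
    fix U assume U: "openin Z U"
    let ?P = "{z \<in> topspace (top_of_set (A \<times> D)). (case z of (a, t) \<Rightarrow> g a t) \<in> U}"
    show "openin (top_of_set (A \<times> D)) ?P"
    proof (subst openin_subopen, rule ballI)
      fix z assume "z \<in> ?P"
      then obtain T where T: "openin (top_of_set (A \<times> D)) T" "z \<in> T" "\<forall>z\<in>T. g (fst z) (snd z) \<in> U"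
        using step[OF U, of "fst z" "snd z"] by auto
      moreover have "T \<subseteq> ?P" using openin_subset[OF T(1)] T(3) by auto
      ultimately show "\<exists>T. openin (top_of_set (A \<times> D)) T \<and> z \<in> T \<and> T \<subseteq> ?P" by blast
    qed
  qed
qed

text \<open>For a subbasic set given by a compact \<open>K\<close>, the parameters that violate it
  form the projection along \<open>K\<close> of a closed set.\<close>

lemma continuous_map_curry:
  fixes D :: "'d::topological_space set" and A :: "'a::topological_space set"
  assumes h: "continuous_map (top_of_set (A \<times> D)) Z h"
  shows "continuous_map (top_of_set A) (compact_open (top_of_set D) Z) (\<lambda>a. restrict (\<lambda>t. h (a, t)) D)"
proof -
  have ha: "continuous_map (top_of_set D) Z (restrict (\<lambda>t. h (a, t)) D)" if "a \<in> A" for a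
  proof -
    have "continuous_map (top_of_set D) (top_of_set (A \<times> D)) (\<lambda>t. (a, t))"
      using that by (auto intro!: continuous_intros)
    then have "continuous_map (top_of_set D) Z (h \<circ> (\<lambda>t. (a, t)))" using h by (rule continuous_map_compose)
    then show ?thesis by (rule continuous_map_eq) auto
  qed
  show ?thesis
    unfolding compact_open_def
  proof (rule continuous_on_generated_topo)
    fix Q assume "Q \<in> {{f. f \<in> extensional (topspace (top_of_set D)) \<and> continuous_map (top_of_set D) Z f \<and> f ` K \<subseteq> U} |K U. compactin (top_of_set D) K \<and> openin Z U}"
    then obtain K U where Q: "Q = {f. f \<in> extensional (topspace (top_of_set D)) \<and> continuous_map (top_of_set D) Z f \<and> f ` K \<subseteq> U}"
      and K: "compactin (top_of_set D) K" and U: "openin Z U" by blast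
    have K: "compact K" "K \<subseteq> D" using K by (auto simp: compactin_subtopology)
    have "continuous_map (top_of_set (K \<times> A)) (top_of_set (A \<times> D)) (\<lambda>z. (snd z, fst z))"
      using K by (auto intro!: continuous_intros)
    then have "continuous_map (top_of_set (K \<times> A)) Z (h \<circ> (\<lambda>z. (snd z, fst z)))" using h by (rule continuous_map_compose)
    then have "openin (top_of_set (K \<times> A)) {z \<in> K \<times> A. h (snd z, fst z) \<in> U}"
      using openin_continuous_map_preimage[OF _ U] by fastforce
    then have "closedin (top_of_set (K \<times> A)) (K \<times> A - {z \<in> K \<times> A. h (snd z, fst z) \<in> U})"
      by (intro closedin_diff) (auto simp: closedin_def)
    then have "closedin (top_of_set A) (snd ` (K \<times> A - {z \<in> K \<times> A. h (snd z, fst z) \<in> U}))"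
      by (rule closedin_snd_compact[OF K(1)])
    then have "openin (top_of_set A) (A - snd ` (K \<times> A - {z \<in> K \<times> A. h (snd z, fst z) \<in> U}))"
      by (simp add: openin_diff)
    also have "A - snd ` (K \<times> A - {z \<in> K \<times> A. h (snd z, fst z) \<in> U}) = (\<lambda>a. restrict (\<lambda>t. h (a, t)) D) -` Q \<inter> topspace (top_of_set A)"
      (is "?L = ?R")
    proof (rule set_eqI)
      fix a
      have "a \<in> ?L \<longleftrightarrow> a \<in> A \<and> (\<forall>t\<in>K. h (a, t) \<in> U)" by force
      also have "\<dots> \<longleftrightarrow> a \<in> ?R" using ha[of a] K(2) unfolding Q by (auto simp: subset_iff)
      finally show "a \<in> ?L \<longleftrightarrow> a \<in> ?R" .
    qed
    finally show "openin (top_of_set A) ((\<lambda>a. restrict (\<lambda>t. h (a, t)) D) -` Q \<inter> topspace (top_of_set A))" .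
  next
    have "(\<lambda>a. restrict (\<lambda>t. h (a, t)) D) ` topspace (top_of_set A) \<subseteq> topspace (compact_open (top_of_set D) Z)"
      using ha by (auto simp: topspace_compact_open)
    then show "(\<lambda>a. restrict (\<lambda>t. h (a, t)) D) ` topspace (top_of_set A) \<subseteq> \<Union> {{f. f \<in> extensional (topspace (top_of_set D)) \<and> continuous_map (top_of_set D) Z f \<and> f ` K \<subseteq> U} |K U. compactin (top_of_set D) K \<and> openin Z U}"
      unfolding compact_open_def topology_generated_by_topspace .
  qed
qed

section \<open>Continuous quotients and the compensated path\<close>

text \<open>The quotient lies between 0 and \<open>v a / c\<close>, so at a zero of \<open>v\<close>
  it tends to 0, which is also its value there since \<open>x / 0 = 0\<close>.\<close>

lemma continuous_on_divide_dominated: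
  fixes u v :: "'a::topological_space \<Rightarrow> real"
  assumes u: "continuous_on A u" and v: "continuous_on A v" and c: "0 < c"
    and u0: "\<And>a. a \<in> A \<Longrightarrow> 0 \<le> u a" and v0: "\<And>a. a \<in> A \<Longrightarrow> 0 \<le> v a"
    and dom: "\<And>a. a \<in> A \<Longrightarrow> c * u a \<le> (v a)\<^sup>2"
  shows "continuous_on A (\<lambda>a. u a / v a)"
proof -
  have bnd: "0 \<le> u a / v a \<and> u a / v a \<le> v a / c" if "a \<in> A" for a
  proof (cases "v a = 0")
    case False
    then have "0 < v a" using v0[OF that] by simp
    then show ?thesis using u0[OF that] dom[OF that] c by (simp add: field_simps power2_eq_square)
  qed simp
  have "((\<lambda>a. u a / v a) \<longlongrightarrow> u a0 / v a0) (at a0 within A)" if a0: "a0 \<in> A" for a0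
  proof (cases "v a0 = 0")
    case True
    have "((\<lambda>a. v a / c) \<longlongrightarrow> v a0 / c) (at a0 within A)"
      using v a0 c unfolding continuous_on_def by (intro tendsto_intros) auto
    then have l: "((\<lambda>a. v a / c) \<longlongrightarrow> 0) (at a0 within A)" using True by simp
    have e: "\<forall>\<^sub>F a in at a0 within A. 0 \<le> u a / v a" "\<forall>\<^sub>F a in at a0 within A. u a / v a \<le> v a / c"
      using bnd by (auto simp: eventually_at_filter)
    show ?thesis using tendsto_sandwich[OF e tendsto_const l] True by simp
  next
    case False
    then show ?thesis using u v a0 unfolding continuous_on_def by (intro tendsto_divide) auto
  qed
  then show ?thesis unfolding continuous_on_def by blast
qed

text \<open>The two factors have product \<open>t\<close> and difference \<open>d\<close>: moving \<open>d\<close> along a segment gives a path on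
  the hyperbola \<open>\<phi> \<psi> = t\<close> that degenerates continuously to the coordinate axes as \<open>t\<close> tends to \<open>0\<close>.\<close>

lemma hyperbola_factors:
  fixes d t :: real
  assumes "0 \<le> t"
  defines "r \<equiv> sqrt (d\<^sup>2 + 4 * t)"
  shows "0 \<le> (r + d) / 2" "0 \<le> (r - d) / 2" "(r + d) / 2 * ((r - d) / 2) = t"
    "0 < t \<Longrightarrow> 0 < (r + d) / 2" "0 < t \<Longrightarrow> 0 < (r - d) / 2"
proof -
  have r2: "r\<^sup>2 = d\<^sup>2 + 4 * t" unfolding r_def using assms by simp
  have "\<bar>d\<bar> \<le> r" unfolding r_def using assms by (intro real_le_rsqrt) simp
  then show "0 \<le> (r + d) / 2" "0 \<le> (r - d) / 2" by auto
  show p: "(r + d) / 2 * ((r - d) / 2) = t" using r2 by (simp add: algebra_simps power2_eq_square)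
  show "0 < (r + d) / 2" if "0 < t"
  proof (rule ccontr)
    assume "\<not> ?thesis"
    then have "(r + d) / 2 = 0" using \<open>0 \<le> (r + d) / 2\<close> by linarith
    then show False using p that by simp
  qed
  show "0 < (r - d) / 2" if "0 < t"
  proof (rule ccontr)
    assume "\<not> ?thesis"
    then have "(r - d) / 2 = 0" using \<open>0 \<le> (r - d) / 2\<close> by linarith
    then show False using p that by simp
  qed
qed

text \<open>The discriminant is the square of \<open>a + b\<close>, so nonnegative factors are
  recovered from their product and difference. This evaluates the path at its two ends.\<close>

lemma hyperbola_factors_of:
  fixes a b :: real
  assumes "0 \<le> a" "0 \<le> b"
  shows "(sqrt ((a - b)\<^sup>2 + 4 * (a * b)) + (a - b)) / 2 = a" "(sqrt ((a - b)\<^sup>2 + 4 * (a * b)) - (a - b)) / 2 = b"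
proof -
  have "(a - b)\<^sup>2 + 4 * (a * b) = (a + b)\<^sup>2" by (simp add: power2_eq_square algebra_simps)
  then have "sqrt ((a - b)\<^sup>2 + 4 * (a * b)) = a + b" using assms by simp
  then show "(sqrt ((a - b)\<^sup>2 + 4 * (a * b)) + (a - b)) / 2 = a" "(sqrt ((a - b)\<^sup>2 + 4 * (a * b)) - (a - b)) / 2 = b" by auto
qed

text \<open>For a family over |N(P)| the weights at the moved point \<open>\<mu> s t\<close> are its
  coordinates. Multiplied by \<open>\<phi> i s t\<close> they become proportional to
  \<open>t\<close>, so the motion towards \<open>\<kappa>\<close> is undone label by label. Before
  normalisation \<open>\<mu>\<close> is the second factor \<open>\<psi>\<close> of
  \<open>t i\<close>, and the normalisation only changes the constant of proportionality.\<close>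

lemma compensated_path:
  fixes \<kappa> :: "(nat \<Rightarrow> real) \<Rightarrow> nat \<Rightarrow> real"
  assumes c\<kappa>: "continuous_on (std_simplex n) \<kappa>" and c: "0 < c"
    and \<kappa>: "\<And>t. t \<in> std_simplex n \<Longrightarrow> \<kappa> t \<in> std_simplex n"
    and \<kappa>0: "\<And>t i. t \<in> std_simplex n \<Longrightarrow> (\<And>j. i \<le> j \<Longrightarrow> t j = 0) \<Longrightarrow> \<kappa> t i = 0"
    and dom: "\<And>t i. t \<in> std_simplex n \<Longrightarrow> i \<le> n \<Longrightarrow> c * t i \<le> (\<kappa> t i)\<^sup>2"
  obtains \<mu> :: "real \<Rightarrow> (nat \<Rightarrow> real) \<Rightarrow> nat \<Rightarrow> real" and \<phi> :: "nat \<Rightarrow> real \<Rightarrow> (nat \<Rightarrow> real) \<Rightarrow> real"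
  where "continuous_on ({0..1} \<times> std_simplex n) (\<lambda>z. \<mu> (fst z) (snd z))"
    "\<And>i. i \<le> n \<Longrightarrow> continuous_on ({0..1} \<times> std_simplex n) (\<lambda>z. \<phi> i (fst z) (snd z))"
    "\<And>s t. s \<in> {0..1} \<Longrightarrow> t \<in> std_simplex n \<Longrightarrow> \<mu> s t \<in> std_simplex n"
    "\<And>i s t. i \<le> n \<Longrightarrow> s \<in> {0..1} \<Longrightarrow> t \<in> std_simplex n \<Longrightarrow> 0 \<le> \<phi> i s t"
    "\<And>i s t. i \<le> n \<Longrightarrow> s \<in> {0..1} \<Longrightarrow> t \<in> std_simplex n \<Longrightarrow> 0 < t i \<Longrightarrow> 0 < \<phi> i s t \<and> 0 < \<mu> s t i"
    "\<And>i s t. s \<in> {0..1} \<Longrightarrow> t \<in> std_simplex n \<Longrightarrow> (\<And>j. i \<le> j \<Longrightarrow> t j = 0) \<Longrightarrow> \<mu> s t i = 0"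
    "\<And>t. t \<in> std_simplex n \<Longrightarrow> \<mu> 0 t = t" "\<And>i t. i \<le> n \<Longrightarrow> t \<in> std_simplex n \<Longrightarrow> \<phi> i 0 t = 1"
    "\<And>t. t \<in> std_simplex n \<Longrightarrow> \<mu> 1 t = \<kappa> t" "\<And>i t. i \<le> n \<Longrightarrow> t \<in> std_simplex n \<Longrightarrow> \<phi> i 1 t = t i / \<kappa> t i"
    "\<And>s t. s \<in> {0..1} \<Longrightarrow> t \<in> std_simplex n \<Longrightarrow> \<exists>C>0. \<forall>i\<le>n. \<phi> i s t * \<mu> s t i = C * t i"
proof -
  let ?D = "std_simplex n" and ?M = "{0..1} \<times> std_simplex n"
  \<comment> \<open>The pair of factors is \<open>(1, t i)\<close> at the start and
    \<open>(t i / \<kappa> t i, \<kappa> t i)\<close> at the end; \<open>d\<close> interpolates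
    linearly between the two differences.\<close>
  define d where "d i s t = (1 - s) * (1 - t i) + s * (t i / \<kappa> t i - \<kappa> t i)" for i s and t :: "nat \<Rightarrow> real"
  define r where "r i s t = sqrt ((d i s t)\<^sup>2 + 4 * t i)" for i s and t :: "nat \<Rightarrow> real"
  define \<phi> where "\<phi> i s t = (r i s t + d i s t) / 2" for i s and t :: "nat \<Rightarrow> real"
  define \<psi> where "\<psi> i s t = (r i s t - d i s t) / 2" for i s and t :: "nat \<Rightarrow> real"
  define \<Sigma> where "\<Sigma> s t = (\<Sum>j\<le>n. \<psi> j s t)" for s and t :: "nat \<Rightarrow> real"
  define \<mu> where "\<mu> s t = (\<lambda>i. if i \<le> n then \<psi> i s t / \<Sigma> s t else 0)" for s and t :: "nat \<Rightarrow> real"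
  have t0: "0 \<le> t i" if "t \<in> ?D" for t i using std_simplex_nonneg[OF that] .
  have \<kappa>n: "0 \<le> \<kappa> t i" if "t \<in> ?D" for t i using t0[OF \<kappa>[OF that]] .
  have \<phi>0: "0 \<le> \<phi> i s t" and \<psi>0: "0 \<le> \<psi> i s t" and \<phi>\<psi>: "\<phi> i s t * \<psi> i s t = t i" if "t \<in> ?D" for i s t
    unfolding \<phi>_def \<psi>_def r_def by (rule hyperbola_factors[OF t0[OF that]])+
  have \<phi>p: "0 < \<phi> i s t" and \<psi>p: "0 < \<psi> i s t" if "t \<in> ?D" "0 < t i" for i s t
    unfolding \<phi>_def \<psi>_def r_def by (rule hyperbola_factors(4,5)[OF t0[OF that(1)] that(2)])+
  have \<Sigma>p: "0 < \<Sigma> s t" if t: "t \<in> ?D" for s t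
  proof -
    obtain k where "k \<le> n" "0 < t k" using std_simplex_top[OF t] by metis
    then show ?thesis unfolding \<Sigma>_def using \<psi>0[OF t] \<psi>p[OF t] by (intro sum_pos2[of _ k]) auto
  qed
  have at0: "\<phi> i 0 t = 1" "\<psi> i 0 t = t i" if "t \<in> ?D" for i t
    using hyperbola_factors_of[of 1 "t i"] t0[OF that] unfolding \<phi>_def \<psi>_def r_def d_def by auto
  have at1: "\<phi> i 1 t = t i / \<kappa> t i" "\<psi> i 1 t = \<kappa> t i" if t: "t \<in> ?D" and i: "i \<le> n" for i t
  proof -
    \<comment> \<open>Where \<open>\<kappa> t i\<close> vanishes so does \<open>t i\<close>, so
      division by 0 yields the intended pair of zeros.\<close>
    have "\<kappa> t i = 0 \<Longrightarrow> t i = 0" using dom[OF that] t0[OF t, of i] c by (simp add: mult_le_0_iff)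
    then have "t i / \<kappa> t i * \<kappa> t i = t i" by auto
    then show "\<phi> i 1 t = t i / \<kappa> t i" "\<psi> i 1 t = \<kappa> t i"
      using hyperbola_factors_of[of "t i / \<kappa> t i" "\<kappa> t i"] t0[OF t, of i] \<kappa>n[OF t, of i]
      unfolding \<phi>_def \<psi>_def r_def d_def by auto
  qed
  have cf: "continuous_on ?M (\<lambda>z. fst z)" by (intro continuous_intros)
  have cs: "continuous_on ?M (\<lambda>z. g (snd z))" if "continuous_on ?D g" for g :: "_ \<Rightarrow> real"
    by (rule continuous_on_compose2[OF that continuous_on_snd[OF continuous_on_id]]) auto
  have ck: "continuous_on ?D (\<lambda>t. \<kappa> t i)" for i
    using c\<kappa> by (rule continuous_on_product_then_coordinatewise)
  have cd: "continuous_on ?M (\<lambda>z. d i (fst z) (snd z))" if i: "i \<le> n" for i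
  proof -
    have q: "continuous_on ?D (\<lambda>t. t i / \<kappa> t i)"
      by (rule continuous_on_divide_dominated[OF continuous_on_eval ck c]) (use t0 \<kappa>n dom i in auto)
    show ?thesis unfolding d_def by (intro continuous_on_add continuous_on_mult continuous_on_diff continuous_on_const cf cs q ck continuous_on_eval)
  qed
  have cr: "continuous_on ?M (\<lambda>z. r i (fst z) (snd z))" if i: "i \<le> n" for i
    unfolding r_def by (intro continuous_intros cd[OF i] cs continuous_on_eval)
  have c\<phi>: "continuous_on ?M (\<lambda>z. \<phi> i (fst z) (snd z))" if i: "i \<le> n" for i
    unfolding \<phi>_def by (intro continuous_intros cd[OF i] cr[OF i]) auto
  have c\<psi>: "continuous_on ?M (\<lambda>z. \<psi> i (fst z) (snd z))" if i: "i \<le> n" for i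
    unfolding \<psi>_def by (intro continuous_intros cd[OF i] cr[OF i]) auto
  have c\<mu>: "continuous_on ?M (\<lambda>z. \<mu> (fst z) (snd z))"
  proof (rule continuous_on_coordinatewise_then_product)
    fix i
    have "continuous_on ?M (\<lambda>z. \<Sigma> (fst z) (snd z))"
      unfolding \<Sigma>_def by (intro continuous_intros c\<psi>) auto
    then have "continuous_on ?M (\<lambda>z. \<psi> i (fst z) (snd z) / \<Sigma> (fst z) (snd z))" if "i \<le> n"
      using \<Sigma>p that by (intro continuous_on_divide c\<psi>) (auto simp: less_imp_neq[symmetric])
    then show "continuous_on ?M (\<lambda>z. \<mu> (fst z) (snd z) i)"
      unfolding \<mu>_def by (cases "i \<le> n") simp_all
  qed
  show ?thesis
  proof (rule that[of \<mu> \<phi>, OF c\<mu> c\<phi>])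
    fix s :: real and t assume t: "t \<in> ?D"
    have "(\<Sum>i\<le>n. \<mu> s t i) = (\<Sum>i\<le>n. \<psi> i s t / \<Sigma> s t)" by (rule sum.cong) (auto simp: \<mu>_def)
    also have "\<dots> = 1" using \<Sigma>p[OF t, of s] by (simp flip: sum_divide_distrib \<Sigma>_def)
    finally show "\<mu> s t \<in> std_simplex n"
      using \<psi>0[OF t, of _ s] \<Sigma>p[OF t, of s] by (auto simp: std_simplex_def atMost_atLeast0 \<mu>_def intro: divide_nonneg_pos)
    show "\<exists>C>0. \<forall>i\<le>n. \<phi> i s t * \<mu> s t i = C * t i"
      using \<phi>\<psi>[OF t, of _ s] \<Sigma>p[OF t, of s] by (intro exI[of _ "1 / \<Sigma> s t"]) (simp add: \<mu>_def)
    show "0 < \<phi> i s t \<and> 0 < \<mu> s t i" if "i \<le> n" "0 < t i" for i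
      using \<phi>p[OF t that(2), of s] \<psi>p[OF t that(2), of s] \<Sigma>p[OF t, of s] that by (simp add: \<mu>_def)
  next
    fix i and s :: real and t assume s: "s \<in> {0..1}" and t: "t \<in> ?D" and z: "\<And>j. i \<le> j \<Longrightarrow> t j = 0"
    \<comment> \<open>For \<open>t i = 0\<close> the hyperbola degenerates to the axes. Since
      \<open>\<kappa> t i = 0\<close> as well, \<open>d = 1 - s\<close> is nonnegative, which
      selects the axis \<open>\<psi> = 0\<close>.\<close>
    have "\<kappa> t i = 0" using \<kappa>0[OF t] z by blast
    then have "d i s t = 1 - s" using z by (simp add: d_def)
    then have "\<psi> i s t = 0" using z s by (simp add: \<psi>_def r_def)
    then show "\<mu> s t i = 0" by (simp add: \<mu>_def)
  next
    fix t assume t: "t \<in> ?D"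
    have "\<Sigma> 0 t = 1" using std_simplex_sum[OF t] at0[OF t] by (simp add: \<Sigma>_def)
    then show "\<mu> 0 t = t" using at0[OF t] std_simplex_zero[OF t] by (auto simp: \<mu>_def)
    have "\<Sigma> 1 t = 1" using std_simplex_sum[OF \<kappa>[OF t]] at1[OF t] by (simp add: \<Sigma>_def)
    then show "\<mu> 1 t = \<kappa> t" using at1[OF t] std_simplex_zero[OF \<kappa>[OF t]] by (auto simp: \<mu>_def)
  qed (use \<phi>0 at0 at1 in auto)
qed

section \<open>Straightening families of stratum preserving maps\<close>

context sset
begin

text \<open>Since the \<open>t i\<close> sum to 1, the weighted products sum to \<open>C\<close>;
  normalising divides by exactly this constant and leaves the weights \<open>t\<close>.\<close>

lemma reweight_eq_flag_map:
  assumes J: "flag J" and t: "t \<in> std_simplex (flag_dim J)" and c: "c \<in> pts" and nn: "\<And>p. 0 \<le> \<phi> p"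
    and C: "0 < C" "\<And>i. i \<le> flag_dim J \<Longrightarrow> \<phi> (J ! i) * weight c (J ! i) = C * t i"
    and z: "\<And>p. p \<notin> set J \<Longrightarrow> \<phi> p * weight c p = 0"
  shows "real_map dm lab (reweight \<phi> c) = flag_map J t"
proof -
  have set_J: "set J = (\<lambda>i. J ! i) ` {..flag_dim J}"
    using flag_length[OF J] by (auto simp: set_conv_nth)
  have inj: "inj_on (\<lambda>i. J ! i) {..flag_dim J}"
    using flag_nth_eq[OF J] by (auto simp: inj_on_def)
  have "mass \<phi> c = (\<Sum>p\<in>set J. \<phi> p * weight c p)"
    by (rule mass_finite_support[OF c finite_set z])
  also have "\<dots> = (\<Sum>i\<le>flag_dim J. \<phi> (J ! i) * weight c (J ! i))"
    unfolding set_J by (simp add: sum.reindex[OF inj])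
  also have "\<dots> = (\<Sum>i\<le>flag_dim J. C * t i)" using C(2) by (intro sum.cong) auto
  also have "\<dots> = C" using std_simplex_sum[OF t] by (simp flip: sum_distrib_left)
  finally have m: "mass \<phi> c = C" .
  have w: "weight (reweight \<phi> c) p = \<phi> p * weight c p / C" for p
    using weight_reweight[of \<phi>, OF nn c] m C(1) by simp
  have "weight (reweight \<phi> c) (J ! i) = t i" if "i \<le> flag_dim J" for i
    using w[of "J ! i"] C(2)[OF that] C(1) by simp
  moreover have "weight (reweight \<phi> c) p = 0" if "p \<notin> set J" for p
    using w[of p] z[OF that] by simp
  ultimately show ?thesis
    by (intro iffD2[OF real_map_eq_flag_map_iff[OF reweight_in_pts[OF nn c] J t]] conjI allI impI)
qed

text \<open>Multiplication creates no new labels, and a positive multiplier at the top label keeps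
  it in the support.\<close>

lemma reweight_stratum:
  assumes c: "c \<in> pts" and nn: "\<And>p. 0 \<le> \<phi> p" and p: "nerve_to_P (real_map dm lab c) = p" "0 < \<phi> p"
  shows "0 < mass \<phi> c" "nerve_to_P (real_map dm lab (reweight \<phi> c)) = p"
proof -
  have w: "0 < weight c p" "\<And>q. 0 < weight c q \<Longrightarrow> q \<le> p" using p(1) nerve_to_P_real_map[OF c] by auto
  show m: "0 < mass \<phi> c" by (rule mass_pos[where \<phi> = \<phi> and p = p, OF c nn w(1) p(2)])
  have "q \<le> p" if "0 < weight (reweight \<phi> c) q" for q
  proof -
    have "0 < \<phi> q * weight c q"
      using that m zero_less_divide_iff[of "\<phi> q * weight c q" "mass \<phi> c"] unfolding weight_reweight[OF nn c m] by linarith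
    then have "0 < weight c q" using nn[of q] zero_less_mult_pos by fastforce
    then show ?thesis by (rule w(2))
  qed
  moreover have "0 < weight (reweight \<phi> c) p"
    unfolding weight_reweight[OF nn c m] using m w(1) p(2) by simp
  ultimately show "nerve_to_P (real_map dm lab (reweight \<phi> c)) = p"
    by (intro iffD2[OF nerve_to_P_real_map[OF reweight_in_pts[OF nn c]]] conjI allI impI)
qed

text \<open>The homotopy has two stages. During the first, the point of the simplex moves to
  \<open>\<kappa> t\<close> under compensating multipliers. During the second it stays at
  \<open>\<kappa> t\<close> while the multipliers change linearly to \<open>t i / f i\<close>, and
  to 0 outside the flag. The last claim, for a parameter whose map already lies over |N(P)|, holds
  because the first stage is compensated and the second one is then constant.\<close>

lemma straightening:
  fixes K :: "'k::metric_space set" and F :: "'k \<times> (nat \<Rightarrow> real) \<Rightarrow> _"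
  assumes J: "flag J" and K: "compact K"
    and F: "continuous_map (top_of_set (K \<times> std_simplex (flag_dim J))) RX F"
    and strat: "\<And>k t. k \<in> K \<Longrightarrow> t \<in> std_simplex (flag_dim J) \<Longrightarrow>
       nerve_to_P (real_map dm lab (F (k, t))) = nerve_to_P (flag_map J t)"
  obtains H :: "real \<times> 'k \<times> (nat \<Rightarrow> real) \<Rightarrow> ('x \<times> (nat \<Rightarrow> real)) set"
  where "continuous_map (top_of_set ({0..1} \<times> K \<times> std_simplex (flag_dim J))) RX H"
    "\<And>k t. k \<in> K \<Longrightarrow> t \<in> std_simplex (flag_dim J) \<Longrightarrow> H (0, k, t) = F (k, t)"
    "\<And>s k t. s \<in> {0..1} \<Longrightarrow> k \<in> K \<Longrightarrow> t \<in> std_simplex (flag_dim J) \<Longrightarrow>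
       nerve_to_P (real_map dm lab (H (s, k, t))) = nerve_to_P (flag_map J t)"
    "\<And>k t. k \<in> K \<Longrightarrow> t \<in> std_simplex (flag_dim J) \<Longrightarrow> real_map dm lab (H (1, k, t)) = flag_map J t"
    "\<And>s k t. s \<in> {0..1} \<Longrightarrow> k \<in> K \<Longrightarrow> t \<in> std_simplex (flag_dim J) \<Longrightarrow>
       (\<And>u. u \<in> std_simplex (flag_dim J) \<Longrightarrow> real_map dm lab (F (k, u)) = flag_map J u) \<Longrightarrow>
       real_map dm lab (H (s, k, t)) = flag_map J t"
proof -
  let ?n = "flag_dim J"
  let ?D = "std_simplex ?n"
  have Fp: "F (k, t) \<in> pts" if "k \<in> K" "t \<in> ?D" for k t
    using continuous_map_image_subset_topspace[OF F] that by auto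
  have cKD: "compact (K \<times> ?D)" using K compact_std_simplex by (rule compact_Times)
  define f where "f i m = weight (F m) (J ! i)" for i m
  have cf: "continuous_on (K \<times> ?D) (f i)" for i
    using continuous_map_compose[OF F continuous_mass] unfolding f_def by (simp add: o_def)
  have f0: "0 \<le> f i m" if "m \<in> K \<times> ?D" for i m
    unfolding f_def using Fp that by (cases m) (auto intro!: mass_nonneg)
  have ftop: "0 < f i (k, x)" if "i \<le> ?n" "k \<in> K" "x \<in> ?D" "0 < x i" "\<And>j. i < j \<Longrightarrow> x j = 0" for i k x
    using strat[OF that(2,3)] stratum_eq_flag_iff[OF Fp[OF that(2,3)] J that(3,1,4,5)] unfolding f_def by blast
  obtain \<kappa> c where c\<kappa>: "continuous_on ?D \<kappa>" and c: "(0::real) < c"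
    and \<kappa>: "\<And>t. t \<in> ?D \<Longrightarrow> \<kappa> t \<in> ?D"
    and \<kappa>0: "\<And>t i. t \<in> ?D \<Longrightarrow> (\<And>j. i \<le> j \<Longrightarrow> t j = 0) \<Longrightarrow> \<kappa> t i = 0"
    and dom: "\<And>t i. t \<in> ?D \<Longrightarrow> i \<le> ?n \<Longrightarrow> c * t i \<le> (\<kappa> t i)\<^sup>2"
    and domf: "\<And>t i k. t \<in> ?D \<Longrightarrow> i \<le> ?n \<Longrightarrow> k \<in> K \<Longrightarrow> c * t i \<le> (f i (k, \<kappa> t))\<^sup>2"
  proof -
    show thesis by (rule shrinking_map[of K ?n f]) (fact cKD ftop that | rule cf f0, assumption?)+
  qed
  obtain \<mu> :: "real \<Rightarrow> (nat \<Rightarrow> real) \<Rightarrow> nat \<Rightarrow> real" and \<phi> :: "nat \<Rightarrow> real \<Rightarrow> (nat \<Rightarrow> real) \<Rightarrow> real"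
    where c\<mu>: "continuous_on ({0..1} \<times> ?D) (\<lambda>z. \<mu> (fst z) (snd z))"
    and c\<phi>: "\<And>i. i \<le> ?n \<Longrightarrow> continuous_on ({0..1} \<times> ?D) (\<lambda>z. \<phi> i (fst z) (snd z))"
    and \<mu>: "\<And>s t. s \<in> {0..1} \<Longrightarrow> t \<in> ?D \<Longrightarrow> \<mu> s t \<in> ?D"
    and \<phi>0: "\<And>i s t. i \<le> ?n \<Longrightarrow> s \<in> {0..1} \<Longrightarrow> t \<in> ?D \<Longrightarrow> 0 \<le> \<phi> i s t"
    and pos: "\<And>i s t. i \<le> ?n \<Longrightarrow> s \<in> {0..1} \<Longrightarrow> t \<in> ?D \<Longrightarrow> 0 < t i \<Longrightarrow> 0 < \<phi> i s t \<and> 0 < \<mu> s t i"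
    and \<mu>z: "\<And>i s t. s \<in> {0..1} \<Longrightarrow> t \<in> ?D \<Longrightarrow> (\<And>j. i \<le> j \<Longrightarrow> t j = 0) \<Longrightarrow> \<mu> s t i = 0"
    and at0: "\<And>t. t \<in> ?D \<Longrightarrow> \<mu> 0 t = t" "\<And>i t. i \<le> ?n \<Longrightarrow> t \<in> ?D \<Longrightarrow> \<phi> i 0 t = 1"
    and at1: "\<And>t. t \<in> ?D \<Longrightarrow> \<mu> 1 t = \<kappa> t" "\<And>i t. i \<le> ?n \<Longrightarrow> t \<in> ?D \<Longrightarrow> \<phi> i 1 t = t i / \<kappa> t i"
    and prp: "\<And>s t. s \<in> {0..1} \<Longrightarrow> t \<in> ?D \<Longrightarrow> \<exists>C>0. \<forall>i\<le>?n. \<phi> i s t * \<mu> s t i = C * t i"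
  proof -
    show thesis by (rule compensated_path[OF c\<kappa> c]) (fact \<kappa> \<kappa>0 dom that)+
  qed
  define e where "e i k t = t i / f i (k, \<kappa> t)" for i k t
  \<comment> \<open>Clocks of the two stages: \<open>\<alpha>\<close> runs in the first half of the
    time interval, while \<open>\<beta>\<close> is 0, and \<open>\<beta>\<close> runs in the second
    half, while \<open>\<alpha>\<close> is 1.\<close>
  define \<alpha> where "\<alpha> s = min 1 (2 * s)" for s :: real
  define \<beta> where "\<beta> s = max 0 (2 * s - 1)" for s :: real
  define idx where "idx p = (SOME i. i \<le> ?n \<and> J ! i = p)" for p
  have idx: "idx p \<le> ?n" "J ! idx p = p" if "p \<in> set J" for p
    using someI_ex[of "\<lambda>i. i \<le> ?n \<and> J ! i = p"] that flag_length[OF J] unfolding idx_def by (auto simp: in_set_conv_nth)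
  have idx_nth: "idx (J ! i) = i" "J ! i \<in> set J" if "i \<le> ?n" for i
    using idx[of "J ! i"] flag_nth_eq[OF J] that flag_length[OF J] by auto
  define \<Phi> where "\<Phi> m p = (case m of (s, k, t) \<Rightarrow> if p \<in> set J
      then (1 - \<beta> s) * \<phi> (idx p) (\<alpha> s) t + \<beta> s * e (idx p) k t else 1 - \<beta> s)"
    for m :: "real \<times> 'k \<times> (nat \<Rightarrow> real)" and p
  define G where "G m = (case m of (s, k, t) \<Rightarrow> F (k, \<mu> (\<alpha> s) t))" for m :: "real \<times> 'k \<times> (nat \<Rightarrow> real)"
  define H where "H m = reweight (\<Phi> m) (G m)" for m
  have \<alpha>: "\<alpha> s \<in> {0..1}" and \<beta>: "\<beta> s \<in> {0..1}" if "s \<in> {0..1}" for s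
    using that by (auto simp: \<alpha>_def \<beta>_def)
  have stage: "\<beta> s = 0 \<or> \<alpha> s = 1" for s by (auto simp: \<alpha>_def \<beta>_def max_def min_def)
  have t0: "0 \<le> t i" if "t \<in> ?D" for t i using std_simplex_nonneg[OF that] .
  have f\<kappa>: "0 \<le> f i (k, \<kappa> t)" if "k \<in> K" "t \<in> ?D" for i k t using f0 \<kappa> that by simp
  have e0: "0 \<le> e i k t" if "k \<in> K" "t \<in> ?D" for i k t unfolding e_def using f\<kappa>[OF that] t0[OF that(2)] by simp
  have \<Phi>0: "0 \<le> \<Phi> m p" if "m \<in> {0..1} \<times> K \<times> ?D" for m p
    using that \<phi>0[OF idx(1)[of p] \<alpha>] \<beta> e0 by (auto simp: \<Phi>_def intro!: add_nonneg_nonneg mult_nonneg_nonneg)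
  have \<Phi>nth: "\<Phi> (s, k, t) (J ! i) = (1 - \<beta> s) * \<phi> i (\<alpha> s) t + \<beta> s * e i k t" if "i \<le> ?n" for s k t i
    using idx_nth[OF that] by (simp add: \<Phi>_def)
  have \<Phi>out: "\<Phi> (s, k, t) p = 1 - \<beta> s" if "p \<notin> set J" for s k t p using that by (simp add: \<Phi>_def)
  have Gp: "G m \<in> pts" if "m \<in> {0..1} \<times> K \<times> ?D" for m using that Fp \<mu> \<alpha> by (auto simp: G_def)
  \<comment> \<open>The moved point has the same last nonzero index as \<open>t\<close>, hence the
    same stratum. At this index \<open>\<phi>\<close> and \<open>e\<close> are both positive, the
    latter by the quadratic bound, and so is their convex combination.\<close>
  have top: "nerve_to_P (real_map dm lab (G (s, k, t))) = nerve_to_P (flag_map J t)"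
    "0 < \<Phi> (s, k, t) (nerve_to_P (flag_map J t))"
    if s: "s \<in> {0..1}" and k: "k \<in> K" and t: "t \<in> ?D" for s k t
  proof -
    obtain i where i: "i \<le> ?n" "0 < t i" "\<And>j. i < j \<Longrightarrow> t j = 0" using std_simplex_top[OF t] by metis
    let ?u = "\<mu> (\<alpha> s) t"
    have u: "?u \<in> ?D" "0 < ?u i" using \<mu>[OF \<alpha>[OF s] t] pos[OF i(1) \<alpha>[OF s] t i(2)] by auto
    have uz: "?u j = 0" if "i < j" for j
      by (rule \<mu>z[OF \<alpha>[OF s] t]) (use i(3) that in auto)
    have "nerve_to_P (real_map dm lab (F (k, ?u))) = J ! i"
      using strat[OF k u(1)] stratum_eq_flag_iff[OF Fp[OF k u(1)] J u(1) i(1) u(2) uz]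
      by (intro iffD2[OF nerve_to_P_real_map[OF Fp[OF k u(1)]]]) simp
    moreover have ti: "nerve_to_P (flag_map J t) = J ! i"
    proof -
      have "nerve_to_P (real_map dm lab (F (k, t))) = J ! i"
        using strat[OF k t] stratum_eq_flag_iff[OF Fp[OF k t] J t i]
        by (intro iffD2[OF nerve_to_P_real_map[OF Fp[OF k t]]]) simp
      then show ?thesis using strat[OF k t] by simp
    qed
    ultimately show "nerve_to_P (real_map dm lab (G (s, k, t))) = nerve_to_P (flag_map J t)" by (simp add: G_def)
    have "f i (k, \<kappa> t) \<noteq> 0" using domf[OF t i(1) k] c i(2) by (auto simp: mult_le_0_iff)
    then have "0 < e i k t" using i(2) f\<kappa>[OF k t, of i] by (simp add: e_def)
    then show "0 < \<Phi> (s, k, t) (nerve_to_P (flag_map J t))"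
      using pos[OF i(1) \<alpha>[OF s] t i(2)] \<beta>[OF s] unfolding ti \<Phi>nth[OF i(1)]
      by (cases "\<beta> s = 0") (auto intro!: add_nonneg_pos)
  qed
  let ?M = "{0..1::real} \<times> K \<times> ?D"
  have M: "compact ?M" using K compact_std_simplex by (intro compact_Times compact_Icc)
  have c\<alpha>: "continuous_on ?M (\<lambda>m. \<alpha> (fst m))" unfolding \<alpha>_def by (intro continuous_on_min continuous_on_mult continuous_on_const continuous_on_fst continuous_on_id)
  have c\<beta>: "continuous_on ?M (\<lambda>m. \<beta> (fst m))" unfolding \<beta>_def by (intro continuous_on_max continuous_on_diff continuous_on_mult continuous_on_const continuous_on_fst continuous_on_id)
  have ct: "continuous_on ?M (\<lambda>m. snd (snd m))" by (intro continuous_on_snd continuous_on_id)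
  have c\<alpha>t: "continuous_on ?M (\<lambda>m. (\<alpha> (fst m), snd (snd m)))" by (intro continuous_on_Pair c\<alpha> ct)
  have im: "(\<lambda>m. (\<alpha> (fst m), snd (snd m))) ` ?M \<subseteq> {0..1} \<times> ?D"
  proof (rule image_subsetI)
    fix m assume "m \<in> ?M"
    then have "fst m \<in> {0..1}" "snd (snd m) \<in> ?D" by (simp_all add: mem_Times_iff)
    then show "(\<alpha> (fst m), snd (snd m)) \<in> {0..1} \<times> ?D" by (intro SigmaI \<alpha>)
  qed
  have cG: "continuous_map (top_of_set ?M) RX G"
  proof -
    have "continuous_on ?M (\<lambda>m. \<mu> (\<alpha> (fst m)) (snd (snd m)))"
      using continuous_on_compose2[OF c\<mu> c\<alpha>t im] unfolding fst_conv snd_conv .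
    then have "continuous_on ?M (\<lambda>m. (fst (snd m), \<mu> (\<alpha> (fst m)) (snd (snd m))))"
      by (intro continuous_on_Pair continuous_on_fst continuous_on_snd continuous_on_id)
    then have "continuous_map (top_of_set ?M) (top_of_set (K \<times> ?D)) (\<lambda>m. (fst (snd m), \<mu> (\<alpha> (fst m)) (snd (snd m))))"
      unfolding continuous_map_subtopology_eu
    proof (rule conjI[OF _ funcsetI])
      fix m assume "m \<in> ?M"
      then have "fst m \<in> {0..1}" "snd (snd m) \<in> ?D" "fst (snd m) \<in> K" by (simp_all add: mem_Times_iff)
      then show "(fst (snd m), \<mu> (\<alpha> (fst m)) (snd (snd m))) \<in> K \<times> ?D" by (intro SigmaI \<mu> \<alpha>)
    qed
    moreover have "G = F \<circ> (\<lambda>m. (fst (snd m), \<mu> (\<alpha> (fst m)) (snd (snd m))))"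
      by (rule ext) (simp add: G_def case_prod_beta)
    ultimately show ?thesis using F by (simp only: continuous_map_compose)
  qed
  have ce: "continuous_on ?M (\<lambda>m. e i (fst (snd m)) (snd (snd m)))" if i: "i \<le> ?n" for i
    unfolding e_def
  proof (rule continuous_on_divide_dominated[OF _ _ c])
    show "continuous_on ?M (\<lambda>m. snd (snd m) i)"
      by (rule continuous_on_compose2[OF continuous_on_eval ct subset_UNIV])
    have "continuous_on ?M (\<lambda>m. \<kappa> (snd (snd m)))"
      by (rule continuous_on_compose2[OF c\<kappa> ct]) (simp add: image_subset_iff)
    then have "continuous_on ?M (\<lambda>m. (fst (snd m), \<kappa> (snd (snd m))))"
      by (intro continuous_on_Pair continuous_on_fst continuous_on_snd continuous_on_id)
    then show "continuous_on ?M (\<lambda>m. f i (fst (snd m), \<kappa> (snd (snd m))))"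
      by (rule continuous_on_compose2[OF cf]) (simp add: image_subset_iff \<kappa>)
  qed (simp_all add: mem_Times_iff t0 f\<kappa> domf[OF _ i])
  have c\<Phi>: "continuous_on ?M (\<lambda>m. \<Phi> m p)" for p
  proof (cases "p \<in> set J")
    case True
    have "continuous_on ?M (\<lambda>m. \<phi> (idx p) (\<alpha> (fst m)) (snd (snd m)))"
      using continuous_on_compose2[OF c\<phi>[OF idx(1)[OF True]] c\<alpha>t im] unfolding fst_conv snd_conv .
    then have "continuous_on ?M (\<lambda>m. (1 - \<beta> (fst m)) * \<phi> (idx p) (\<alpha> (fst m)) (snd (snd m)) + \<beta> (fst m) * e (idx p) (fst (snd m)) (snd (snd m)))"
      by (intro continuous_on_add continuous_on_mult continuous_on_diff continuous_on_const c\<beta> ce idx(1)[OF True])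
    then show ?thesis using True by (simp add: \<Phi>_def case_prod_beta)
  next
    case False
    then show ?thesis using c\<beta> by (simp add: \<Phi>_def case_prod_beta continuous_on_diff)
  qed
  show ?thesis
  proof (rule that[of H])
    show "continuous_map (top_of_set ?M) RX H"
      unfolding H_def
    proof (rule continuous_reweight[OF M cG c\<Phi> \<Phi>0])
      fix m assume m: "m \<in> ?M"
      obtain s k t where skt: "m = (s, k, t)" by (cases m)
      show "0 < mass (\<Phi> m) (G m)"
        using reweight_stratum(1)[OF Gp[OF m] \<Phi>0[OF m]] top m skt by auto
    qed
  next
    fix k t assume kt: "k \<in> K" "t \<in> ?D"
    have "\<Phi> (0, k, t) p = 1" for p
      using at0(2)[OF idx(1) kt(2)] by (simp add: \<Phi>_def \<alpha>_def \<beta>_def)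
    moreover have "G (0, k, t) = F (k, t)" using at0(1)[OF kt(2)] by (simp add: G_def \<alpha>_def)
    ultimately show "H (0, k, t) = F (k, t)" unfolding H_def using Fp[OF kt] by (simp add: reweight_one)
  next
    fix s :: real and k t assume skt: "s \<in> {0..1}" "k \<in> K" "t \<in> ?D"
    then have m: "(s, k, t) \<in> ?M" by simp
    show "nerve_to_P (real_map dm lab (H (s, k, t))) = nerve_to_P (flag_map J t)"
      unfolding H_def by (rule reweight_stratum(2)[where \<phi> = "\<Phi> (s, k, t)", OF Gp[OF m] \<Phi>0[OF m] top[OF skt]])
  next
    fix k t assume kt: "k \<in> K" "t \<in> ?D"
    then have m: "(1, k, t) \<in> ?M" by simp
    show "real_map dm lab (H (1, k, t)) = flag_map J t"
      unfolding H_def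
    proof (rule reweight_eq_flag_map[OF J kt(2) Gp[OF m] \<Phi>0[OF m], of 1])
      fix i assume i: "i \<le> ?n"
      \<comment> \<open>The quadratic bound forces \<open>t i = 0\<close> where \<open>f i\<close>
        vanishes, so \<open>e\<close> times the weight is \<open>t i\<close> even there.\<close>
      have "f i (k, \<kappa> t) = 0 \<Longrightarrow> t i = 0" using domf[OF kt(2) i kt(1)] t0[OF kt(2), of i] c by (simp add: mult_le_0_iff)
      then show "\<Phi> (1, k, t) (J ! i) * weight (G (1, k, t)) (J ! i) = 1 * t i"
        unfolding \<Phi>nth[OF i] by (auto simp: G_def e_def \<alpha>_def \<beta>_def at1(1)[OF kt(2)] simp flip: f_def)
    next
      fix p assume "p \<notin> set J"
      then show "\<Phi> (1, k, t) p * weight (G (1, k, t)) p = 0" using \<Phi>out by (simp add: \<beta>_def)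
    qed simp
  next
    fix s :: real and k t assume skt: "s \<in> {0..1}" "k \<in> K" "t \<in> ?D"
      and flagged: "\<And>u. u \<in> ?D \<Longrightarrow> real_map dm lab (F (k, u)) = flag_map J u"
    then have m: "(s, k, t) \<in> ?M" by simp
    note t = skt(3)
    have w: "weight (F (k, u)) (J ! i) = u i" if "u \<in> ?D" "i \<le> ?n" for u i
      using flagged[OF that(1)] real_map_eq_flag_map_iff[OF Fp[OF skt(2) that(1)] J that(1)] that(2) by blast
    have wz: "weight (F (k, u)) p = 0" if "u \<in> ?D" "p \<notin> set J" for u p
      using flagged[OF that(1)] real_map_eq_flag_map_iff[OF Fp[OF skt(2) that(1)] J that(1)] that(2) by blast
    have u: "\<mu> (\<alpha> s) t \<in> ?D" by (rule \<mu>[OF \<alpha>[OF skt(1)] t])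
    obtain C where C: "0 < C" "\<And>i. i \<le> ?n \<Longrightarrow> \<phi> i (\<alpha> s) t * \<mu> (\<alpha> s) t i = C * t i"
      using prp[OF \<alpha>[OF skt(1)] t] by blast
    \<comment> \<open>Over |N(P)| the weight \<open>f i\<close> at \<open>\<kappa> t\<close> is
      \<open>\<kappa> t i\<close>, so \<open>e\<close> coincides with \<open>\<phi>\<close> at time
      1, where the second stage begins.\<close>
    have e\<phi>: "\<beta> s * e i k t = \<beta> s * \<phi> i (\<alpha> s) t" if i: "i \<le> ?n" for i
      using stage[of s]
    proof
      assume "\<alpha> s = 1"
      then show ?thesis using at1(2)[OF i t] w[OF \<kappa>[OF t] i] by (simp add: e_def f_def)
    qed simp
    show "real_map dm lab (H (s, k, t)) = flag_map J t"
      unfolding H_def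
    proof (rule reweight_eq_flag_map[OF J t Gp[OF m] \<Phi>0[OF m] C(1)])
      fix i assume i: "i \<le> ?n"
      have "\<Phi> (s, k, t) (J ! i) = \<phi> i (\<alpha> s) t" unfolding \<Phi>nth[OF i] e\<phi>[OF i] by (simp add: algebra_simps)
      then show "\<Phi> (s, k, t) (J ! i) * weight (G (s, k, t)) (J ! i) = C * t i"
        using C(2)[OF i] w[OF u i] by (simp add: G_def)
    next
      fix p assume "p \<notin> set J"
      then show "\<Phi> (s, k, t) p * weight (G (s, k, t)) p = 0" using wz[OF u] by (simp add: G_def)
    qed
  qed
qed

end

section \<open>Collars of cubes and weak equivalences by compression\<close>

lemma continuous_on_Max_insert:
  fixes f :: "'i \<Rightarrow> 'a::topological_space \<Rightarrow> real"
  assumes "finite I" "\<And>i. i \<in> I \<Longrightarrow> continuous_on A (f i)"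
  shows "continuous_on A (\<lambda>x. Max (insert c ((\<lambda>i. f i x) ` I)))"
  using assms
proof (induction I)
  case (insert i I)
  have "Max (insert c ((\<lambda>i. f i x) ` insert i I)) = max (f i x) (Max (insert c ((\<lambda>i. f i x) ` I)))" for x
    using insert.hyps(1) by (simp add: insert_commute[of c])
  then show ?case using insert by (auto intro!: continuous_on_max)
qed simp

text \<open>\<open>r\<close> expands the cube radially in the maximum norm until a collar has been pushed onto the boundary.\<close>

lemma cube_collar:
  obtains r :: "real \<Rightarrow> (nat \<Rightarrow> real) \<Rightarrow> nat \<Rightarrow> real" and d :: "(nat \<Rightarrow> real) \<Rightarrow> real"
  where "continuous_on ({0..1} \<times> cube_n m) (\<lambda>z. r (fst z) (snd z))" "continuous_on (cube_n m) d"
    "\<And>s x. s \<in> {0..1} \<Longrightarrow> x \<in> cube_n m \<Longrightarrow> r s x \<in> cube_n m" "\<And>x. x \<in> cube_n m \<Longrightarrow> d x \<in> {0..1}"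
    "\<And>x. x \<in> cube_n m \<Longrightarrow> r 0 x = x" "\<And>s x. s \<in> {0..1} \<Longrightarrow> x \<in> cube_bd m \<Longrightarrow> r s x = x"
    "\<And>x. x \<in> cube_bd m \<Longrightarrow> d x = 0" "\<And>x. x \<in> cube_n m \<Longrightarrow> d x = 1 \<or> r 1 x \<in> cube_bd m"
proof -
  define \<rho> where "\<rho> x = Max (insert 0 ((\<lambda>i. \<bar>x i - 1/2\<bar>) ` {..<m}))" for x :: "nat \<Rightarrow> real"
  \<comment> \<open>Twice \<open>\<rho>\<close> is 1 exactly on the boundary. Dividing by at least
    this amount keeps the image in the cube, and the floor \<open>1 / (1 + s)\<close> sinks from 1
    to 1/2: at \<open>s = 0\<close> nothing moves, at \<open>s = 1\<close> all points with
    \<open>\<rho> x \<ge> 1/4\<close> reach the boundary.\<close>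
  define q where "q s x = max (1 / (1 + s)) (2 * \<rho> x)" for s and x :: "nat \<Rightarrow> real"
  define r where "r s x = (\<lambda>i. if i < m then 1/2 + (x i - 1/2) / q s x else 0)" for s and x :: "nat \<Rightarrow> real"
  \<comment> \<open>Equal to 1 up to \<open>\<rho> x = 1/4\<close> and falling to 0 on the boundary,
    so \<open>d\<close> drops below 1 only where \<open>r 1\<close> lands on the boundary.\<close>
  define d where "d x = min 1 (2 - 4 * \<rho> x)" for x :: "nat \<Rightarrow> real"
  have c\<rho>: "continuous_on A \<rho>" for A
    unfolding \<rho>_def by (rule continuous_on_Max_insert) (auto intro!: continuous_on_rabs continuous_on_diff continuous_on_const continuous_on_eval)
  have \<rho>0: "0 \<le> \<rho> x" for x unfolding \<rho>_def by (rule Max_ge) auto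
  have \<rho>i: "\<bar>x i - 1/2\<bar> \<le> \<rho> x" if "i < m" for x i unfolding \<rho>_def by (rule Max_ge) (use that in auto)
  have \<rho>1: "\<rho> x \<le> 1/2" if "x \<in> cube_n m" for x
  proof -
    have "\<bar>x i - 1/2\<bar> \<le> 1/2" if "i < m" for i
    proof -
      have "0 \<le> x i" "x i \<le> 1" using \<open>x \<in> cube_n m\<close> that by (auto simp: cube_n_def)
      then show ?thesis by arith
    qed
    then show ?thesis unfolding \<rho>_def by (subst Max_le_iff) auto
  qed
  have \<rho>b: "\<rho> x = 1/2" if "x \<in> cube_bd m" for x
  proof -
    obtain i where "i < m" "x i = 0 \<or> x i = 1" "x \<in> cube_n m" using \<open>x \<in> cube_bd m\<close> by (auto simp: cube_bd_def)
    then show ?thesis using \<rho>i[of i x] \<rho>1[of x] by auto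
  qed
  have q0: "0 < q s x" if "s \<in> {0..1}" for s x
    unfolding q_def using that by (auto simp: less_max_iff_disj)
  have q2: "2 * \<rho> x \<le> q s x" for s x by (simp add: q_def)
  have q1: "1 / (1 + s) \<le> 1" if "s \<in> {0..1}" for s :: real using that by simp
  have qb: "q s x = 1" if "s \<in> {0..1}" "x \<in> cube_bd m" for s x
    using q1[OF that(1)] \<rho>b[OF that(2)] by (simp add: q_def)
  have q00: "q 0 x = 1" if "x \<in> cube_n m" for x using \<rho>1[OF that] by (simp add: q_def)
  have bd: "cube_bd m \<subseteq> cube_n m" by (auto simp: cube_bd_def)
  have rid: "r s x = x" if "q s x = 1" "x \<in> cube_n m" for s x
    using that by (auto simp: r_def cube_n_def)
  have rm: "r s x \<in> cube_n m" if s: "s \<in> {0..1}" and "x \<in> cube_n m" for s x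
  proof -
    have "0 \<le> r s x i \<and> r s x i \<le> 1" if "i < m" for i
    proof -
      have "\<bar>(x i - 1/2) / q s x\<bar> \<le> 1/2"
        using \<rho>i[OF that, of x] q2[of x s] q0[OF s, of x] by (simp add: abs_divide divide_le_eq)
      then have "- (1/2) \<le> (x i - 1/2) / q s x" "(x i - 1/2) / q s x \<le> 1/2" unfolding abs_le_iff by linarith+
      then show ?thesis unfolding r_def if_P[OF that] by linarith
    qed
    then show ?thesis by (auto simp: cube_n_def r_def)
  qed
  have cq: "continuous_on ({0..1} \<times> cube_n m) (\<lambda>z. q (fst z) (snd z))"
    unfolding q_def
    by (intro continuous_on_max continuous_on_divide continuous_on_add continuous_on_mult continuous_on_const continuous_on_fst
        continuous_on_id continuous_on_compose2[OF c\<rho> continuous_on_snd[OF continuous_on_id] subset_UNIV]) auto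
  have cr: "continuous_on ({0..1} \<times> cube_n m) (\<lambda>z. r (fst z) (snd z))"
  proof (rule continuous_on_coordinatewise_then_product)
    fix i
    have "continuous_on ({0..1} \<times> cube_n m) (\<lambda>z. 1/2 + (snd z i - 1/2) / q (fst z) (snd z))"
      using q0 by (intro continuous_on_add continuous_on_divide continuous_on_diff continuous_on_const continuous_on_snd_eval cq)
        (auto simp: less_imp_neq[symmetric])
    then show "continuous_on ({0..1} \<times> cube_n m) (\<lambda>z. r (fst z) (snd z) i)"
      unfolding r_def by (cases "i < m") simp_all
  qed
  have cd: "continuous_on (cube_n m) d"
    unfolding d_def by (intro continuous_on_min continuous_on_diff continuous_on_mult continuous_on_const c\<rho>)
  have last: "d x = 1 \<or> r 1 x \<in> cube_bd m" if x: "x \<in> cube_n m" for x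
  proof (cases "\<rho> x \<le> 1/4")
    case True
    then show ?thesis by (simp add: d_def)
  next
    case False
    have "\<rho> x \<in> insert 0 ((\<lambda>i. \<bar>x i - 1/2\<bar>) ` {..<m})" unfolding \<rho>_def by (rule Max_in) auto
    then obtain i where i: "i < m" "\<rho> x = \<bar>x i - 1/2\<bar>" using False by auto
    have "q 1 x = 2 * \<bar>x i - 1/2\<bar>" using False i by (simp add: q_def)
    then have "r 1 x i = 0 \<or> r 1 x i = 1" using False i by (auto simp: r_def abs_if field_simps)
    then show ?thesis using i(1) rm[of 1 x] x by (auto simp: cube_bd_def)
  qed
  have d01: "d x \<in> {0..1}" if "x \<in> cube_n m" for x
    using \<rho>0[of x] \<rho>1[OF that] by (simp add: d_def)
  have db: "d x = 0" if "x \<in> cube_bd m" for x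
    using \<rho>b[OF that] by (simp add: d_def)
  have r0: "r 0 x = x" if "x \<in> cube_n m" for x by (rule rid[OF q00[OF that] that])
  have rb: "r s x = x" if "s \<in> {0..1}" "x \<in> cube_bd m" for s x
    by (rule rid[OF qb[OF that] subsetD[OF bd that(2)]])
  show ?thesis by (rule that) (fact cr cd rm d01 r0 rb db last)+
qed

lemma compact_cube_n: "compact (cube_n n)"
proof -
  let ?B = "Pi\<^sub>E UNIV (\<lambda>i::nat. if i < n then {0..1::real} else {0})"
  have "compactin (product_topology (\<lambda>i. euclidean) UNIV) ?B"
    by (subst compactin_PiE) auto
  moreover have "cube_n n = ?B"
  proof (rule set_eqI)
    fix t :: "nat \<Rightarrow> real"
    have "t \<in> ?B \<longleftrightarrow> (\<forall>i. t i \<in> (if i < n then {0..1} else {0}))" by (simp add: PiE_UNIV_domain Pi_iff)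
    also have "\<dots> \<longleftrightarrow> (\<forall>i. (i < n \<longrightarrow> 0 \<le> t i \<and> t i \<le> 1) \<and> (n \<le> i \<longrightarrow> t i = 0))"
      by (intro all_cong1) (simp add: not_less)
    finally show "t \<in> cube_n n \<longleftrightarrow> t \<in> ?B" unfolding cube_n_def by blast
  qed
  ultimately show ?thesis
    by (simp add: euclidean_product_topology)
qed

lemma continuous_map_deltafy:
  assumes "continuous_map T T' f"
  shows "continuous_map (deltafy T) (deltafy T') f"
  unfolding continuous_map_def
proof (intro conjI allI impI)
  show "f \<in> topspace (deltafy T) \<rightarrow> topspace (deltafy T')" using assms by (simp add: continuous_map_def)
  fix U assume U: "openin (deltafy T') U"
  show "openin (deltafy T) {x \<in> topspace (deltafy T). f x \<in> U}"
    unfolding openin_deltafy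
  proof (intro conjI allI impI)
    fix k \<sigma> assume \<sigma>: "continuous_map (Dtop k) T \<sigma>"
    have "openin (Dtop k) {t \<in> std_simplex k. (f \<circ> \<sigma>) t \<in> U}"
      using U continuous_map_compose[OF \<sigma> assms] unfolding openin_deltafy by blast
    also have "{t \<in> std_simplex k. (f \<circ> \<sigma>) t \<in> U} = {t \<in> std_simplex k. \<sigma> t \<in> {x \<in> topspace (deltafy T). f x \<in> U}}"
      using continuous_map_image_subset_topspace[OF \<sigma>] by auto
    finally show "openin (Dtop k) {t \<in> std_simplex k. \<sigma> t \<in> {x \<in> topspace (deltafy T). f x \<in> U}}" .
  qed auto
qed

lemma cube_bd_Suc:
  assumes "y \<in> cube_bd (Suc n)"
  shows "y 0 = 0 \<or> y 0 = 1 \<or> (\<lambda>i. y (Suc i)) \<in> cube_bd n"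
proof -
  obtain i where i: "i < Suc n" "y i = 0 \<or> y i = 1" and y: "y \<in> cube_n (Suc n)" using assms by (auto simp: cube_bd_def)
  show ?thesis
  proof (cases i)
    case (Suc j)
    then have "j < n" "(\<lambda>i. y (Suc i)) j = 0 \<or> (\<lambda>i. y (Suc i)) j = 1" using i by auto
    then show ?thesis using cube_uncons_in[OF y] unfolding cube_bd_def by blast
  qed (use i in auto)
qed

lemma cube_cons_bd:
  assumes "s \<in> {0..1}" "x \<in> cube_n n" "s = 0 \<or> s = 1 \<or> x \<in> cube_bd n"
  shows "cube_cons (s, x) \<in> cube_bd (Suc n)"
proof -
  have "\<exists>i<Suc n. cube_cons (s, x) i = 0 \<or> cube_cons (s, x) i = 1"
  proof (cases "s = 0 \<or> s = 1")
    case True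
    then show ?thesis by (intro exI[of _ 0]) auto
  next
    case False
    then obtain j where "j < n" "x j = 0 \<or> x j = 1" using assms(3) by (auto simp: cube_bd_def)
    then show ?thesis by (intro exI[of _ "Suc j"]) auto
  qed
  then show ?thesis using cube_cons_in[OF assms(1,2)] unfolding cube_bd_def by blast
qed

text \<open>Injectivity in degree \<open>n\<close> comes from compressing cubes of dimension \<open>n + 1\<close>, a homotopy being
  a map of such a cube.\<close>

lemma weak_homotopy_equivalence_inclusion:
  assumes inc: "continuous_map A B (\<lambda>x. x)"
    and lift: "\<And>n g. continuous_map (top_of_set (cube_n n)) B g \<Longrightarrow> g ` cube_n n \<subseteq> topspace A \<Longrightarrow>
        continuous_map (top_of_set (cube_n n)) A g"
    and compress: "\<And>n F. continuous_map (top_of_set (cube_n n)) B F \<Longrightarrow> (\<forall>x\<in>cube_bd n. F x \<in> topspace A) \<Longrightarrow>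
        \<exists>Q. continuous_map (top_of_set ({0..1::real} \<times> cube_n n)) B Q \<and> (\<forall>x\<in>cube_n n. Q (0, x) = F x) \<and>
          (\<forall>s\<in>{0..1}. \<forall>x\<in>cube_bd n. Q (s, x) = F x) \<and> (\<forall>x\<in>cube_n n. Q (1, x) \<in> topspace A)"
  shows "weak_homotopy_equivalence A B (\<lambda>x. x)"
proof -
  have AB: "topspace A \<subseteq> topspace B" using continuous_map_image_subset_topspace[OF inc] by simp
  have end1: "continuous_map (top_of_set (cube_n n)) A (\<lambda>x. Q (1, x))"
    if Q: "continuous_map (top_of_set ({0..1::real} \<times> cube_n n)) B Q" and "\<forall>x\<in>cube_n n. Q (1, x) \<in> topspace A" for n Q
  proof (rule lift)
    have "continuous_map (top_of_set (cube_n n)) (top_of_set ({0..1::real} \<times> cube_n n)) (\<lambda>x. (1, x))"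
      unfolding continuous_map_subtopology_eu by (auto intro!: continuous_on_Pair continuous_on_const continuous_on_id)
    from continuous_map_compose[OF this Q] show "continuous_map (top_of_set (cube_n n)) B (\<lambda>x. Q (1, x))" by (simp add: o_def)
  qed (use that in auto)
  have line: "continuous_map (top_of_set {0..1::real}) (top_of_set (cube_n 1)) (\<lambda>s. cube_cons (s, \<lambda>_. 0))"
    unfolding continuous_map_subtopology_eu
  proof
    have "continuous_on {0..1::real} (\<lambda>s. (s, \<lambda>_::nat. 0::real))"
      by (intro continuous_on_Pair continuous_on_const continuous_on_id)
    then show "continuous_on {0..1::real} (\<lambda>s. cube_cons (s, \<lambda>_. 0))"
      by (rule continuous_on_compose2[OF continuous_on_cube_cons _ subset_UNIV])
    show "(\<lambda>s. cube_cons (s, \<lambda>_. 0)) \<in> {0..1} \<rightarrow> cube_n 1"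
      using cube_cons_in[of _ "\<lambda>_. 0" 0] by (auto simp: cube_n_def)
  qed
  have eval0: "continuous_map (top_of_set (cube_n 1)) (top_of_set {0..1::real}) (\<lambda>x. x 0)"
    unfolding continuous_map_subtopology_eu by (auto simp: cube_n_def intro: continuous_on_eval)
  have pi0_surj: "\<exists>a\<in>topspace A. path_component_of B a b" if b: "b \<in> topspace B" for b
  proof -
    \<comment> \<open>A point is a 0-cube, and its boundary is empty; the track of its compression
      is a path into \<open>A\<close>.\<close>
    have "continuous_map (top_of_set (cube_n 0)) B (\<lambda>_. b)" using b by simp
    moreover have "cube_bd 0 = {}" by (simp add: cube_bd_def)
    ultimately obtain Q where Q: "continuous_map (top_of_set ({0..1::real} \<times> cube_n 0)) B Q"
      "\<forall>x\<in>cube_n 0. Q (0, x) = b" "\<forall>x\<in>cube_n 0. Q (1, x) \<in> topspace A"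
      using compress[of 0 "\<lambda>_. b"] by auto
    let ?o = "\<lambda>_::nat. 0::real"
    have o: "?o \<in> cube_n 0" by (simp add: cube_n_def)
    have "continuous_map (top_of_set {0..1::real}) (top_of_set ({0..1} \<times> cube_n 0)) (\<lambda>s. (s, ?o))"
      unfolding continuous_map_subtopology_eu using o by (auto intro!: continuous_on_Pair continuous_on_const continuous_on_id)
    from continuous_map_compose[OF this Q(1)] have "pathin B (\<lambda>s. Q (s, ?o))" by (simp add: pathin_def o_def)
    then have "path_component_of B b (Q (1, ?o))" unfolding path_component_of_def using Q(2) o by blast
    then show ?thesis using Q(3) o path_component_of_sym by metis
  qed
  have pi0_inj: "path_component_of A a a'" if a: "a \<in> topspace A" "a' \<in> topspace A" and p: "path_component_of B a a'" for a a'
  proof -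
    obtain g where g: "pathin B g" "g 0 = a" "g 1 = a'" using p unfolding path_component_of_def by blast
    \<comment> \<open>A path is a 1-cube with both boundary points in \<open>A\<close>; compression
      fixes them, so its final stage is a path in \<open>A\<close> between the same points.\<close>
    have F: "continuous_map (top_of_set (cube_n 1)) B (g \<circ> (\<lambda>x. x 0))"
      using eval0 g(1) unfolding pathin_def by (rule continuous_map_compose)
    have "(g \<circ> (\<lambda>x. x 0)) x \<in> topspace A" if "x \<in> cube_bd 1" for x
    proof -
      have "x 0 = 0 \<or> x 0 = 1" using that by (auto simp: cube_bd_def)
      then show ?thesis using a g by (elim disjE) simp_all
    qed
    then have "\<forall>x\<in>cube_bd 1. (g \<circ> (\<lambda>x. x 0)) x \<in> topspace A" by blast
    from compress[OF F this] obtain Q where Q: "continuous_map (top_of_set ({0..1::real} \<times> cube_n 1)) B Q"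
      "\<forall>s\<in>{0..1}. \<forall>x\<in>cube_bd 1. Q (s, x) = g (x 0)" "\<forall>x\<in>cube_n 1. Q (1, x) \<in> topspace A"
      unfolding o_def by blast
    have "pathin A (\<lambda>s. Q (1, cube_cons (s, \<lambda>_. 0)))"
      using continuous_map_compose[OF line end1[OF Q(1,3)]] by (simp add: pathin_def o_def)
    moreover have "cube_cons (s, \<lambda>_. 0) \<in> cube_bd 1" if "s = 0 \<or> s = 1" for s
      using cube_cons_bd[of s "\<lambda>_. 0" 0] that by (auto simp: cube_n_def)
    then have "Q (1, cube_cons (0, \<lambda>_. 0)) = a" "Q (1, cube_cons (1, \<lambda>_. 0)) = a'"
      using Q(2) g(2,3) by simp_all
    ultimately show ?thesis unfolding path_component_of_def
      by (intro exI[of _ "\<lambda>s. Q (1, cube_cons (s, \<lambda>_. 0))"] conjI)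
  qed
  have pi_surj: "\<exists>g. sphere_rep A a n g \<and> homotopic_rel_bd B a n g k"
    if a: "a \<in> topspace A" and k: "sphere_rep B a n k" for a n k
  proof -
    have k': "continuous_map (top_of_set (cube_n n)) B k" "\<And>x. x \<in> cube_bd n \<Longrightarrow> k x = a" using k by (auto simp: sphere_rep_def)
    have "\<forall>x\<in>cube_bd n. k x \<in> topspace A" using k'(2) a by simp
    from compress[OF k'(1) this]
    obtain Q where Q: "continuous_map (top_of_set ({0..1::real} \<times> cube_n n)) B Q" "\<forall>x\<in>cube_n n. Q (0, x) = k x"
      "\<forall>s\<in>{0..1}. \<forall>x\<in>cube_bd n. Q (s, x) = k x" "\<forall>x\<in>cube_n n. Q (1, x) \<in> topspace A"
      by blast
    have "sphere_rep A a n (\<lambda>x. Q (1, x))" using end1[OF Q(1,4)] Q(3) k'(2) by (simp add: sphere_rep_def)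
    moreover have "homotopic_rel_bd B a n k (\<lambda>x. Q (1, x))"
      unfolding homotopic_rel_bd_def
    proof (subst homotopic_with)
      show "\<exists>h. continuous_map (prod_topology (top_of_set {0..1::real}) (top_of_set (cube_n n))) B h \<and>
          (\<forall>x\<in>topspace (top_of_set (cube_n n)). h (0, x) = k x) \<and>
          (\<forall>x\<in>topspace (top_of_set (cube_n n)). h (1, x) = Q (1, x)) \<and>
          (\<forall>t\<in>{0..1}. \<forall>x\<in>cube_bd n. h (t, x) = a)"
        using Q k'(2) by (intro exI[of _ Q] conjI) simp_all
    qed (simp add: cube_bd_def)
    then have "homotopic_rel_bd B a n (\<lambda>x. Q (1, x)) k"
      unfolding homotopic_rel_bd_def by (rule homotopic_with_symD)
    ultimately show ?thesis by blast
  qed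
  have pi_inj: "homotopic_rel_bd A a n g g'"
    if a: "a \<in> topspace A" and g: "sphere_rep A a n g" "sphere_rep A a n g'" and h: "homotopic_rel_bd B a n g g'" for a n g g'
  proof -
    obtain h where h: "continuous_map (top_of_set ({0..1::real} \<times> cube_n n)) B h" "\<And>x. h (0, x) = g x" "\<And>x. h (1, x) = g' x"
      "\<And>s x. s \<in> {0..1} \<Longrightarrow> x \<in> cube_bd n \<Longrightarrow> h (s, x) = a"
      using h unfolding homotopic_rel_bd_def homotopic_with_def by auto
    have gA: "g x \<in> topspace A" "g' x \<in> topspace A" if "x \<in> cube_n n" for x
    proof -
      have "continuous_map (top_of_set (cube_n n)) A g" "continuous_map (top_of_set (cube_n n)) A g'"
        using g by (simp_all add: sphere_rep_def)
      from this[THEN continuous_map_image_subset_topspace] show "g x \<in> topspace A" "g' x \<in> topspace A"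
        using that by (simp_all add: image_subset_iff)
    qed
    have "continuous_map (top_of_set (cube_n (Suc n))) (top_of_set ({0..1::real} \<times> cube_n n)) (\<lambda>y. (y 0, \<lambda>i. y (Suc i)))"
      unfolding continuous_map_subtopology_eu using cube_uncons_in continuous_on_cube_uncons by auto
    then have F: "continuous_map (top_of_set (cube_n (Suc n))) B (h \<circ> (\<lambda>y. (y 0, \<lambda>i. y (Suc i))))"
      using h(1) by (rule continuous_map_compose)
    have "(h \<circ> (\<lambda>y. (y 0, \<lambda>i. y (Suc i)))) y \<in> topspace A" if y: "y \<in> cube_bd (Suc n)" for y
    proof -
      have "y \<in> cube_n (Suc n)" using y by (simp add: cube_bd_def)
      note u = cube_uncons_in[OF this]
      from cube_bd_Suc[OF y] show ?thesis
      proof (elim disjE)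
        assume "y 0 = 0"
        then show ?thesis using h(2) gA(1) u by simp
      next
        assume "y 0 = 1"
        then show ?thesis using h(3) gA(2) u by simp
      next
        assume "(\<lambda>i. y (Suc i)) \<in> cube_bd n"
        then show ?thesis using h(4) a u by simp
      qed
    qed
    then have "\<forall>y\<in>cube_bd (Suc n). (h \<circ> (\<lambda>y. (y 0, \<lambda>i. y (Suc i)))) y \<in> topspace A" by blast
    from compress[OF F this] obtain Q where Q: "continuous_map (top_of_set ({0..1::real} \<times> cube_n (Suc n))) B Q"
      "\<forall>s\<in>{0..1}. \<forall>y\<in>cube_bd (Suc n). Q (s, y) = h (y 0, \<lambda>i. y (Suc i))" "\<forall>x\<in>cube_n (Suc n). Q (1, x) \<in> topspace A"
      unfolding o_def by blast
    have "continuous_map (top_of_set ({0..1::real} \<times> cube_n n)) (top_of_set (cube_n (Suc n))) cube_cons"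
      unfolding continuous_map_subtopology_eu using cube_cons_in continuous_on_cube_cons by auto
    from continuous_map_compose[OF this end1[OF Q(1,3)]]
    have c: "continuous_map (top_of_set ({0..1::real} \<times> cube_n n)) A (\<lambda>z. Q (1, cube_cons z))" by (simp add: o_def)
    \<comment> \<open>Compression fixes the boundary of the larger cube, which contains both ends of
      the homotopy and its sides, so the compressed cube has the same ends and sides.\<close>
    have b: "Q (1, cube_cons (s, x)) = h (s, x)" if "s \<in> {0..1}" "x \<in> cube_n n" "s = 0 \<or> s = 1 \<or> x \<in> cube_bd n" for s x
      using Q(2)[rule_format, OF _ cube_cons_bd[OF that], of 1] by simp
    have bd: "x \<in> cube_n n" if "x \<in> cube_bd n" for x using that by (simp add: cube_bd_def)
    show ?thesis
      unfolding homotopic_rel_bd_def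
    proof (subst homotopic_with)
      show "\<exists>ha. continuous_map (prod_topology (top_of_set {0..1::real}) (top_of_set (cube_n n))) A ha \<and>
          (\<forall>x\<in>topspace (top_of_set (cube_n n)). ha (0, x) = g x) \<and>
          (\<forall>x\<in>topspace (top_of_set (cube_n n)). ha (1, x) = g' x) \<and>
          (\<forall>t\<in>{0..1}. \<forall>x\<in>cube_bd n. ha (t, x) = a)"
      proof (intro exI[of _ "\<lambda>z. Q (1, cube_cons z)"] conjI ballI)
        show "continuous_map (prod_topology (top_of_set {0..1}) (top_of_set (cube_n n))) A (\<lambda>z. Q (1, cube_cons z))"
          using c by simp
        show "Q (1, cube_cons (0, x)) = g x" if "x \<in> topspace (top_of_set (cube_n n))" for x
          using b[of 0 x] h(2) that by simp
        show "Q (1, cube_cons (1, x)) = g' x" if "x \<in> topspace (top_of_set (cube_n n))" for x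
          using b[of 1 x] h(3) that by simp
        show "Q (1, cube_cons (s, x)) = a" if "s \<in> {0..1}" "x \<in> cube_bd n" for s x
          using b[of s x] h(4)[OF that] bd[OF that(2)] that by simp
      qed
    qed (use bd in simp)
  qed
  show ?thesis
    unfolding weak_homotopy_equivalence_def o_def
    by (intro conjI ballI allI impI inc pi0_surj pi0_inj pi_surj pi_inj; (elim conjE)?; assumption)
qed

section \<open>The spaces of maps and the conclusion\<close>

context sset
begin

lemma Hol_N_subset_Hol_P: "Hol_N_set S dm act lab J \<subseteq> Hol_P_set S dm act lab J"
  unfolding Hol_N_set_def Hol_P_set_def by auto

lemma topspace_Hol_N: "topspace (Hol_N S dm act lab J) = Hol_N_set S dm act lab J"
  and topspace_Hol_P: "topspace (Hol_P S dm act lab J) = Hol_P_set S dm act lab J"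
  unfolding Hol_N_def Hol_P_def Hol_N_set_def Hol_P_set_def by (auto simp: topspace_compact_open)

text \<open>Straightening keeps boundary points in \<open>Hol_N\<close> but does not fix them. So at
  time \<open>s\<close> it is applied at the point \<open>r s x\<close> and run only up to time
  \<open>s * d x\<close>. On the boundary of the cube \<open>d\<close> is 0 and \<open>r\<close> is
  the identity, hence nothing moves. At \<open>s = 1\<close> either \<open>d x = 1\<close> and the
  map is fully straightened, or \<open>r 1 x\<close> lies on the boundary, where every stage of the
  straightening is in \<open>Hol_N\<close>.\<close>

lemma compression:
  assumes J: "flag J" and F: "continuous_map (top_of_set (cube_n m)) (Hol_P S dm act lab J) F"
    and bd: "\<forall>x\<in>cube_bd m. F x \<in> Hol_N_set S dm act lab J"
  shows "\<exists>Q. continuous_map (top_of_set ({0..1::real} \<times> cube_n m)) (Hol_P S dm act lab J) Q \<and>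
    (\<forall>x\<in>cube_n m. Q (0, x) = F x) \<and> (\<forall>s\<in>{0..1}. \<forall>x\<in>cube_bd m. Q (s, x) = F x) \<and>
    (\<forall>x\<in>cube_n m. Q (1, x) \<in> Hol_N_set S dm act lab J)"
proof -
  let ?D = "std_simplex (flag_dim J)" and ?I = "{0..1::real}"
  let ?HP = "Hol_P_set S dm act lab J" and ?HN = "Hol_N_set S dm act lab J"
  let ?CO = "compact_open (Dtop (flag_dim J)) RX"
  have FP: "F x \<in> ?HP" if "x \<in> cube_n m" for x
    using continuous_map_image_subset_topspace[OF F] that by (auto simp: topspace_Hol_P)
  have "continuous_map (top_of_set (cube_n m)) ?CO F"
    using continuous_map_from_deltafy[OF F[unfolded Hol_P_def]] by (simp add: continuous_map_in_subtopology)
  then have cF: "continuous_map (top_of_set (cube_n m \<times> ?D)) RX (\<lambda>(x, t). F x t)"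
    unfolding Dtop_def by (rule continuous_map_uncurry[OF compact_std_simplex])
  define F' where "F' = (\<lambda>(x, t). F x t)"
  have F': "F' (x, t) = F x t" for x t by (simp add: F'_def)
  have sF: "nerve_to_P (real_map dm lab (F' (x, t))) = nerve_to_P (flag_map J t)"
    if "x \<in> cube_n m" "t \<in> ?D" for x t
    using FP[OF that(1)] that(2) by (simp add: Hol_P_set_def F')
  obtain H where cH: "continuous_map (top_of_set (?I \<times> cube_n m \<times> ?D)) RX H"
    and H0: "\<And>x t. x \<in> cube_n m \<Longrightarrow> t \<in> ?D \<Longrightarrow> H (0, x, t) = F' (x, t)"
    and HP: "\<And>s x t. s \<in> ?I \<Longrightarrow> x \<in> cube_n m \<Longrightarrow> t \<in> ?D \<Longrightarrow> nerve_to_P (real_map dm lab (H (s, x, t))) = nerve_to_P (flag_map J t)"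
    and H1: "\<And>x t. x \<in> cube_n m \<Longrightarrow> t \<in> ?D \<Longrightarrow> real_map dm lab (H (1, x, t)) = flag_map J t"
    and HN: "\<And>s x t. s \<in> ?I \<Longrightarrow> x \<in> cube_n m \<Longrightarrow> t \<in> ?D \<Longrightarrow>
       (\<And>u. u \<in> ?D \<Longrightarrow> real_map dm lab (F' (x, u)) = flag_map J u) \<Longrightarrow> real_map dm lab (H (s, x, t)) = flag_map J t"
  proof -
    show thesis by (rule straightening[OF J compact_cube_n cF[folded F'_def]]) (fact sF that)+
  qed
  obtain r :: "real \<Rightarrow> (nat \<Rightarrow> real) \<Rightarrow> nat \<Rightarrow> real" and d :: "(nat \<Rightarrow> real) \<Rightarrow> real"
    where cr: "continuous_on (?I \<times> cube_n m) (\<lambda>z. r (fst z) (snd z))" and cd: "continuous_on (cube_n m) d"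
    and r: "\<And>s x. s \<in> ?I \<Longrightarrow> x \<in> cube_n m \<Longrightarrow> r s x \<in> cube_n m" and d: "\<And>x. x \<in> cube_n m \<Longrightarrow> d x \<in> ?I"
    and r0: "\<And>x. x \<in> cube_n m \<Longrightarrow> r 0 x = x" and rb: "\<And>s x. s \<in> ?I \<Longrightarrow> x \<in> cube_bd m \<Longrightarrow> r s x = x"
    and db: "\<And>x. x \<in> cube_bd m \<Longrightarrow> d x = 0" and dr: "\<And>x. x \<in> cube_n m \<Longrightarrow> d x = 1 \<or> r 1 x \<in> cube_bd m"
  proof -
    show thesis by (rule cube_collar[of m]) (fact that)
  qed
  define h where "h z = H (fst (fst z) * d (snd (fst z)), r (fst (fst z)) (snd (fst z)), snd z)"
    for z :: "(real \<times> (nat \<Rightarrow> real)) \<times> (nat \<Rightarrow> real)"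
  define Q where "Q z = restrict (\<lambda>t. h (z, t)) ?D" for z
  have sd: "s * d x \<in> ?I" if "s \<in> ?I" "x \<in> cube_n m" for s x
    using d[OF that(2)] that(1) by (auto intro: mult_le_one)
  have ch: "continuous_map (top_of_set ((?I \<times> cube_n m) \<times> ?D)) RX h"
  proof -
    let ?X = "(?I \<times> cube_n m) \<times> ?D"
    let ?g = "\<lambda>z. (fst (fst z) * d (snd (fst z)), r (fst (fst z)) (snd (fst z)), snd z)"
    have "continuous_on ?X fst" by (intro continuous_on_fst continuous_on_id)
    then have "continuous_on ?X (\<lambda>z. r (fst (fst z)) (snd (fst z)))"
      by (rule continuous_on_compose2[OF cr]) (auto simp: image_subset_iff)
    moreover have "continuous_on ?X (\<lambda>z. d (snd (fst z)))"
      by (rule continuous_on_compose2[OF cd continuous_on_snd[OF continuous_on_fst[OF continuous_on_id]]]) (auto simp: image_subset_iff)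
    ultimately have "continuous_on ?X ?g"
      by (intro continuous_on_Pair continuous_on_mult continuous_on_fst continuous_on_snd continuous_on_id)
    moreover have "?g \<in> ?X \<rightarrow> ?I \<times> cube_n m \<times> ?D"
    proof (rule funcsetI)
      fix z assume "z \<in> ?X"
      then have "fst (fst z) \<in> ?I" "snd (fst z) \<in> cube_n m" "snd z \<in> ?D" by (simp_all add: mem_Times_iff)
      then show "?g z \<in> ?I \<times> cube_n m \<times> ?D" by (intro SigmaI sd r)
    qed
    ultimately have "continuous_map (top_of_set ?X) (top_of_set (?I \<times> cube_n m \<times> ?D)) ?g"
      unfolding continuous_map_subtopology_eu by blast
    from continuous_map_compose[OF this cH] show ?thesis unfolding h_def o_def .
  qed
  have hQ: "Q (s, x) t = H (s * d x, r s x, t)" if "t \<in> ?D" for s x t using that by (simp add: Q_def h_def)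
  have cQ: "continuous_map (top_of_set (?I \<times> cube_n m)) ?CO Q"
    using continuous_map_curry[OF ch] unfolding Q_def Dtop_def .
  have Qc: "Q z \<in> extensional ?D" "continuous_map (Dtop (flag_dim J)) RX (Q z)" if "z \<in> ?I \<times> cube_n m" for z
    using continuous_map_image_subset_topspace[OF cQ] that by (auto simp: topspace_compact_open)
  have "Q z \<in> ?HP" if z: "z \<in> ?I \<times> cube_n m" for z
  proof -
    obtain s x where zz: "z = (s, x)" "s \<in> ?I" "x \<in> cube_n m" using z by auto
    have "nerve_to_P (real_map dm lab (Q z t)) = nerve_to_P (flag_map J t)" if "t \<in> ?D" for t
      unfolding zz(1) hQ[OF that] by (rule HP[OF sd[OF zz(2,3)] r[OF zz(2,3)] that])
    then show ?thesis using Qc[OF z] by (simp add: Hol_P_set_def)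
  qed
  then have "continuous_map (top_of_set (?I \<times> cube_n m)) (Hol_P S dm act lab J) Q"
    unfolding Hol_P_def using cQ
    by (intro continuous_map_into_deltafy simplex_retract_interval_cube) (auto simp: continuous_map_in_subtopology)
  moreover have fixF: "Q (s, x) = F x" if "s \<in> ?I" "x \<in> cube_n m" "s * d x = 0" "r s x = x" for s x
  proof (rule extensionalityI[where A = ?D])
    show "Q (s, x) \<in> extensional ?D" using Qc that by blast
    show "F x \<in> extensional ?D" using FP[OF that(2)] by (simp add: Hol_P_set_def)
    show "Q (s, x) t = F x t" if "t \<in> ?D" for t
      unfolding hQ[OF that] \<open>s * d x = 0\<close> \<open>r s x = x\<close> H0[OF \<open>x \<in> cube_n m\<close> that] F' ..
  qed
  moreover have "Q (1, x) \<in> ?HN" if x: "x \<in> cube_n m" for x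
  proof -
    have "real_map dm lab (Q (1, x) t) = flag_map J t" if t: "t \<in> ?D" for t
      using dr[OF x]
    proof
      assume "d x = 1"
      then show ?thesis unfolding hQ[OF t] using H1[OF r[OF _ x] t] by simp
    next
      assume "r 1 x \<in> cube_bd m"
      then have "real_map dm lab (F' (r 1 x, u)) = flag_map J u" if "u \<in> ?D" for u
        using bd that by (simp add: Hol_N_set_def F')
      then show ?thesis unfolding hQ[OF t] by (intro HN sd r x t) simp_all
    qed
    then show ?thesis using Qc[of "(1, x)"] x by (simp add: Hol_N_set_def)
  qed
  ultimately show ?thesis
    using r0 rb db by (intro exI[of _ Q]) (auto simp: cube_bd_def)
qed

text \<open>The two spaces are delta-ified separately, so \<open>Hol_N\<close> is not by definition
  a subspace of \<open>Hol_P\<close>; for maps out of retracts of simplices the difference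
  disappears.\<close>

lemma continuous_map_into_Hol_N:
  assumes "simplex_retract Y" "continuous_map Y (Hol_P S dm act lab J) g" "g ` topspace Y \<subseteq> Hol_N_set S dm act lab J"
  shows "continuous_map Y (Hol_N S dm act lab J) g"
  unfolding Hol_N_def
  using continuous_map_from_deltafy[OF assms(2)[unfolded Hol_P_def]] assms(3)
  by (intro continuous_map_into_deltafy[OF assms(1)]) (auto simp: continuous_map_in_subtopology)

lemma continuous_map_Hol_N_Hol_P: "continuous_map (Hol_N S dm act lab J) (Hol_P S dm act lab J) (\<lambda>\<sigma>. \<sigma>)"
  unfolding Hol_N_def Hol_P_def
  using Hol_N_subset_Hol_P
  by (intro continuous_map_deltafy) (auto simp: continuous_map_in_subtopology continuous_map_from_subtopology)

end

theorem theorem1p3p3: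
  fixes S :: "'x set" and dm :: "'x \<Rightarrow> nat" and act :: "(nat \<Rightarrow> nat) \<Rightarrow> nat \<Rightarrow> 'x \<Rightarrow> 'x"
    and lab :: "'x \<Rightarrow> nat \<Rightarrow> 'p::order" and J :: "'p list"
  assumes "sset_over S dm act lab"
    and "flag J"
  shows "weak_homotopy_equivalence (Hol_N S dm act lab J) (Hol_P S dm act lab J) (\<lambda>\<sigma>. \<sigma>)"
proof -
  interpret sset S dm act lab by unfold_locales (rule assms(1))
  show ?thesis
  proof (rule weak_homotopy_equivalence_inclusion)
    show "continuous_map (Hol_N S dm act lab J) (Hol_P S dm act lab J) (\<lambda>\<sigma>. \<sigma>)"
      by (rule continuous_map_Hol_N_Hol_P)
  next
    fix n g assume "continuous_map (top_of_set (cube_n n)) (Hol_P S dm act lab J) g" "g ` cube_n n \<subseteq> topspace (Hol_N S dm act lab J)"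
    then show "continuous_map (top_of_set (cube_n n)) (Hol_N S dm act lab J) g"
      by (intro continuous_map_into_Hol_N simplex_retract_cube) (simp_all add: topspace_Hol_N)
  next
    fix n F assume "continuous_map (top_of_set (cube_n n)) (Hol_P S dm act lab J) F" "\<forall>x\<in>cube_bd n. F x \<in> topspace (Hol_N S dm act lab J)"
    then show "\<exists>Q. continuous_map (top_of_set ({0..1::real} \<times> cube_n n)) (Hol_P S dm act lab J) Q \<and> (\<forall>x\<in>cube_n n. Q (0, x) = F x) \<and>
          (\<forall>s\<in>{0..1}. \<forall>x\<in>cube_bd n. Q (s, x) = F x) \<and> (\<forall>x\<in>cube_n n. Q (1, x) \<in> topspace (Hol_N S dm act lab J))"
      unfolding topspace_Hol_N by (rule compression[OF assms(2)])
  qed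
qed

end
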